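(* Let $d\ge 2$, let $S_d:=\{\vec{x}\in[0,1]^d: x_1+\ldots+x_d=1\}$, let $\mathfrak{P}_d$ be the set of permutations of $\{1,\ldots,d\}$, and let $\mathfrak{L}^X_d$ be the (convex) set of all symmetric $d$-variate stable tail dependence functions. For each $\vec{q}\in S_d$ the function $$\ell^{(d)}_{\vec{q}}(\vec{x}):=\frac{1}{(d-1)!}\sum_{\sigma\in\mathfrak{P}_d}\max\{x_1\,q_{\sigma(1)},\ldots,x_d\,q_{\sigma(d)}\},\qquad \vec{x}\in[0,\infty)^d,$$ is in $\mathfrak{L}^X_d$ and depends on $\vec{q}$ only through its equivalence class $[\vec{q}]\in S_d/{\sim}$ under permutation of coordinates, so that one may write $\ell^{(d)}_{\vec{q}}=\ell^{(d)}_{[\vec{q}]}$. Further, $\mathfrak{L}^X_d$ is a simplex with set of extreme points $\{\ell^{(d)}_{[\vec{q}]}\}_{[\vec{q}]\in S_d/{\sim}}$.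
   Context: A $d$-variate extreme-value copula is a distribution function $C:[0,1]^d\to[0,1]$ with one-dimensional margins uniform on $[0,1]$ satisfying $C(u_1^t,\ldots,u_d^t)=C(u_1,\ldots,u_d)^t$ for all $\vec{u}\in[0,1]^d$, $t>0$. Its stable tail dependence function is $\ell(\vec{x}):=-\log C(e^{-x_1},\ldots,e^{-x_d})$, $\vec{x}\in[0,\infty)^d$. By a classical result of Pickands, $\ell:[0,\infty)^d\to[0,\infty)$ is the stable tail dependence function of some $d$-variate extreme-value copula if and only if there is a random vector $\vec{Q}=(Q_1,\ldots,Q_d)$ with values in $S_d$ and $\mathbb{E}[Q_k]=1/d$ for $k=1,\ldots,d$ such that $\ell(\vec{x})=d\,\mathbb{E}[\max\{x_1Q_1,\ldots,x_dQ_d\}]$ for all $\vec{x}$; moreover the law of $\vec{Q}$ is uniquely determined by $\ell$. A stable tail dependence function is symmetric if it is invariant under permutations of its arguments. The equivalence relation on $S_d$ is: $\vec{q}\sim\vec{r}$ if there exists $\sigma\in\mathfrak{P}_d$ with $\vec{q}=(r_{\sigma(1)},\ldots,r_{\sigma(d)})$; $[\vec{q}]$ is the class of $\vec{q}$, and $S_d/{\sim}$ carries the quotient topology (it is compact Hausdorff). "Simplex" is meant in the sense of Choquet: a convex set $K$ of real-valued functions on a common domain (with the topology of pointwise convergence) is called a simplex if every element of $K$ can be represented as a mixture (pointwise integral) of extreme points of $K$ with respect to a unique Borel probability measure on the set of extreme points. Here, with extreme points parametrized by $S_d/{\sim}$, this means that for every $\ell\in\mathfrak{L}^X_d$ there is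 a unique Borel probability measure $m$ on $S_d/{\sim}$ with $\ell(\vec{x})=\int_{S_d/\sim}\ell^{(d)}_{[\vec{q}]}(\vec{x})\,m(\mathrm{d}[\vec{q}])$ for all $\vec{x}\in[0,\infty)^d$. *)

theory Defs
  imports "HOL-Probability.Probability" "HOL-Library.Function_Algebras"
begin

text \<open>
  Throughout, the index set \<open>{1, \<dots>, d}\<close> is a finite type \<open>'n\<close> with \<open>CARD('n) = d\<close>.
  A real-valued function on a domain \<open>D \<subseteq> 'a\<close> is represented by a member of \<open>extensional D\<close>
  (it takes the value \<open>undefined\<close> off \<open>D\<close>), so that HOL equality is equality on \<open>D\<close>. Affine
  combinations with coefficients summing to 1 preserve \<open>extensional D\<close>. The topology of
  \<open>'a \<Rightarrow> real\<close> is the product topology, which on \<open>extensional D\<close> is that of pointwise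
  convergence on \<open>D\<close>.
\<close>

section \<open>Convex sets of functions\<close>

text \<open>
  The pointwise vector space structure on functions, which makes \<^const>\<open>convex\<close> and
  \<^const>\<open>extreme_point_of\<close> available for sets of functions.
\<close>

instantiation "fun" :: (type, real_vector) real_vector
begin

definition scaleR_fun :: "real \<Rightarrow> ('a \<Rightarrow> 'b) \<Rightarrow> 'a \<Rightarrow> 'b" where
  "scaleR_fun c f = (\<lambda>x. c *\<^sub>R f x)"

instance
  by standard (simp_all add: scaleR_fun_def plus_fun_def scaleR_add_left scaleR_add_right)

end

definition simplex_on :: "'a set \<Rightarrow> ('a \<Rightarrow> real) set \<Rightarrow> bool" where
  "simplex_on D K \<longleftrightarrow> K \<subseteq> extensional D \<and> convex K \<and>
     (\<forall>f\<in>K. \<exists>!\<mu>. prob_space \<mu> \<and>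
        sets \<mu> = sets (restrict_space borel {g. g extreme_point_of K}) \<and>
        (\<forall>x\<in>D. integrable \<mu> (\<lambda>g. g x) \<and> f x = (\<integral>g. g x \<partial>\<mu>)))"


section \<open>Quotient topologies and their Borel sets\<close>

definition quotient_topology :: "'a topology \<Rightarrow> ('a \<times> 'a) set \<Rightarrow> 'a set topology" where
  "quotient_topology X R =
     topology (\<lambda>U. U \<subseteq> topspace X // R \<and> openin X {x \<in> topspace X. R `` {x} \<in> U})"

lemma openin_quotient_topology:
  "openin (quotient_topology X R) U \<longleftrightarrow>
     U \<subseteq> topspace X // R \<and> openin X {x \<in> topspace X. R `` {x} \<in> U}"
proof -
  have "istopology (\<lambda>U. U \<subseteq> topspace X // R \<and> openin X {x \<in> topspace X. R `` {x} \<in> U})"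
    unfolding istopology_def
  proof (intro conjI allI impI; (elim conjE)?)
    fix S T
    assume "openin X {x \<in> topspace X. R `` {x} \<in> S}" "openin X {x \<in> topspace X. R `` {x} \<in> T}"
    then have "openin X ({x \<in> topspace X. R `` {x} \<in> S} \<inter> {x \<in> topspace X. R `` {x} \<in> T})"
      by (rule openin_Int)
    also have "\<dots> = {x \<in> topspace X. R `` {x} \<in> S \<inter> T}"
      by auto
    finally show "openin X {x \<in> topspace X. R `` {x} \<in> S \<inter> T}" .
  next
    fix \<U>
    assume *: "\<forall>U\<in>\<U>. U \<subseteq> topspace X // R \<and> openin X {x \<in> topspace X. R `` {x} \<in> U}"
    then show "\<Union>\<U> \<subseteq> topspace X // R"
      by blast
    have "openin X (\<Union>U\<in>\<U>. {x \<in> topspace X. R `` {x} \<in> U})"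
      using * by blast
    also have "(\<Union>U\<in>\<U>. {x \<in> topspace X. R `` {x} \<in> U}) = {x \<in> topspace X. R `` {x} \<in> \<Union>\<U>}"
      by auto
    finally show "openin X {x \<in> topspace X. R `` {x} \<in> \<Union>\<U>}" .
  qed auto
  then show ?thesis
    by (simp add: quotient_topology_def)
qed

lemma topspace_quotient_topology: "topspace (quotient_topology X R) = topspace X // R"
proof
  show "topspace (quotient_topology X R) \<subseteq> topspace X // R"
    using openin_topspace openin_quotient_topology by blast
  have "{x \<in> topspace X. R `` {x} \<in> topspace X // R} = topspace X"
    by (auto intro: quotientI)
  then have "openin (quotient_topology X R) (topspace X // R)"
    by (simp add: openin_quotient_topology)
  then show "topspace X // R \<subseteq> topspace (quotient_topology X R)"
    by (rule openin_subset)
qed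

lemma quotient_map_quotient_topology:
  "quotient_map X (quotient_topology X R) (\<lambda>x. R `` {x})"
  by (auto simp: quotient_map_def openin_quotient_topology topspace_quotient_topology quotient_def)

definition borel_of :: "'a topology \<Rightarrow> 'a measure" where
  "borel_of X = sigma (topspace X) {U. openin X U}"


section \<open>Symmetric stable tail dependence functions\<close>

definition unit_cube :: "(real ^ 'n) set" where
  "unit_cube = {u. \<forall>k. u $ k \<in> {0..1}}"

definition orthant :: "(real ^ 'n) set" where
  "orthant = {x. \<forall>k. 0 \<le> x $ k}"

definition permute_vec :: "('n \<Rightarrow> 'n) \<Rightarrow> real ^ 'n \<Rightarrow> real ^ 'n" where
  "permute_vec \<sigma> x = (\<chi> k. x $ \<sigma> k)"

text \<open>
  Only the values of \<open>C\<close> on the unit cube are constrained (and used below). The measure \<open>M\<close> is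
  the law with distribution function \<open>C\<close>; as its margins are uniform, it is concentrated on
  the unit cube. \<open>{..u}\<close> refers to the componentwise order.
\<close>

definition copula :: "(real ^ 'n \<Rightarrow> real) \<Rightarrow> bool" where
  "copula C \<longleftrightarrow>
     (\<exists>M. prob_space M \<and> sets M = sets borel \<and>
        (\<forall>k. distr M borel (\<lambda>u. u $ k) = uniform_measure lborel {0..1}) \<and>
        (\<forall>u\<in>unit_cube. C u = measure M {..u}))"

definition extreme_value_copula :: "(real ^ 'n \<Rightarrow> real) \<Rightarrow> bool" where
  "extreme_value_copula C \<longleftrightarrow> copula C \<and>
     (\<forall>u\<in>unit_cube. \<forall>t>0. C (\<chi> k. u $ k powr t) = C u powr t)"

text \<open>
  An extreme-value copula is strictly positive on \<open>(0, 1]\<^sup>d\<close>, so the logarithm below is never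
  applied outside its proper domain.
\<close>

definition stdf_of :: "(real ^ 'n \<Rightarrow> real) \<Rightarrow> real ^ 'n \<Rightarrow> real" where
  "stdf_of C = (\<lambda>x\<in>orthant. - ln (C (\<chi> k. exp (- (x $ k)))))"

definition stdf :: "(real ^ 'n \<Rightarrow> real) \<Rightarrow> bool" where
  "stdf f \<longleftrightarrow> (\<exists>C. extreme_value_copula C \<and> f = stdf_of C)"

definition symmetric_stdfs :: "(real ^ 'n \<Rightarrow> real) set" where
  "symmetric_stdfs =
     {f. stdf f \<and> (\<forall>\<sigma>. \<sigma> permutes UNIV \<longrightarrow> (\<forall>x\<in>orthant. f (permute_vec \<sigma> x) = f x))}"


section \<open>The functions indexed by the unit simplex modulo permutations\<close>

definition unit_simplex :: "(real ^ 'n) set" where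
  "unit_simplex = {x \<in> unit_cube. (\<Sum>k\<in>UNIV. x $ k) = 1}"

definition perm_rel :: "((real ^ 'n) \<times> (real ^ 'n)) set" where
  "perm_rel = {(q, r). q \<in> unit_simplex \<and> r \<in> unit_simplex \<and>
     (\<exists>\<sigma>. \<sigma> permutes UNIV \<and> q = permute_vec \<sigma> r)}"

lemma equiv_perm_rel: "equiv unit_simplex (perm_rel :: ((real ^ 'n) \<times> (real ^ 'n)) set)"
proof (rule equivI)
  show "perm_rel \<subseteq> (unit_simplex :: (real ^ 'n) set) \<times> unit_simplex"
    unfolding perm_rel_def by blast
  have "q = permute_vec id q" for q :: "real ^ 'n"
    by (simp add: permute_vec_def)
  then show "refl_on unit_simplex (perm_rel :: ((real ^ 'n) \<times> (real ^ 'n)) set)"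
    unfolding refl_on_def perm_rel_def using permutes_id by blast
  show "sym (perm_rel :: ((real ^ 'n) \<times> (real ^ 'n)) set)"
  proof (rule symI)
    fix q r :: "real ^ 'n"
    assume "(q, r) \<in> perm_rel"
    then obtain \<sigma> where *: "q \<in> unit_simplex" "r \<in> unit_simplex" "\<sigma> permutes UNIV"
      "q = permute_vec \<sigma> r"
      unfolding perm_rel_def by blast
    have "r = permute_vec (inv \<sigma>) q"
      by (simp add: *(4) permute_vec_def permutes_inverses(1)[OF *(3)])
    then show "(r, q) \<in> perm_rel"
      unfolding perm_rel_def using *(1,2) permutes_inv[OF *(3)] by blast
  qed
  show "trans (perm_rel :: ((real ^ 'n) \<times> (real ^ 'n)) set)"
  proof (rule transI)
    fix q r s :: "real ^ 'n"
    assume "(q, r) \<in> perm_rel" "(r, s) \<in> perm_rel"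
    then obtain \<sigma> \<tau> where *: "q \<in> unit_simplex" "s \<in> unit_simplex" "\<sigma> permutes UNIV"
      "\<tau> permutes UNIV" "q = permute_vec \<sigma> (permute_vec \<tau> s)"
      unfolding perm_rel_def by blast
    have "q = permute_vec (\<tau> \<circ> \<sigma>) s"
      by (simp add: *(5) permute_vec_def)
    then show "(q, s) \<in> perm_rel"
      unfolding perm_rel_def using *(1,2) permutes_compose[OF *(3,4)] by blast
  qed
qed

definition ell :: "real ^ 'n \<Rightarrow> real ^ 'n \<Rightarrow> real" where
  "ell q = (\<lambda>x\<in>orthant.
     1 / fact (CARD('n) - 1) * (\<Sum>\<sigma> | \<sigma> permutes UNIV. MAX k. x $ k * q $ \<sigma> k))"

definition perm_quotient :: "(real ^ 'n) set topology" where
  "perm_quotient = quotient_topology (top_of_set unit_simplex) perm_rel"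

text \<open>
  \<open>ell\<close> lifted to classes: the common value of \<open>ell\<close> on \<open>c\<close>. It is meaningful because
  \<open>ell\<close> is constant on the classes of \<^const>\<open>perm_rel\<close>.
\<close>

definition ell_class :: "(real ^ 'n) set \<Rightarrow> real ^ 'n \<Rightarrow> real" where
  "ell_class c = the_elem (ell ` c)"

end

theory Submission
  imports Defs
begin

text \<open>
  By Pickands' theorem every stable tail dependence function is \<open>x \<mapsto> d \<integral>q. max\<^sub>k x\<^sub>k q\<^sub>k \<partial>\<nu>\<close> for a
  probability measure \<open>\<nu>\<close> on the simplex; averaging over permutations turns this, for symmetric
  functions, into a mixture of the functions \<open>ell q\<close>. If \<open>y\<close> has survival function \<open>exp (- f)\<close>,
  then \<open>max\<^sub>k x\<^sub>k / y\<^sub>k\<close> has a moment of order \<open>a < 1\<close> proportional to \<open>f x powr a\<close>, so \<open>f powr a\<close> is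
  represented by a tilted law of the direction of \<open>(1 / y\<^sub>k powr a)\<^sub>k\<close>; let \<open>a\<close> tend to 1 and use weak
  compactness. For uniqueness, the right derivative of the integral in one coordinate of \<open>x\<close>
  is the distribution function of \<open>q / q\<^sub>j\<close> under \<open>q\<^sub>j \<nu>(dq)\<close>. Conversely all mixtures occur, because
  the stable tail dependence functions are convex and closed under pointwise limits. Hence
  symmetric functions correspond to probability measures on the quotient, and the extreme points to
  the point masses.
\<close>


section \<open>Weak compactness of probability measures on the unit cube\<close>

text \<open>A Frechet variable of shape 1 has infinite mean, so tilting at order 1 is impossible;
  this forces the detour through \<open>f powr a\<close> with \<open>a < 1\<close>. Compactness is
  then needed only for laws on the cube, and a continuous surjection from a compact set of reals
  reduces it to tight sequences of real distributions.

  Symmetrization removes Pickands' mean condition E[Q_k] = 1/d. The sum of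
  \<open>q $ \<sigma> k\<close> over all permutations is (d-1)! times the coordinate sum, so every
  probability measure on the simplex is admissible as a mixing measure. With no constraint left, the
  extreme mixing measures are exactly the point masses on classes.

  That mixtures are stable tail dependence functions rests on survival functions: products
  correspond to minima of independent vectors, and homogeneity turns sums of exponents into such
  products. The simplex property is finally moved from the quotient to the set of extreme points
  with its pointwise topology. Compactness of the unit simplex makes the inverse of
  \<open>ell_class\<close> continuous there, so the two Borel structures agree.\<close>

lemma binary_expansion:
  fixes x :: real
  assumes "x \<in> {0..1}"
  obtains a :: "nat \<Rightarrow> bool" where "(\<lambda>i. of_bool (a i) / 2 ^ Suc i) sums x"
proof -
  \<comment> \<open>The orbit of \<open>x\<close> under the doubling map: \<open>r n\<close> is the
    remainder after \<open>n\<close> digits, scaled by \<open>2 ^ n\<close>. The endpoint 1 is a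
    fixed point with digit 1 throughout, so the closed interval is preserved.\<close>
  define r where "r = rec_nat x (\<lambda>_ y. 2 * y - of_bool (y \<ge> 1 / 2))"
  have r_Suc: "r (Suc n) = 2 * r n - of_bool (r n \<ge> 1 / 2)" for n
    by (simp add: r_def)
  have r_bounds: "r n \<in> {0..1}" for n
    by (induction n) (use assms in \<open>auto simp: r_Suc\<close>, simp_all add: r_def)
  have "(\<Sum>i<n. of_bool (r i \<ge> 1 / 2) / 2 ^ Suc i) = x - r n / 2 ^ n" for n
    by (induction n) (simp_all add: r_Suc field_simps, simp_all add: r_def)
  moreover have "(\<lambda>n. r n / 2 ^ n) \<longlonglongrightarrow> 0"
  proof (rule Lim_null_comparison)
    show "(\<lambda>n. (1 / 2) ^ n :: real) \<longlonglongrightarrow> 0"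
      by (simp add: LIMSEQ_power_zero)
    show "\<forall>\<^sub>F n in sequentially. norm (r n / 2 ^ n) \<le> (1 / 2) ^ n"
      using r_bounds by (auto simp: field_simps)
  qed
  then have "(\<lambda>n. x - r n / 2 ^ n) \<longlonglongrightarrow> x - 0"
    by (intro tendsto_intros)
  ultimately show thesis
    by (intro that[of "\<lambda>i. r i \<ge> 1 / 2"]) (simp add: sums_def)
qed

text \<open>Each digit is continuous on the product space, and the geometric majorant makes the
  partial sums converge uniformly. The index map \<open>f\<close> lets one bit sequence supply the
  digits of several coordinates.\<close>

lemma continuous_on_digit_series:
  fixes f :: "nat \<Rightarrow> nat" and b :: real
  assumes "1 < b"
  shows "continuous_on UNIV (\<lambda>a :: nat \<Rightarrow> bool. \<Sum>i. of_bool (a (f i)) / b ^ Suc i)"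
proof (rule uniform_limit_theorem)
  have cont: "continuous_on UNIV (\<lambda>a :: nat \<Rightarrow> bool. of_bool (a i) :: real)" for i
  proof -
    have "continuous_on UNIV (of_bool :: bool \<Rightarrow> real)"
      by (simp add: continuous_on_open_vimage open_discrete)
    then show ?thesis
      by (rule continuous_on_compose2[OF _ continuous_on_product_coordinates]) simp
  qed
  show "\<forall>\<^sub>F n in sequentially.
      continuous_on UNIV (\<lambda>a :: nat \<Rightarrow> bool. \<Sum>i<n. of_bool (a (f i)) / b ^ Suc i)"
    using assms by (intro always_eventually allI continuous_intros cont) auto
  show "uniform_limit UNIV (\<lambda>n a. \<Sum>i<n. of_bool (a (f i)) / b ^ Suc i)
     (\<lambda>a :: nat \<Rightarrow> bool. \<Sum>i. of_bool (a (f i)) / b ^ Suc i) sequentially"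
  proof (rule Weierstrass_m_test)
    show "norm (of_bool (a (f i)) / b ^ Suc i) \<le> (1 / b) ^ Suc i" for a :: "nat \<Rightarrow> bool" and i
      using assms by (auto simp: power_one_over field_simps)
    show "summable (\<lambda>i. (1 / b) ^ Suc i)"
      using summable_mult[OF summable_geometric[of "1 / b"], of "1 / b"] assms by simp
  qed
qed simp

text \<open>At the first place where two sequences differ the terms are \<open>1 / 3 ^ Suc n\<close>
  apart, while all later places together contribute at most half of that. In base 2 the two amounts
  would be equal and injectivity would fail.\<close>

lemma inj_ternary_digit_series: "inj (\<lambda>a :: nat \<Rightarrow> bool. \<Sum>i. of_bool (a i) / (3 :: real) ^ Suc i)"
  (is "inj ?t")
proof (rule injI, rule ccontr)
  fix a b :: "nat \<Rightarrow> bool"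
  assume eq: "?t a = ?t b" and "a \<noteq> b"
  define c where "c i = (of_bool (a i) - of_bool (b i) :: real)" for i
  define n where "n = (LEAST n. a n \<noteq> b n)"
  have "\<exists>n. a n \<noteq> b n"
    using \<open>a \<noteq> b\<close> by auto
  from LeastI_ex[OF this] have n1: "a n \<noteq> b n"
    by (simp add: n_def)
  have n2: "a i = b i" if "i < n" for i
    using not_less_Least[of i "\<lambda>n. a n \<noteq> b n"] that by (auto simp: n_def)
  have geo: "summable (\<lambda>i. (1 / 3 :: real) ^ Suc i)"
    using summable_mult[OF summable_geometric[of "1 / 3 :: real"], of "1 / 3"] by simp
  have sm: "summable (\<lambda>i. of_bool (a i) / (3 :: real) ^ Suc i)" for a :: "nat \<Rightarrow> bool"
    by (rule summable_comparison_test'[OF geo, of 0]) (auto simp: power_one_over field_simps)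
  have smc: "summable (\<lambda>i. c i / 3 ^ Suc i)"
    using summable_diff[OF sm sm, of a b] by (simp add: c_def diff_divide_distrib)
  have "0 = (\<Sum>i. c i / 3 ^ Suc i)"
    using suminf_diff[OF sm sm, of a b] eq by (simp add: c_def diff_divide_distrib)
  also have "\<dots> = (\<Sum>i. c (i + Suc n) / 3 ^ Suc (i + Suc n)) + (\<Sum>i<Suc n. c i / 3 ^ Suc i)"
    by (rule suminf_split_initial_segment[OF smc])
  also have "(\<Sum>i<Suc n. c i / 3 ^ Suc i) = c n / 3 ^ Suc n"
    using n2 by (simp add: c_def)
  finally have "c n / 3 ^ Suc n = - (\<Sum>i. c (i + Suc n) / 3 ^ Suc (i + Suc n))"
    by linarith
  then have "\<bar>c n / 3 ^ Suc n\<bar> = \<bar>\<Sum>i. c (i + Suc n) / 3 ^ Suc (i + Suc n)\<bar>"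
    by simp
  also have "\<dots> \<le> (\<Sum>i. (1 / 3) ^ Suc n * (1 / 3) ^ Suc i)"
    unfolding real_norm_def[symmetric]
    by (rule norm_suminf_le[OF _ summable_mult[OF geo]])
      (auto simp: c_def power_one_over field_simps power_add)
  also have "\<dots> = (1 / 3) ^ Suc n * (\<Sum>i. (1 / 3) ^ Suc i)"
    by (rule suminf_mult[OF geo])
  also have "(\<Sum>i. (1 / 3 :: real) ^ Suc i) = 1 / 2"
    using suminf_mult[OF summable_geometric[of "1 / 3 :: real"], of "1 / 3"]
    by (simp add: suminf_geometric)
  finally show False
    using n1 by (auto simp: c_def power_one_over field_simps split: if_splits)
qed

lemma compact_UNIV_bool_sequences: "compact (UNIV :: (nat \<Rightarrow> bool) set)"
proof -
  have "compact_space (product_topology (\<lambda>_ :: nat. euclidean :: bool topology) UNIV)"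
    by (subst compact_space_product_topology) (auto simp: compact_space_def finite_imp_compact)
  then show ?thesis
    by (simp add: euclidean_product_topology compact_space_def)
qed

lemma unit_cube_eq_cbox: "(unit_cube :: (real ^ 'n) set) = cbox 0 1"
  by (auto simp: unit_cube_def mem_box_cart)

lemma compact_unit_cube: "compact (unit_cube :: (real ^ 'n) set)"
  by (simp add: unit_cube_eq_cbox)

text \<open>The parametrization is read off the Cantor set and extended to the line by Dugundji's theorem.\<close>

lemma unit_cube_parametrization:
  obtains g :: "real \<Rightarrow> real ^ 'n" and K where "continuous_on UNIV g" "range g \<subseteq> unit_cube"
    "compact K" "g ` K = unit_cube"
proof -
  define t where "t = (\<lambda>a :: nat \<Rightarrow> bool. \<Sum>i. of_bool (a i) / (3 :: real) ^ Suc i)"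
  \<comment> \<open>Interleaving: bit \<open>to_nat (k, i)\<close> serves as the i-th binary digit
    of coordinate \<open>k\<close>.\<close>
  define h :: "(nat \<Rightarrow> bool) \<Rightarrow> real ^ 'n"
    where "h a = (\<chi> k. \<Sum>i. of_bool (a (to_nat (k, i))) / 2 ^ Suc i)" for a
  have t: "continuous_on UNIV t"
    unfolding t_def using continuous_on_digit_series[of 3 "\<lambda>i. i"] by simp
  have h: "continuous_on UNIV h"
    unfolding h_def by (intro continuous_on_vec_lambda continuous_on_digit_series) simp
  have h_cube: "h a \<in> unit_cube" for a
  proof -
    have "(\<Sum>i. of_bool (a (to_nat (k, i))) / (2 :: real) ^ Suc i) \<in> {0..1}" for k :: 'n
    proof -
      have geo: "(\<lambda>i. (1 / 2 :: real) ^ Suc i) sums 1"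
        using power_half_series .
      have sm: "summable (\<lambda>i. of_bool (a (to_nat (k, i))) / (2 :: real) ^ Suc i)"
        by (rule summable_comparison_test'[OF sums_summable[OF geo], of 0])
          (auto simp: power_one_over field_simps)
      have "(\<Sum>i. of_bool (a (to_nat (k, i))) / (2 :: real) ^ Suc i) \<le> (\<Sum>i. (1 / 2) ^ Suc i)"
        by (rule suminf_le[OF _ sm sums_summable[OF geo]]) (auto simp: power_one_over field_simps)
      then show ?thesis
        using sums_unique[OF geo] suminf_nonneg[OF sm] by simp
    qed
    then show ?thesis
      by (simp add: unit_cube_def h_def)
  qed
  have h_surj: "\<exists>a. h a = u" if "u \<in> unit_cube" for u
  proof -
    have "\<exists>a :: nat \<Rightarrow> bool. (\<lambda>i. of_bool (a i) / 2 ^ Suc i) sums (u $ k)" for k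
      using that binary_expansion[of "u $ k"] by (auto simp: unit_cube_def)
    then obtain a :: "'n \<Rightarrow> nat \<Rightarrow> bool"
      where "\<And>k. (\<lambda>i. of_bool (a k i) / 2 ^ Suc i) sums (u $ k)"
      by metis
    then have "h (\<lambda>n. case from_nat n of (k, i) \<Rightarrow> a k i) = u"
      by (simp add: h_def vec_eq_iff sums_iff)
    then show ?thesis
      by blast
  qed
  have inj: "inj t"
    unfolding t_def by (rule inj_ternary_digit_series)
  have K: "compact (range t)"
    by (rule compact_continuous_image[OF t compact_UNIV_bool_sequences])
  \<comment> \<open>A continuous injection on a compact space has a continuous inverse, so the cube
    becomes a continuous image of the Cantor-like set \<open>range t\<close>.\<close>
  have "continuous_on (range t) (inv t)"
    by (rule continuous_on_inv[OF t compact_UNIV_bool_sequences]) (simp add: inj)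
  then have "continuous_on (range t) (h \<circ> inv t)"
    by (intro continuous_on_compose continuous_on_subset[OF h]) auto
  then obtain g where g: "continuous_on UNIV g" "g ` UNIV \<subseteq> unit_cube"
    "\<And>x. x \<in> range t \<Longrightarrow> g x = (h \<circ> inv t) x"
    using Dugundji[of unit_cube UNIV "range t" "h \<circ> inv t"] h_cube compact_imp_closed[OF K]
    by (auto simp: unit_cube_eq_cbox image_subset_iff)
  have "g ` range t = h ` UNIV"
    using g(3) by (auto simp: inv_f_f[OF inj] image_iff)
  also have "\<dots> = unit_cube"
    using h_cube h_surj by (auto simp: image_iff) metis
  finally show thesis
    using that[OF g(1,2) K] by simp
qed

text \<open>The laws are carried to the line by a Borel section \<open>s\<close> of the
  parametrization \<open>g\<close>, where boundedness gives tightness; the weak limit found there is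
  pushed back by \<open>g\<close>. Integrals survive the round trip because
  \<open>g (s q) = q\<close> on the cube. A continuous test function becomes bounded after
  composition with \<open>g\<close>.\<close>

lemma weakly_convergent_subsequence_unit_cube:
  fixes N :: "nat \<Rightarrow> (real ^ 'n) measure"
  assumes N: "\<And>n. prob_space (N n)" "\<And>n. sets (N n) = sets borel" "\<And>n. AE q in N n. q \<in> unit_cube"
  obtains r \<nu> where "strict_mono (r :: nat \<Rightarrow> nat)" "prob_space \<nu>" "sets \<nu> = sets borel"
    "AE q in \<nu>. q \<in> unit_cube"
    "\<And>\<phi> :: real ^ 'n \<Rightarrow> real. continuous_on UNIV \<phi> \<Longrightarrow>
      (\<lambda>n. \<integral>q. \<phi> q \<partial>N (r n)) \<longlonglongrightarrow> (\<integral>q. \<phi> q \<partial>\<nu>)"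
proof -
  obtain g :: "real \<Rightarrow> real ^ 'n" and K where g: "continuous_on UNIV g" "range g \<subseteq> unit_cube"
    "compact K" "g ` K = unit_cube"
    by (rule unit_cube_parametrization)
  obtain b where b: "0 < b" "\<And>t. t \<in> K \<Longrightarrow> \<bar>t\<bar> < b"
    using compact_imp_bounded[OF g(3)] by (auto simp: bounded_pos_less)
  define s where "s q = (if q \<in> unit_cube then Inf {t \<in> K. g t = q} else b)" for q
  have s_mem: "s q \<in> K \<and> g (s q) = q" and s_le: "\<And>t. t \<in> K \<Longrightarrow> g t = q \<Longrightarrow> s q \<le> t"
    if "q \<in> unit_cube" for q
  proof -
    have "{t \<in> K. g t = q} = K \<inter> g -` {q}"
      by auto
    moreover have "closed (g -` {q})"
      using continuous_closed_vimage[of "{q}" g] g(1)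
      by (auto simp: continuous_on_eq_continuous_at)
    ultimately have cpt: "compact {t \<in> K. g t = q}"
      using compact_Int_closed[OF g(3)] by simp
    have ne: "{t \<in> K. g t = q} \<noteq> {}"
      using that unfolding g(4)[symmetric] by auto
    have "Inf {t \<in> K. g t = q} \<in> {t \<in> K. g t = q}"
      using cpt ne
      by (intro closed_contains_Inf) (auto intro: bounded_imp_bdd_below compact_imp_bounded compact_imp_closed)
    then show "s q \<in> K \<and> g (s q) = q"
      using that by (simp add: s_def)
    show "\<And>t. t \<in> K \<Longrightarrow> g t = q \<Longrightarrow> s q \<le> t"
      using that cpt by (auto simp: s_def intro!: cInf_lower bounded_imp_bdd_below compact_imp_bounded)
  qed
  have s_meas: "s \<in> borel_measurable borel"
  proof (rule borel_measurable_iff_le[THEN iffD2], rule allI)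
    fix t
    have compact_g: "compact (g ` (K \<inter> {..t}))"
      using g(1,3) by (intro compact_continuous_image compact_Int_closed)
        (auto intro: continuous_on_subset)
    have eq: "{q \<in> unit_cube. s q \<le> t} = g ` (K \<inter> {..t})"
    proof (intro equalityI subsetI)
      fix q assume "q \<in> {q \<in> unit_cube. s q \<le> t}"
      then show "q \<in> g ` (K \<inter> {..t})"
        using s_mem by (auto intro!: image_eqI[of _ _ "s q"])
    next
      fix q assume "q \<in> g ` (K \<inter> {..t})"
      then show "q \<in> {q \<in> unit_cube. s q \<le> t}"
        using s_le g(2) by fastforce
    qed
    have "{q. s q \<le> t} = g ` (K \<inter> {..t}) \<union> (if b \<le> t then - unit_cube else {})"
      unfolding eq[symmetric] by (auto simp: s_def)
    also have "\<dots> \<in> sets borel"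
      using borel_closed[OF compact_imp_closed[OF compact_g]] by (auto simp: unit_cube_eq_cbox)
    finally show "{q \<in> space borel. s q \<le> t} \<in> sets borel"
      by simp
  qed
  have s_meas' [measurable]: "s \<in> borel_measurable (N n)" for n
    using s_meas N(2) by (simp cong: measurable_cong_sets)
  define L where "L n = distr (N n) borel s" for n
  have "real_distribution (L n)" for n
  proof -
    interpret prob_space "N n" by (rule N)
    show ?thesis
      unfolding L_def by (rule real_distribution_distr) simp
  qed
  moreover have "measure (L n) {-b - 1<..b} = 1" for n
  proof -
    interpret prob_space "N n" by (rule N)
    have "AE q in N n. s q \<in> {-b - 1<..b}"
      using N(3) by eventually_elim (use s_mem b in \<open>fastforce simp: s_def\<close>)
    then have "prob (s -` {-b - 1<..b} \<inter> space (N n)) = 1"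
      by (intro prob_eq_1[THEN iffD2]) (auto elim!: AE_mp)
    then show ?thesis
      by (simp add: L_def measure_distr)
  qed
  ultimately have tight: "tight L"
    unfolding tight_def using b(1)
    by (intro conjI allI impI exI[of _ "-b - 1"] exI[of _ b]) auto
  obtain r M where r: "strict_mono r" "real_distribution M" "weak_conv_m (L \<circ> id \<circ> r) M"
    using tight_imp_convergent_subsubsequence[OF tight, of id] by (auto simp: strict_mono_def)
  interpret M: real_distribution M by fact
  have g_meas [measurable]: "g \<in> borel_measurable borel"
    using g(1) by (rule borel_measurable_continuous_onI)
  show thesis
  proof (rule that[OF r(1)])
    show "prob_space (distr M borel g)"
      by (rule M.prob_space_distr) simp
    show "sets (distr M borel g) = sets borel"
      by simp
    show "AE q in distr M borel g. q \<in> unit_cube"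
      using g(2) by (subst AE_distr_iff) (auto simp: unit_cube_eq_cbox)
    fix \<phi> :: "real ^ 'n \<Rightarrow> real" assume \<phi>: "continuous_on UNIV \<phi>"
    then have [measurable]: "\<phi> \<in> borel_measurable borel"
      by (rule borel_measurable_continuous_onI)
    obtain B where B: "\<And>q. q \<in> unit_cube \<Longrightarrow> norm (\<phi> q) \<le> B"
      by (rule continuous_on_compact_bound[OF compact_unit_cube continuous_on_subset[OF \<phi>]]) auto
    have "(\<lambda>n. integral\<^sup>L ((L \<circ> id \<circ> r) n) (\<lambda>t. \<phi> (g t))) \<longlonglongrightarrow> integral\<^sup>L M (\<lambda>t. \<phi> (g t))"
    proof (rule weak_conv_imp_integral_bdd_continuous_conv[OF _ r(2,3)])
      show "real_distribution ((L \<circ> id \<circ> r) n)" for n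
        using tight by (simp add: tight_def)
      show "isCont (\<lambda>t. \<phi> (g t)) t" for t
        using continuous_on_compose2[OF \<phi> g(1)] by (simp add: continuous_on_eq_continuous_at)
      show "norm (\<phi> (g t)) \<le> B" for t
        using B g(2) by auto
    qed
    moreover have "integral\<^sup>L ((L \<circ> id \<circ> r) n) (\<lambda>t. \<phi> (g t)) = (\<integral>q. \<phi> q \<partial>N (r n))" for n
    proof -
      have "integral\<^sup>L ((L \<circ> id \<circ> r) n) (\<lambda>t. \<phi> (g t)) = (\<integral>q. \<phi> (g (s q)) \<partial>N (r n))"
        by (simp add: L_def integral_distr)
      also have "\<dots> = (\<integral>q. \<phi> q \<partial>N (r n))"
      proof (rule integral_cong_AE)
        show "AE q in N (r n). \<phi> (g (s q)) = \<phi> q"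
          using N(3)[of "r n"] by eventually_elim (use s_mem in auto)
        show "(\<lambda>q. \<phi> (g (s q))) \<in> borel_measurable (N (r n))"
          by measurable
        show "\<phi> \<in> borel_measurable (N (r n))"
          using N(2) by (simp cong: measurable_cong_sets)
      qed
      finally show ?thesis .
    qed
    ultimately show "(\<lambda>n. \<integral>q. \<phi> q \<partial>N (r n)) \<longlonglongrightarrow> (\<integral>q. \<phi> q \<partial>distr M borel g)"
      by (simp add: integral_distr)
  qed
qed


section \<open>Weighted maxima and survival functions\<close>

definition wmax :: "real ^ 'n \<Rightarrow> real ^ 'n \<Rightarrow> real" where
  "wmax x q = (MAX k. x $ k * q $ k)"

lemma wmax_le_iff: "wmax x q \<le> r \<longleftrightarrow> (\<forall>k. x $ k * q $ k \<le> r)"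
  unfolding wmax_def by (subst Max_le_iff) auto

lemma wmax_upper: "x $ k * q $ k \<le> wmax x q"
  using wmax_le_iff[of x q "wmax x q"] by simp

lemma wmax_attained: obtains k where "wmax x q = x $ k * q $ k"
proof -
  have "wmax x q \<in> range (\<lambda>k. x $ k * q $ k)"
    unfolding wmax_def by (rule Max_in) auto
  then show thesis
    using that by auto
qed

lemma wmax_commute: "wmax x q = wmax q x"
  by (simp add: wmax_def mult.commute)

lemma wmax_nonneg:
  assumes "x \<in> orthant" "q \<in> orthant"
  shows "0 \<le> wmax x q"
  using assms wmax_attained[of x q] by (metis (mono_tags) mem_Collect_eq orthant_def mult_nonneg_nonneg)

lemma wmax_scaleR_left:
  assumes "0 \<le> t"
  shows "wmax (t *\<^sub>R x) q = t * wmax x q"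
proof (rule antisym)
  show "wmax (t *\<^sub>R x) q \<le> t * wmax x q"
    using assms wmax_upper[of x _ q] by (simp add: wmax_le_iff mult.assoc mult_left_mono)
  obtain k where "wmax x q = x $ k * q $ k"
    by (rule wmax_attained)
  then show "t * wmax x q \<le> wmax (t *\<^sub>R x) q"
    using wmax_upper[of "t *\<^sub>R x" k q] by (simp add: mult.assoc)
qed

lemma wmax_scaleR_right: "0 \<le> t \<Longrightarrow> wmax x (t *\<^sub>R q) = t * wmax x q"
  using wmax_scaleR_left[of t q x] by (simp add: wmax_commute)

lemma wmax_axis:
  assumes "0 \<le> t" "q \<in> orthant"
  shows "wmax (axis k t) q = t * q $ k"
proof (rule antisym)
  show "wmax (axis k t) q \<le> t * q $ k"
    using assms by (auto simp: wmax_le_iff axis_def orthant_def)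
  show "t * q $ k \<le> wmax (axis k t) q"
    using wmax_upper[of "axis k t" k q] by (simp add: axis_def)
qed

text \<open>Each term changes by at most its own summand. Keeping the weights
  \<open>\<bar>q $ k\<bar>\<close> yields the dominating function \<open>\<bar>q $ j\<bar>\<close>
  for difference quotients in direction \<open>j\<close>; on the cube the weights are at most 1,
  which gives a Lipschitz bound uniform in \<open>q\<close>.\<close>

lemma wmax_diff_le: "\<bar>wmax x q - wmax y q\<bar> \<le> (\<Sum>k\<in>UNIV. \<bar>x $ k - y $ k\<bar> * \<bar>q $ k\<bar>)"
proof -
  have *: "wmax x q \<le> wmax y q + (\<Sum>k\<in>UNIV. \<bar>x $ k - y $ k\<bar> * \<bar>q $ k\<bar>)" for x y
  proof -
    have "x $ k * q $ k \<le> wmax y q + (\<Sum>k\<in>UNIV. \<bar>x $ k - y $ k\<bar> * \<bar>q $ k\<bar>)" for k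
    proof -
      have "x $ k * q $ k = y $ k * q $ k + (x $ k - y $ k) * q $ k"
        by (simp add: algebra_simps)
      also have "(x $ k - y $ k) * q $ k \<le> \<bar>x $ k - y $ k\<bar> * \<bar>q $ k\<bar>"
        by (metis abs_ge_self abs_mult)
      also have "\<dots> \<le> (\<Sum>k\<in>UNIV. \<bar>x $ k - y $ k\<bar> * \<bar>q $ k\<bar>)"
        by (rule member_le_sum) auto
      finally show ?thesis
        using wmax_upper[of y k q] by linarith
    qed
    then show ?thesis
      by (simp add: wmax_le_iff)
  qed
  show ?thesis
    using *[of x y] *[of y x] by (simp add: abs_minus_commute abs_le_iff)
qed

lemma continuous_on_wmax [continuous_intros]:
  assumes "continuous_on A f" "continuous_on A g"
  shows "continuous_on A (\<lambda>z. wmax (f z) (g z))"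
proof -
  have "continuous_on A (\<lambda>z. Max ((\<lambda>k. f z $ k * g z $ k) ` I))" if "finite I" "I \<noteq> {}" for I
    using that
  proof (induction rule: finite_ne_induct)
    case (singleton k)
    then show ?case
      using assms by (auto intro!: continuous_intros)
  next
    case (insert k I)
    then have "continuous_on A (\<lambda>z. max (f z $ k * g z $ k) (Max ((\<lambda>k. f z $ k * g z $ k) ` I)))"
      using assms by (intro continuous_intros)
    then show ?case
      using insert by simp
  qed
  from this[of UNIV] show ?thesis
    by (simp add: wmax_def)
qed

lemma borel_measurable_wmax [measurable]:
  assumes "f \<in> borel_measurable M" "g \<in> borel_measurable M"
  shows "(\<lambda>z. wmax (f z) (g z)) \<in> borel_measurable M"
proof -
  have "continuous_on UNIV (\<lambda>z :: (real ^ 'n) \<times> (real ^ 'n). wmax (fst z) (snd z))"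
    by (intro continuous_intros)
  then show ?thesis
    by (rule borel_measurable_continuous_Pair[OF assms])
qed

lemma borel_measurable_vec_lambda [measurable (raw)]:
  fixes f :: "'a \<Rightarrow> 'n :: finite \<Rightarrow> real"
  assumes "\<And>k. (\<lambda>z. f z k) \<in> borel_measurable M"
  shows "(\<lambda>z. \<chi> k. f z k) \<in> borel_measurable M"
  by (rule borel_measurable_euclidean_space[THEN iffD2])
    (auto simp: Basis_vec_def inner_axis assms)

lemma borel_measurable_vec_component [measurable (raw)]:
  fixes f :: "'a \<Rightarrow> real ^ 'n"
  assumes "f \<in> borel_measurable M"
  shows "(\<lambda>z. f z $ k) \<in> borel_measurable M"
  using assms by (rule measurable_compose) (intro borel_measurable_continuous_onI continuous_intros)

section \<open>The orthant and the unit simplex\<close>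

lemma orthant_scaleR: "x \<in> orthant \<Longrightarrow> 0 \<le> t \<Longrightarrow> t *\<^sub>R x \<in> orthant"
  by (simp add: orthant_def)

lemma orthant_axis: "0 \<le> t \<Longrightarrow> axis k t \<in> orthant"
  by (simp add: orthant_def axis_def)

lemma unit_simplex_subset_orthant: "unit_simplex \<subseteq> orthant"
  by (auto simp: unit_simplex_def unit_cube_def orthant_def)

lemma unit_simplexI:
  assumes "q \<in> orthant" "(\<Sum>k\<in>UNIV. q $ k) = 1"
  shows "q \<in> unit_simplex"
proof -
  have "q $ k \<le> 1" for k
    using member_le_sum[of k UNIV "\<lambda>k. q $ k"] assms by (auto simp: orthant_def)
  then show ?thesis
    using assms by (auto simp: unit_simplex_def unit_cube_def orthant_def)
qed

lemma closed_unit_simplex: "closed (unit_simplex :: (real ^ 'n) set)"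
proof -
  have eq: "unit_simplex = cbox 0 1 \<inter> {x :: real ^ 'n. (\<Sum>k\<in>UNIV. x $ k) = 1}"
    by (auto simp: unit_simplex_def simp flip: unit_cube_eq_cbox)
  have "closed {x :: real ^ 'n. (\<Sum>k\<in>UNIV. x $ k) = 1}"
    by (intro closed_Collect_eq continuous_intros)
  then show ?thesis
    unfolding eq by (intro closed_Int closed_cbox)
qed

lemma compact_unit_simplex: "compact (unit_simplex :: (real ^ 'n) set)"
proof -
  have "unit_simplex \<subseteq> (cbox 0 1 :: (real ^ 'n) set)"
    by (auto simp: unit_simplex_def simp flip: unit_cube_eq_cbox)
  then show ?thesis
    using closed_unit_simplex compact_Int_closed[OF compact_cbox] by (metis inf.absorb2)
qed

lemma borel_unit_simplex [measurable]: "unit_simplex \<in> sets borel"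
  and borel_unit_cube [measurable]: "unit_cube \<in> sets borel"
  by (simp_all add: borel_closed closed_unit_simplex unit_cube_eq_cbox)

lemma measure_uniform_unit_interval_atMost:
  assumes "v \<in> {0..1}"
  shows "measure (uniform_measure lborel {0..1 :: real}) {..v} = v"
proof -
  have "{0..1} \<inter> {..v} = {0..v}"
    using assms by auto
  then show ?thesis
    using assms by (simp add: measure_uniform_measure)
qed

text \<open>
  In the coordinates \<open>y = - ln u\<close>, a stable tail dependence function is a homogeneous function
  \<open>f\<close> such that \<open>exp (- f)\<close> is the survival function of a law with standard exponential margins.
\<close>

lemma stdf_survivalD:
  assumes "stdf (f :: real ^ 'n \<Rightarrow> real)"
  shows "f \<in> extensional orthant"
    and "\<And>x t. x \<in> orthant \<Longrightarrow> 0 < t \<Longrightarrow> f (t *\<^sub>R x) = t * f x"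
    and "\<And>k t. 0 \<le> t \<Longrightarrow> f (axis k t) = t"
    and "\<exists>N. prob_space N \<and> sets N = sets borel \<and> (\<forall>x\<in>orthant. measure N {x..} = exp (- f x))"
proof -
  obtain C where C: "\<And>u t. u \<in> unit_cube \<Longrightarrow> 0 < t \<Longrightarrow> C (\<chi> k. u $ k powr t) = C u powr t"
    and f: "f = stdf_of C" and "copula C"
    using assms unfolding stdf_def extreme_value_copula_def by blast
  then obtain M where M: "prob_space M" "sets M = sets borel"
    and marg: "\<And>k. distr M borel (\<lambda>u. u $ k) = uniform_measure lborel {0..1}"
    and CM: "\<And>u. u \<in> unit_cube \<Longrightarrow> C u = measure M {..u}"
    unfolding copula_def by blast
  interpret M: prob_space M by fact
  have sets_M [measurable_cong]: "sets M = sets borel" by fact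
  have space_M: "space M = UNIV"
    using M(2) sets_eq_imp_space_eq by fastforce
  define e where "e x = (\<chi> k. exp (- (x $ k)))" for x :: "real ^ 'n"
  have e_cube: "e x \<in> unit_cube" if "x \<in> orthant" for x
    using that by (simp add: e_def unit_cube_def orthant_def)
  have M_le: "measure M {u. u $ k \<le> v} = v" if "v \<in> {0..1}" for k v
    using measure_uniform_unit_interval_atMost[OF that] marg[of k, symmetric]
    by (simp add: measure_distr space_M vimage_def)
  have M_AE: "AE u in M. \<forall>k. 0 < u $ k \<and> u $ k \<le> 1"
  proof (subst AE_all_countable, rule allI)
    fix k
    have "AE u in M. \<not> u $ k \<le> 0"
      using M_le[of 0 k] by (intro AE_I[of _ _ "{u. u $ k \<le> 0}"]) (auto simp: M.emeasure_eq_measure)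
    moreover have "AE u in M. u $ k \<le> 1"
      using M_le[of 1 k] M.prob_eq_1[of "{u. u $ k \<le> 1}"] by auto
    ultimately show "AE u in M. 0 < u $ k \<and> u $ k \<le> 1"
      by eventually_elim auto
  qed
  have e_scale: "(\<chi> k. e x $ k powr t) = e (t *\<^sub>R x)" for x t
    by (simp add: e_def vec_eq_iff powr_def)
  \<comment> \<open>A zero of \<open>C\<close> would propagate along the whole ray, since passing
    from \<open>x\<close> to \<open>t *\<^sub>R x\<close> raises the value to the power
    \<open>t\<close>. Close to the origin, however, the union bound over the uniform margins keeps
    \<open>C\<close> above 1 minus \<open>t\<close> times the coordinate sum. The added 1 in the
    denominator of \<open>t\<close> makes this bound positive, also for
    \<open>x = 0\<close>.\<close>
  have C_pos: "0 < C (e x)" if x: "x \<in> orthant" for x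
  proof (rule ccontr)
    assume "\<not> 0 < C (e x)"
    then have "C (e x) = 0"
      using CM[OF e_cube[OF x]] by (simp add: not_less measure_le_0_iff)
    define t where "t = 1 / (1 + (\<Sum>k\<in>UNIV. x $ k))"
    have sum_nonneg: "0 \<le> (\<Sum>k\<in>UNIV. x $ k)"
      using x by (auto simp: orthant_def intro: sum_nonneg)
    then have t: "0 < t" "t * (\<Sum>k\<in>UNIV. x $ k) < 1"
      by (auto simp: t_def field_simps)
    have tx: "t *\<^sub>R x \<in> orthant"
      using x t by (intro orthant_scaleR) auto
    have "1 - measure M {..e (t *\<^sub>R x)} = measure M (space M - {..e (t *\<^sub>R x)})"
      by (rule M.prob_compl[symmetric]) simp
    also have "space M - {..e (t *\<^sub>R x)} = (\<Union>k. {u. \<not> u $ k \<le> e (t *\<^sub>R x) $ k})"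
      by (auto simp: space_M less_eq_vec_def)
    also have "measure M \<dots> \<le> (\<Sum>k\<in>UNIV. measure M {u. \<not> u $ k \<le> e (t *\<^sub>R x) $ k})"
      by (rule measure_UNION_le) auto
    also have "\<dots> \<le> (\<Sum>k\<in>UNIV. t * x $ k)"
    proof (rule sum_mono)
      fix k
      have "measure M {u. \<not> u $ k \<le> e (t *\<^sub>R x) $ k}
        = 1 - measure M {u. u $ k \<le> e (t *\<^sub>R x) $ k}"
        by (subst M.prob_compl[symmetric]) (auto simp: space_M intro!: arg_cong[where f = "measure M"])
      also have "\<dots> = 1 - exp (- (t * x $ k))"
        using e_cube[OF tx] by (subst M_le) (auto simp: unit_cube_def, simp add: e_def)
      also have "\<dots> \<le> t * x $ k"
        using exp_ge_add_one_self[of "- (t * x $ k)"] by simp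
      finally show "measure M {u. \<not> u $ k \<le> e (t *\<^sub>R x) $ k} \<le> t * x $ k" .
    qed
    also have "\<dots> < 1"
      using t(2) by (simp add: sum_distrib_left)
    finally have "0 < C (e (t *\<^sub>R x))"
      using CM[OF e_cube[OF tx]] by simp
    moreover have "C (e (t *\<^sub>R x)) = 0"
      using C[OF e_cube[OF x] t(1)] \<open>C (e x) = 0\<close> by (simp add: e_scale)
    ultimately show False
      by simp
  qed
  have f_eq: "f x = - ln (C (e x))" if "x \<in> orthant" for x
    using that by (simp add: f stdf_of_def e_def)
  have C_e: "C (e x) = exp (- f x)" if "x \<in> orthant" for x
    using that by (simp add: f_eq C_pos)
  show "f \<in> extensional orthant"
    by (simp add: f stdf_of_def)
  show "f (t *\<^sub>R x) = t * f x" if "x \<in> orthant" "0 < t" for x t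
    using C[OF e_cube[OF that(1)] that(2)] C_pos[OF that(1)] that
    by (simp add: f_eq orthant_scaleR e_scale ln_powr)
  show "f (axis k t) = t" if "0 \<le> t" for k t
  proof -
    have "C (e (axis k t)) = measure M {..e (axis k t)}"
      by (rule CM[OF e_cube[OF orthant_axis[OF that]]])
    also have "\<dots> = measure M {u. u $ k \<le> exp (- t)}"
    proof (rule M.finite_measure_eq_AE)
      show "AE u in M. (u \<in> {..e (axis k t)}) = (u \<in> {u. u $ k \<le> exp (- t)})"
        using M_AE by eventually_elim (auto simp: less_eq_vec_def e_def axis_def split: if_splits)
    qed auto
    also have "\<dots> = exp (- t)"
      using that by (intro M_le) auto
    finally show ?thesis
      using that by (simp add: f_eq orthant_axis)
  qed
  define L :: "real ^ 'n \<Rightarrow> real ^ 'n" where "L u = (\<chi> k. - ln (u $ k))" for u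
  have L [measurable]: "L \<in> borel_measurable borel"
    unfolding L_def by measurable
  have "measure (distr M borel L) {x..} = exp (- f x)" if "x \<in> orthant" for x
  proof -
    have "measure (distr M borel L) {x..} = measure M (L -` {x..} \<inter> space M)"
      by (rule measure_distr) auto
    also have "\<dots> = measure M {..e x}"
    proof (rule M.finite_measure_eq_AE)
      show "AE u in M. (u \<in> L -` {x..} \<inter> space M) = (u \<in> {..e x})"
        using M_AE
      proof eventually_elim
        case (elim u)
        have "(x $ k \<le> - ln (u $ k)) = (u $ k \<le> exp (- (x $ k)))" for k
          using elim ln_le_cancel_iff[of "u $ k" "exp (- (x $ k))"] by (simp add: le_minus_iff)
        then show ?case
          by (auto simp: less_eq_vec_def L_def e_def space_M)
      qed
    qed auto
    also have "\<dots> = exp (- f x)"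
      using CM[OF e_cube[OF that]] C_e[OF that] by simp
    finally show ?thesis .
  qed
  then show "\<exists>N. prob_space N \<and> sets N = sets borel \<and> (\<forall>x\<in>orthant. measure N {x..} = exp (- f x))"
    using M.prob_space_distr[of L borel] by (intro exI[of _ "distr M borel L"]) auto
qed

text \<open>Under \<open>y \<mapsto> exp (- y)\<close> the values on the axes become uniform
  margins, and homogeneity becomes the power identity of an extreme-value copula. Boundary points of
  the cube with a zero coordinate come from no finite \<open>y\<close>; there both sides of the
  identity vanish because the margins have no mass at 0.\<close>

lemma stdf_survivalI:
  fixes f :: "real ^ 'n \<Rightarrow> real"
  assumes ext: "f \<in> extensional orthant"
    and hom: "\<And>x t. x \<in> orthant \<Longrightarrow> 0 < t \<Longrightarrow> f (t *\<^sub>R x) = t * f x"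
    and axis: "\<And>k t. 0 \<le> t \<Longrightarrow> f (axis k t) = t"
    and N: "prob_space N" "sets N = sets borel"
    and surv: "\<And>x. x \<in> orthant \<Longrightarrow> measure N {x..} = exp (- f x)"
  shows "stdf f"
proof -
  interpret N: prob_space N by fact
  have sets_N [measurable_cong]: "sets N = sets borel" by fact
  have space_N: "space N = UNIV"
    using N(2) sets_eq_imp_space_eq by fastforce
  have axis_0: "axis k (0 :: real) = 0" for k :: 'n
    by (simp add: axis_def vec_eq_iff)
  have N_nonneg: "AE y in N. y \<in> orthant"
  proof -
    have "measure N {0..} = 1"
      using surv[of 0] axis[of 0] by (simp add: axis_0 orthant_def)
    then have "AE y in N. y \<in> {0..}"
      by (subst (asm) N.prob_eq_1) auto
    then show ?thesis
      by eventually_elim (auto simp: orthant_def less_eq_vec_def)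
  qed
  define e where "e y = (\<chi> k. exp (- (y $ k)))" for y :: "real ^ 'n"
  have e [measurable]: "e \<in> borel_measurable borel"
    unfolding e_def by measurable
  define M where "M = distr N borel e"
  interpret M: prob_space M
    unfolding M_def by (rule N.prob_space_distr) measurable
  have M_e: "measure M {..e x} = exp (- f x)" if "x \<in> orthant" for x
  proof -
    have "e -` {..e x} \<inter> space N = {x..}"
      by (auto simp: e_def less_eq_vec_def space_N)
    then show ?thesis
      using surv[OF that] by (simp add: M_def measure_distr)
  qed
  have M_pos: "AE u in M. \<forall>k. 0 < u $ k \<and> u $ k \<le> 1"
    unfolding M_def using N_nonneg by (subst AE_distr_iff) (auto simp: e_def orthant_def elim: AE_mp)
  have marg_le: "measure M {u. u $ k \<le> v} = (if v \<le> 0 then 0 else if 1 \<le> v then 1 else v)" for k v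
  proof -
    consider "v \<le> 0" | "0 < v" "v < 1" | "1 \<le> v" by linarith
    then show ?thesis
    proof cases
      case 1
      have "AE u in M. \<not> u $ k \<le> v"
        using M_pos by eventually_elim (use 1 in \<open>auto simp: not_le intro: le_less_trans\<close>)
      then have "measure M {u. u $ k \<le> v} = 0"
        by (subst M.prob_eq_0) (auto simp: M_def)
      then show ?thesis
        using 1 by simp
    next
      case 2
      define t where "t = - ln v"
      have t: "0 \<le> t" "v = exp (- t)"
        using 2 by (auto simp: t_def)
      have "measure M {u. u $ k \<le> v} = measure M {..e (axis k t)}"
      proof (rule M.finite_measure_eq_AE)
        show "AE u in M. (u \<in> {u. u $ k \<le> v}) = (u \<in> {..e (axis k t)})"
          using M_pos by eventually_elim (auto simp: less_eq_vec_def e_def axis_def t(2) split: if_splits)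
      qed (auto simp: M_def)
      then show ?thesis
        using M_e[OF orthant_axis[OF t(1)]] axis[OF t(1)] t(2) 2 by simp
    next
      case 3
      have "AE u in M. u $ k \<le> v"
        using M_pos by eventually_elim (use 3 in \<open>auto intro: order_trans\<close>)
      then have "measure M {u. u $ k \<le> v} = 1"
        by (subst M.prob_eq_1) (auto simp: M_def)
      then show ?thesis
        using 3 by simp
    qed
  qed
  have marg: "distr M borel (\<lambda>u. u $ k) = uniform_measure lborel {0..1}" for k
  proof (rule cdf_unique)
    show "real_distribution (distr M borel (\<lambda>u. u $ k))"
      by (rule M.real_distribution_distr) (auto simp: M_def)
    have "prob_space (uniform_measure lborel {0..1 :: real})"
      by (rule prob_space_uniform_measure) auto
    then show "real_distribution (uniform_measure lborel {0..1 :: real})"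
      by (simp add: real_distribution_def real_distribution_axioms_def)
    show "cdf (distr M borel (\<lambda>u. u $ k)) = cdf (uniform_measure lborel {0..1})"
    proof
      fix v :: real
      have "cdf (uniform_measure lborel {0..1}) v = (if v \<le> 0 then 0 else if 1 \<le> v then 1 else v)"
      proof -
        consider "v < 0" | "v \<in> {0..1}" | "1 < v"
          by fastforce
        then show ?thesis
        proof cases
          case 1
          then have "{0..1} \<inter> {..v} = {}"
            by auto
          then show ?thesis
            using 1 by (simp add: cdf_def measure_uniform_measure)
        next
          case 2
          then show ?thesis
            using measure_uniform_unit_interval_atMost[OF 2] by (auto simp: cdf_def)
        next
          case 3
          then have "{0..1} \<inter> {..v} = {0..1}"
            by auto
          then show ?thesis
            using 3 by (simp add: cdf_def measure_uniform_measure)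
        qed
      qed
      moreover have "cdf (distr M borel (\<lambda>u. u $ k)) v = measure M {u. u $ k \<le> v}"
        unfolding cdf_def by (subst measure_distr) (auto simp: M_def vimage_def)
      ultimately show "cdf (distr M borel (\<lambda>u. u $ k)) v = cdf (uniform_measure lborel {0..1}) v"
        by (simp add: marg_le)
    qed
  qed
  define C where "C u = measure M {..u}" for u
  have C_zero: "C u = 0" if "u $ k \<le> 0" for u k
  proof -
    have "C u \<le> measure M {u. u $ k \<le> 0}"
      unfolding C_def
    proof (rule M.finite_measure_mono)
      show "{..u} \<subseteq> {u. u $ k \<le> 0}"
        using that by (auto simp: less_eq_vec_def) (meson order_trans)
    qed (simp add: M_def)
    then show ?thesis
      by (simp add: marg_le C_def measure_le_0_iff)
  qed
  have "C (\<chi> k. u $ k powr t) = C u powr t" if "u \<in> unit_cube" "0 < t" for u t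
  proof (cases "\<exists>k. u $ k = 0")
    case True
    then obtain k where "u $ k = 0" ..
    then show ?thesis
      by (subst (1 2) C_zero[of _ k]) auto
  next
    case False
    define x where "x = (\<chi> k. - ln (u $ k))"
    have pos: "0 < u $ k" "u $ k \<le> 1" for k
      using False that(1) by (auto simp: unit_cube_def less_le)
    have x: "x \<in> orthant"
      using pos by (simp add: x_def orthant_def)
    have "u = e x" "(\<chi> k. u $ k powr t) = e (t *\<^sub>R x)"
      using pos by (simp_all add: x_def e_def vec_eq_iff powr_def less_imp_neq[symmetric])
    then show ?thesis
      using x that(2) by (simp add: C_def M_e orthant_scaleR hom powr_def)
  qed
  then have "extreme_value_copula C"
    unfolding extreme_value_copula_def copula_def using marg M.prob_space_axioms
    by (auto simp: M_def C_def intro!: exI[of _ M])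
  moreover have "f = stdf_of C"
  proof
    fix x
    show "f x = stdf_of C x"
      using ext M_e[of x] by (auto simp: stdf_of_def C_def e_def extensional_def)
  qed
  ultimately show ?thesis
    unfolding stdf_def by blast
qed


section \<open>Pickands' representation\<close>

lemma nn_integral_layer_cake:
  assumes "sigma_finite_measure N" and g [measurable]: "g \<in> borel_measurable N"
  shows "(\<integral>\<^sup>+y. ennreal (g y) \<partial>N)
    = (\<integral>\<^sup>+r. indicator {0<..} r * emeasure N {y \<in> space N. r < g y} \<partial>lborel)"
proof -
  interpret N: sigma_finite_measure N by fact
  interpret P: pair_sigma_finite N lborel
    by (rule pair_sigma_finite.intro) (simp_all add: assms lborel.sigma_finite_measure_axioms)
  have "emeasure lborel {0<..<g y} = ennreal (g y)" for y
    by (cases "0 \<le> g y") (auto simp: ennreal_neg)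
  then have "(\<integral>\<^sup>+y. ennreal (g y) \<partial>N) = (\<integral>\<^sup>+y. \<integral>\<^sup>+r. indicator {0<..<g y} r \<partial>lborel \<partial>N)"
    by simp
  also have "\<dots> = (\<integral>\<^sup>+y. \<integral>\<^sup>+r. of_bool (0 < r \<and> r < g y) \<partial>lborel \<partial>N)"
    by (intro nn_integral_cong) (auto simp: indicator_def)
  also have "\<dots> = (\<integral>\<^sup>+r. \<integral>\<^sup>+y. of_bool (0 < r \<and> r < g y) \<partial>N \<partial>lborel)"
    by (rule P.Fubini'[symmetric]) measurable
  also have "\<dots> = (\<integral>\<^sup>+r. \<integral>\<^sup>+y. indicator {0<..} r * indicator {y \<in> space N. r < g y} y \<partial>N \<partial>lborel)"
    by (intro nn_integral_cong) (auto simp: indicator_def)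
  finally show ?thesis
    by (simp add: nn_integral_cmult)
qed

text \<open>The mean of the standard Frechet law of shape \<open>p\<close>, that is, the Gamma
  function at 1 - 1/p. Only its positivity and finiteness for \<open>1 < p\<close> enter
  below.\<close>

definition tail_integral :: "real \<Rightarrow> ennreal" where
  "tail_integral p = (\<integral>\<^sup>+r. indicator {0<..} r * ennreal (1 - exp (- (r powr - p))) \<partial>lborel)"

text \<open>The integrand is at most 1 near 0, and at most \<open>r powr - p\<close> from 1 on,
  which is integrable because \<open>1 < p\<close>.\<close>

lemma tail_integral_finite:
  assumes "1 < p"
  shows "tail_integral p < \<infinity>"
proof -
  have FTC: "(\<integral>\<^sup>+r. ennreal (r powr - p) * indicator {1..} r \<partial>lborel) = ennreal (0 - (- (1 powr (1 - p) / (p - 1))))"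
  proof (rule nn_integral_FTC_atLeast[where F = "\<lambda>r. - (r powr (1 - p) / (p - 1))" and T = 0])
    show "DERIV (\<lambda>r. - (r powr (1 - p) / (p - 1))) r :> r powr - p" if "1 \<le> r" for r
    proof -
      have "DERIV (\<lambda>r. - (r powr (1 - p) / (p - 1))) r :> - ((1 - p) * r powr (1 - p - 1) / (p - 1))"
        using that assms by (auto intro!: derivative_eq_intros)
      moreover have "- ((1 - p) * r powr (1 - p - 1) / (p - 1)) = r powr - p"
        using assms by (simp add: field_simps)
      ultimately show ?thesis
        by simp
    qed
    have "((\<lambda>r. r powr (1 - p)) \<longlongrightarrow> 0) at_top"
      by (rule tendsto_neg_powr) (use assms filterlim_ident in auto)
    then have "((\<lambda>r. - (r powr (1 - p) / (p - 1))) \<longlongrightarrow> - (0 / (p - 1))) at_top"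
      using assms by (intro tendsto_intros) auto
    then show "((\<lambda>r. - (r powr (1 - p) / (p - 1))) \<longlongrightarrow> 0) at_top"
      by simp
  qed auto
  have "tail_integral p \<le> (\<integral>\<^sup>+r. indicator {0..<1} r + ennreal (r powr - p) * indicator {1..} r \<partial>lborel)"
    unfolding tail_integral_def
  proof (rule nn_integral_mono)
    fix r :: real
    have "ennreal (1 - exp (- (r powr - p))) \<le> ennreal (r powr - p)"
      using exp_ge_add_one_self[of "- (r powr - p)"] by (intro ennreal_leI) simp
    moreover have "ennreal (1 - exp (- (r powr - p))) \<le> 1"
      by (simp add: ennreal_le_1)
    ultimately show "indicator {0<..} r * ennreal (1 - exp (- (r powr - p)))
        \<le> indicator {0..<1} r + ennreal (r powr - p) * indicator {1..} r"
      by (cases "r \<le> 0"; cases "r < 1") (auto simp: indicator_def intro: add_increasing2)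
  qed
  also have "\<dots> = 1 + (\<integral>\<^sup>+r. ennreal (r powr - p) * indicator {1..} r \<partial>lborel)"
    by (subst nn_integral_add) auto
  also have "\<dots> < \<infinity>"
    by (simp add: FTC)
  finally show ?thesis .
qed

lemma tail_integral_pos: "0 < tail_integral p" if "0 < p"
proof -
  have "0 < ennreal (1 - exp (- 1))"
    by simp
  also have "\<dots> = (\<integral>\<^sup>+r. ennreal (1 - exp (- 1)) * indicator {0<..1} (r :: real) \<partial>lborel)"
    by (simp add: nn_integral_cmult)
  also have "\<dots> \<le> tail_integral p"
    unfolding tail_integral_def
  proof (rule nn_integral_mono)
    fix r :: real
    have "1 \<le> r powr - p" if "0 < r" "r \<le> 1"
      using powr_mono2'[of "- p" r 1] that \<open>0 < p\<close> by simp
    then show "ennreal (1 - exp (- 1)) * indicator {0<..1} r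
        \<le> indicator {0<..} r * ennreal (1 - exp (- (r powr - p)))"
      by (auto simp: indicator_def intro: ennreal_leI)
  qed
  finally show ?thesis .
qed

text \<open>The substitution \<open>r = F powr (1 / p) * s\<close> absorbs \<open>F\<close>; the
  power of \<open>f\<close> in the representation has its origin here. For \<open>F = 0\<close> both
  sides are 0, since \<open>0 powr (1 / p) = 0\<close>.\<close>

lemma tail_integral_scale:
  assumes "0 < p" "0 \<le> F"
  shows "(\<integral>\<^sup>+r. indicator {0<..} r * ennreal (1 - exp (- (r powr - p * F))) \<partial>lborel)
    = ennreal (F powr (1 / p)) * tail_integral p"
proof (cases "F = 0")
  case False
  define b where "b = F powr (1 / p)"
  have b: "0 < b"
    using assms False by (simp add: b_def)
  have b_powr: "b powr - p = 1 / F"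
    using assms False by (simp add: b_def powr_powr powr_minus divide_inverse)
  have "(\<integral>\<^sup>+r. indicator {0<..} r * ennreal (1 - exp (- (r powr - p * F))) \<partial>lborel)
    = ennreal \<bar>b\<bar> * (\<integral>\<^sup>+s. indicator {0<..} (0 + b * s) *
        ennreal (1 - exp (- ((0 + b * s) powr - p * F))) \<partial>lborel)"
    using b by (intro nn_integral_real_affine) auto
  also have "(\<integral>\<^sup>+s. indicator {0<..} (0 + b * s) *
        ennreal (1 - exp (- ((0 + b * s) powr - p * F))) \<partial>lborel) = tail_integral p"
    unfolding tail_integral_def
    using b False by (intro nn_integral_cong) (auto simp: indicator_def zero_less_mult_iff powr_mult b_powr)
  finally show ?thesis
    using b by (simp add: b_def)
qed simp

lemma integrable_continuous_on_unit_cube: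
  fixes \<phi> :: "real ^ 'n \<Rightarrow> real"
  assumes "prob_space \<nu>" and sets: "sets \<nu> = sets borel" and "AE q in \<nu>. q \<in> unit_cube"
    and \<phi>: "continuous_on UNIV \<phi>"
  shows "integrable \<nu> \<phi>"
proof -
  interpret prob_space \<nu> by fact
  obtain B where B: "\<And>q. q \<in> unit_cube \<Longrightarrow> norm (\<phi> q) \<le> B"
    by (rule continuous_on_compact_bound[OF compact_unit_cube continuous_on_subset[OF \<phi>]]) auto
  show ?thesis
  proof (rule integrable_const_bound)
    show "AE q in \<nu>. norm (\<phi> q) \<le> B"
      using assms(3) by eventually_elim (use B in auto)
    show "\<phi> \<in> borel_measurable \<nu>"
      using borel_measurable_continuous_onI[OF \<phi>] sets by (simp cong: measurable_cong_sets)
  qed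
qed

lemma AE_unit_simplex_imp_unit_cube: "AE q in \<nu>. q \<in> unit_simplex \<Longrightarrow> AE q in \<nu>. q \<in> unit_cube"
  by (erule eventually_mono) (simp add: unit_simplex_def)

lemma integrable_wmax:
  assumes "prob_space \<nu>" "sets \<nu> = sets borel" "AE q in \<nu>. q \<in> unit_simplex"
  shows "integrable \<nu> (wmax x)"
  using assms
  by (intro integrable_continuous_on_unit_cube) (auto intro!: continuous_intros AE_unit_simplex_imp_unit_cube)

text \<open>
  If the survival function of \<open>y\<close> is \<open>exp (- f)\<close> then \<open>max\<^sub>k x\<^sub>k / y\<^sub>k\<close> is Frechet with scale
  \<open>f x\<close>, so its moment of order \<open>a < 1\<close> is a constant times \<open>f x powr a\<close>. Normalizing
  \<open>(1 / y\<^sub>k powr a)\<^sub>k\<close> to the unit simplex turns this into a representation of \<open>f powr a\<close>.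
\<close>

lemma stdf_power_representation:
  fixes f :: "real ^ 'n \<Rightarrow> real"
  assumes f: "stdf f" and a: "0 < a" "a < 1"
  obtains \<nu> where "prob_space \<nu>" "sets \<nu> = sets borel" "AE q in \<nu>. q \<in> unit_simplex"
    "\<And>x. x \<in> orthant \<Longrightarrow> f x powr a = CARD('n) * (\<integral>q. wmax (\<chi> k. x $ k powr a) q \<partial>\<nu>)"
proof -
  obtain N where N: "prob_space N" "sets N = sets borel"
    and surv: "\<And>x. x \<in> orthant \<Longrightarrow> measure N {x..} = exp (- f x)"
    using stdf_survivalD(4)[OF f] by blast
  interpret N: prob_space N by fact
  have sets_N [measurable_cong]: "sets N = sets borel" by fact
  have space_N: "space N = UNIV"
    using N(2) sets_eq_imp_space_eq by fastforce
  \<comment> \<open>The exponential margins have no atom at 0: the event that coordinate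
    \<open>k\<close> is positive has probability at least \<open>exp (- t)\<close> for every
    \<open>t > 0\<close>. Hence the negative powers of the coordinates are meaningful almost
    surely.\<close>
  have N_pos: "AE y in N. \<forall>k. 0 < y $ k"
  proof (subst AE_all_countable, rule allI)
    fix k :: 'n
    have "1 \<le> measure N {y. 0 < y $ k}"
    proof (rule tendsto_upperbound)
      have "((\<lambda>t. exp (- t)) \<longlongrightarrow> exp (- 0)) (at_right (0 :: real))"
        by (intro tendsto_intros)
      then show "((\<lambda>t. exp (- t)) \<longlongrightarrow> 1) (at_right (0 :: real))"
        by simp
      have "exp (- t) \<le> measure N {y. 0 < y $ k}" if "0 < t" for t
      proof -
        have "exp (- t) = measure N {axis k t..}"
          using that surv[OF orthant_axis[of t k]] stdf_survivalD(3)[OF f, of t k] by simp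
        also have "\<dots> \<le> measure N {y. 0 < y $ k}"
        proof (rule N.finite_measure_mono)
          show "{axis k t..} \<subseteq> {y. 0 < y $ k}"
          proof safe
            fix y assume "axis k t \<le> y"
            then have "\<forall>i. axis k t $ i \<le> y $ i"
              by (simp add: less_eq_vec_def)
            from spec[OF this, of k] show "0 < y $ k"
              using that by (simp add: axis_def)
          qed
        qed measurable
        finally show ?thesis .
      qed
      then show "\<forall>\<^sub>F t in at_right 0. exp (- t) \<le> measure N {y. 0 < y $ k}"
        by (auto simp: eventually_at_right_less intro: eventually_mono[OF eventually_at_right_less])
    qed simp
    then have "measure N {y. 0 < y $ k} = 1"
      using N.prob_le_1 by (intro antisym) auto
    then show "AE y in N. 0 < y $ k"
      by (subst (asm) N.prob_eq_1) auto
  qed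
  \<comment> \<open>The Frechet shape of the a-th power of max x_k / y_k; the assumption
    \<open>a < 1\<close> makes its mean finite.\<close>
  define p where "p = 1 / a"
  have p: "1 < p" "a = 1 / p" "0 < p"
    using a by (auto simp: p_def)
  define c where "c = enn2real (tail_integral p)"
  have c: "tail_integral p = ennreal c" "0 < c"
    using tail_integral_finite[OF p(1)] tail_integral_pos[OF p(3)]
    by (auto simp: c_def enn2real_positive_iff)
  define w :: "real ^ 'n \<Rightarrow> real ^ 'n" where "w y = (\<chi> k. y $ k powr - a)" for y
  define pw :: "real ^ 'n \<Rightarrow> real ^ 'n" where "pw x = (\<chi> k. x $ k powr a)" for x
  have w_meas [measurable]: "w \<in> borel_measurable borel"
    unfolding w_def by measurable
  have moment: "(\<integral>\<^sup>+y. ennreal (wmax (pw x) (w y)) \<partial>N) = ennreal (c * f x powr a)"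
    if x: "x \<in> orthant" for x
  proof -
    have f_nonneg: "0 \<le> f x"
      using surv[OF x] N.prob_le_1[of "{x..}"] by simp
    have "(\<integral>\<^sup>+y. ennreal (wmax (pw x) (w y)) \<partial>N)
      = (\<integral>\<^sup>+r. indicator {0<..} r * emeasure N {y \<in> space N. r < wmax (pw x) (w y)} \<partial>lborel)"
      by (rule nn_integral_layer_cake) (auto intro: N.sigma_finite_measure_axioms)
    also have "\<dots> = (\<integral>\<^sup>+r. indicator {0<..} r * ennreal (1 - exp (- (r powr - p * f x))) \<partial>lborel)"
    proof (rule nn_integral_cong)
      fix r :: real
      \<comment> \<open>Up to a null set, the weighted maximum exceeds \<open>r\<close> exactly when
        \<open>y\<close> fails to dominate \<open>r powr - p *\<^sub>R x\<close>. Homogeneity of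
        \<open>f\<close> then pulls the factor out of the exponent.\<close>
      have "emeasure N {y \<in> space N. r < wmax (pw x) (w y)} = ennreal (1 - exp (- (r powr - p * f x)))"
        if r: "0 < r"
      proof -
        have "measure N {y \<in> space N. r < wmax (pw x) (w y)} = measure N (space N - {r powr - p *\<^sub>R x..})"
        proof (rule N.finite_measure_eq_AE)
          show "AE y in N. (y \<in> {y \<in> space N. r < wmax (pw x) (w y)}) = (y \<in> space N - {r powr - p *\<^sub>R x..})"
            using N_pos
          proof eventually_elim
            case (elim y)
            have "(x $ k powr a * y $ k powr - a \<le> r) = (r powr - p * x $ k \<le> y $ k)" for k
            proof -
              have yk: "0 < y $ k" and xk: "0 \<le> x $ k"
                using elim x by (auto simp: orthant_def)
              have "(x $ k powr a * y $ k powr - a \<le> r) = ((x $ k / y $ k) powr a \<le> r)"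
                using xk yk by (simp add: powr_mult inverse_powr powr_minus divide_inverse)
              also have "\<dots> = ((x $ k / y $ k) powr a \<le> (r powr p) powr a)"
                using r a by (simp add: powr_powr p_def)
              also have "\<dots> = (x $ k / y $ k \<le> r powr p)"
                using xk yk a powr_mono2[of a "x $ k / y $ k" "r powr p"]
                  powr_less_mono2[of a "r powr p" "x $ k / y $ k"] by (auto simp: not_le[symmetric])
              also have "\<dots> = (r powr - p * x $ k \<le> y $ k)"
                using yk r by (simp add: powr_minus field_simps)
              finally show ?thesis .
            qed
            then have "(wmax (pw x) (w y) \<le> r) = (r powr - p *\<^sub>R x \<le> y)"
              by (simp add: wmax_le_iff pw_def w_def less_eq_vec_def)
            then show ?case
              by (auto simp: space_N not_le)
          qed
        qed auto
        also have "\<dots> = 1 - measure N {r powr - p *\<^sub>R x..}"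
          by (rule N.prob_compl) auto
        also have "\<dots> = 1 - exp (- (r powr - p * f x))"
          using r x surv[OF orthant_scaleR, of x "r powr - p"] stdf_survivalD(2)[OF f x, of "r powr - p"]
          by simp
        finally show ?thesis
          by (simp add: N.emeasure_eq_measure)
      qed
      then show "indicator {0<..} r * emeasure N {y \<in> space N. r < wmax (pw x) (w y)}
          = indicator {0<..} r * ennreal (1 - exp (- (r powr - p * f x)))"
        by (auto simp: indicator_def)
    qed
    also have "\<dots> = ennreal (f x powr a) * ennreal c"
      using tail_integral_scale[OF p(3) f_nonneg] c by (simp add: p(2))
    finally show ?thesis
      using c(2) by (simp add: ennreal_mult mult.commute)
  qed
  define D where "D y = (\<Sum>k\<in>UNIV. w y $ k)" for y
  \<comment> \<open>The mean of \<open>D\<close>: coordinate \<open>k\<close> of \<open>w\<close> is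
    the weighted maximum for \<open>axis k 1\<close>, where \<open>f\<close> equals 1, so each
    coordinate has mean \<open>c\<close>.\<close>
  define Z where "Z = CARD('n) * c"
  have Z: "0 < Z"
    using c(2) by (simp add: Z_def)
  have D_meas [measurable]: "D \<in> borel_measurable borel"
    unfolding D_def by measurable
  have w_orthant: "w y \<in> orthant" for y
    by (simp add: w_def orthant_def)
  have D_nonneg: "0 \<le> D y" for y
    unfolding D_def by (intro sum_nonneg) (simp add: w_def)
  have w_AE: "AE y in N. 0 < D y"
    using N_pos
  proof eventually_elim
    case (elim y)
    then have "y $ k \<noteq> 0" for k
      by (metis less_irrefl)
    then show ?case
      by (auto simp: D_def w_def intro!: sum_pos)
  qed
  have int_D: "(\<integral>\<^sup>+y. ennreal (D y / Z) \<partial>N) = 1"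
  proof -
    have "ennreal (D y) = (\<Sum>k\<in>UNIV. ennreal (wmax (pw (axis k 1)) (w y)))" for y
    proof -
      have "pw (axis k 1) = axis k 1" for k
        using a by (auto simp: pw_def axis_def vec_eq_iff)
      then show ?thesis
        using w_orthant[of y] by (simp add: D_def wmax_axis w_orthant sum_ennreal orthant_def)
    qed
    then have "(\<integral>\<^sup>+y. ennreal (D y) \<partial>N) = (\<Sum>k\<in>UNIV. \<integral>\<^sup>+y. ennreal (wmax (pw (axis k 1)) (w y)) \<partial>N)"
      by (simp add: nn_integral_sum)
    also have "\<dots> = ennreal Z"
      by (simp add: moment orthant_axis stdf_survivalD(3)[OF f] Z_def c(2) less_imp_le ennreal_mult ennreal_of_nat_eq_real_of_nat)
    finally have D: "(\<integral>\<^sup>+y. ennreal (D y) \<partial>N) = ennreal Z" .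
    have "(\<integral>\<^sup>+y. ennreal (D y / Z) \<partial>N) = (\<integral>\<^sup>+y. ennreal (1 / Z) * ennreal (D y) \<partial>N)"
      using Z D_nonneg by (intro nn_integral_cong) (simp add: ennreal_mult[symmetric])
    also have "\<dots> = ennreal (1 / Z) * ennreal Z"
      by (subst nn_integral_cmult) (auto simp: D)
    also have "\<dots> = 1"
      using Z by (simp add: ennreal_mult[symmetric])
    finally show ?thesis .
  qed
  define Q where "Q y = (1 / D y) *\<^sub>R w y" for y
  have Q_meas [measurable]: "Q \<in> borel_measurable borel"
    unfolding Q_def by measurable
  have Q_simplex: "Q y \<in> unit_simplex" if "0 < D y" for y
  proof (rule unit_simplexI)
    show "Q y \<in> orthant"
      unfolding Q_def by (intro orthant_scaleR w_orthant) (simp add: D_nonneg)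
    have "(\<Sum>k\<in>UNIV. Q y $ k) = (\<Sum>k\<in>UNIV. w y $ k) / D y"
      by (simp add: Q_def flip: sum_divide_distrib)
    also have "\<dots> = D y / D y"
      by (simp add: D_def)
    finally show "(\<Sum>k\<in>UNIV. Q y $ k) = 1"
      using that by simp
  qed
  \<comment> \<open>The density \<open>D y / Z\<close> cancels the normalization of
    \<open>w y\<close> to coordinate sum 1, up to the constant \<open>1 / Z\<close>. Points with
    \<open>D y = 0\<close>, where \<open>Q\<close> is not on the simplex, are null.\<close>
  define T where "T = density N (\<lambda>y. ennreal (D y / Z))"
  define \<nu> where "\<nu> = distr T borel Q"
  have T_meas: "borel_measurable T = borel_measurable borel"
    unfolding T_def by (rule measurable_cong_sets) (auto simp: N)
  interpret T: prob_space T
    by (rule prob_spaceI) (simp add: T_def emeasure_density int_D space_N cong: nn_integral_cong)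
  interpret \<nu>: prob_space \<nu>
    unfolding \<nu>_def by (rule T.prob_space_distr) (simp add: T_meas)
  have \<nu>_simplex: "AE q in \<nu>. q \<in> unit_simplex"
    unfolding \<nu>_def T_def using w_AE Q_simplex
    by (subst AE_distr_iff) (auto simp: AE_density elim!: eventually_mono)
  show thesis
  proof (rule that[of \<nu>])
    show "prob_space \<nu>" by (rule \<nu>.prob_space_axioms)
    show "sets \<nu> = sets borel" by (simp add: \<nu>_def)
    show "AE q in \<nu>. q \<in> unit_simplex" by fact
    fix x :: "real ^ 'n" assume x: "x \<in> orthant"
    have pw_orthant: "pw x \<in> orthant"
      by (simp add: pw_def orthant_def)
    have "(\<integral>\<^sup>+q. ennreal (wmax (pw x) q) \<partial>\<nu>) = (\<integral>\<^sup>+y. ennreal (wmax (pw x) (Q y)) \<partial>T)"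
      unfolding \<nu>_def by (rule nn_integral_distr) (auto simp: T_meas)
    also have "\<dots> = (\<integral>\<^sup>+y. ennreal (D y / Z) * ennreal (wmax (pw x) (Q y)) \<partial>N)"
      unfolding T_def by (rule nn_integral_density) auto
    also have "\<dots> = (\<integral>\<^sup>+y. ennreal (1 / Z) * ennreal (wmax (pw x) (w y)) \<partial>N)"
    proof (rule nn_integral_cong_AE)
      show "AE y in N. ennreal (D y / Z) * ennreal (wmax (pw x) (Q y))
          = ennreal (1 / Z) * ennreal (wmax (pw x) (w y))"
        using w_AE
      proof eventually_elim
        case (elim y)
        have "wmax (pw x) (Q y) = 1 / D y * wmax (pw x) (w y)"
          unfolding Q_def using elim by (intro wmax_scaleR_right) simp
        then have "D y / Z * wmax (pw x) (Q y) = 1 / Z * wmax (pw x) (w y)"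
          using elim by simp
        then show ?case
          using elim Z wmax_nonneg[OF pw_orthant w_orthant[of y]]
          by (simp add: ennreal_mult'[symmetric])
      qed
    qed
    also have "\<dots> = ennreal (1 / Z) * ennreal (c * f x powr a)"
      by (subst nn_integral_cmult) (auto simp: moment[OF x])
    also have "\<dots> = ennreal (f x powr a / CARD('n))"
      using c(2) by (subst ennreal_mult[symmetric]) (auto simp: Z_def)
    finally have "(\<integral>\<^sup>+q. ennreal (wmax (pw x) q) \<partial>\<nu>) = ennreal (f x powr a / CARD('n))" .
    moreover have "AE q in \<nu>. 0 \<le> wmax (pw x) q"
      using \<nu>_simplex by eventually_elim
        (use unit_simplex_subset_orthant in \<open>auto intro!: wmax_nonneg pw_orthant\<close>)
    ultimately have "(\<integral>q. wmax (pw x) q \<partial>\<nu>) = f x powr a / CARD('n)"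
      by (subst integral_eq_nn_integral) (auto simp: \<nu>_def)
    then show "f x powr a = CARD('n) * (\<integral>q. wmax (\<chi> k. x $ k powr a) q \<partial>\<nu>)"
      by (simp add: pw_def)
  qed
qed

text \<open>The usual requirement that every coordinate have mean 1/d is implicit: it is the
  representation evaluated at \<open>axis k 1\<close>, where \<open>f\<close> equals 1.\<close>

theorem pickands_representation:
  fixes f :: "real ^ 'n \<Rightarrow> real"
  assumes "stdf f"
  obtains \<nu> where "prob_space \<nu>" "sets \<nu> = sets borel" "AE q in \<nu>. q \<in> unit_simplex"
    "\<And>x. x \<in> orthant \<Longrightarrow> f x = CARD('n) * (\<integral>q. wmax x q \<partial>\<nu>)"
proof -
  define a where "a n = 1 - 1 / (real n + 2)" for n
  have a: "0 < a n" "a n < 1" for n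
    by (auto simp: a_def field_simps)
  have "(\<lambda>n. 1 / (real n + 2)) \<longlonglongrightarrow> 0"
    by real_asymp
  then have a_lim: "a \<longlonglongrightarrow> 1"
    unfolding a_def using tendsto_diff[OF tendsto_const[of 1]] by fastforce
  have powr_lim: "(\<lambda>n. z powr a n) \<longlonglongrightarrow> z" if "0 \<le> z" for z
  proof (cases "z = 0")
    case False
    then have "(\<lambda>n. z powr a n) \<longlonglongrightarrow> z powr 1"
      by (intro tendsto_powr a_lim tendsto_const) auto
    then show ?thesis
      using that by simp
  qed simp
  have "\<exists>\<nu>. prob_space \<nu> \<and> sets \<nu> = sets borel \<and> (AE q in \<nu>. q \<in> unit_simplex) \<and>
      (\<forall>x\<in>orthant. f x powr a n = CARD('n) * (\<integral>q. wmax (\<chi> k. x $ k powr a n) q \<partial>\<nu>))" for n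
    using stdf_power_representation[OF assms a] by metis
  then obtain \<mu> where \<mu>: "\<And>n. prob_space (\<mu> n)" "\<And>n. sets (\<mu> n) = sets borel"
    "\<And>n. AE q in \<mu> n. q \<in> unit_simplex"
    "\<And>n x. x \<in> orthant \<Longrightarrow> f x powr a n = CARD('n) * (\<integral>q. wmax (\<chi> k. x $ k powr a n) q \<partial>\<mu> n)"
    by metis
  note \<mu>_cube = AE_unit_simplex_imp_unit_cube[OF \<mu>(3)]
  obtain r \<nu> where r: "strict_mono (r :: nat \<Rightarrow> nat)" and \<nu>: "prob_space \<nu>" "sets \<nu> = sets borel"
    "AE q in \<nu>. q \<in> unit_cube"
    and lim: "\<And>\<phi> :: real ^ 'n \<Rightarrow> real. continuous_on UNIV \<phi> \<Longrightarrow>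
      (\<lambda>n. \<integral>q. \<phi> q \<partial>\<mu> (r n)) \<longlonglongrightarrow> (\<integral>q. \<phi> q \<partial>\<nu>)"
    by (rule weakly_convergent_subsequence_unit_cube[of \<mu>, OF \<mu>(1,2) \<mu>_cube])
      (rule that; simp)
  have sets_\<mu> [measurable_cong]: "sets (\<mu> n) = sets borel" for n by fact
  show thesis
  proof (rule that[OF \<nu>(1,2)])
    \<comment> \<open>Among points of the cube this continuous function vanishes exactly on the
      simplex, so zero integrals along the sequence force the weak limit onto the simplex.\<close>
    define \<phi> where "\<phi> q = \<bar>(\<Sum>k\<in>UNIV. q $ k) - 1\<bar>" for q :: "real ^ 'n"
    have \<phi>: "continuous_on UNIV \<phi>"
      unfolding \<phi>_def by (intro continuous_intros)
    have "(\<integral>q. \<phi> q \<partial>\<mu> n) = 0" for n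
      by (rule integral_eq_zero_AE) (use \<mu>(3)[of n] in eventually_elim, simp add: \<phi>_def unit_simplex_def)
    then have "(\<integral>q. \<phi> q \<partial>\<nu>) = 0"
      using lim[OF \<phi>] by (simp add: LIMSEQ_const_iff)
    then have "AE q in \<nu>. \<phi> q = 0"
      using integrable_continuous_on_unit_cube[OF \<nu> \<phi>]
      by (subst (asm) integral_nonneg_eq_0_iff_AE) (auto simp: \<phi>_def)
    with \<nu>(3) show "AE q in \<nu>. q \<in> unit_simplex"
      by eventually_elim (simp add: \<phi>_def unit_simplex_def)
    fix x :: "real ^ 'n" assume x: "x \<in> orthant"
    define pw where "pw n = (\<chi> k. x $ k powr a n)" for n
    \<comment> \<open>The integrand varies with \<open>n\<close> together with the measure.
      Replacing it by the fixed function \<open>wmax x\<close> costs an amount that does not involve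
      the measure and tends to 0, after which weak convergence applies.\<close>
    have diff: "\<bar>(\<integral>q. wmax (pw n) q \<partial>\<mu> n) - (\<integral>q. wmax x q \<partial>\<mu> n)\<bar> \<le> (\<Sum>k\<in>UNIV. \<bar>x $ k powr a n - x $ k\<bar>)"
      for n
    proof -
      interpret prob_space "\<mu> n" by fact
      have int: "integrable (\<mu> n) (wmax y)" for y
        by (rule integrable_wmax[OF \<mu>(1,2,3)])
      have "\<bar>(\<integral>q. wmax (pw n) q \<partial>\<mu> n) - (\<integral>q. wmax x q \<partial>\<mu> n)\<bar> = \<bar>\<integral>q. wmax (pw n) q - wmax x q \<partial>\<mu> n\<bar>"
        by (simp add: Bochner_Integration.integral_diff int)
      also have "\<dots> \<le> (\<integral>q. \<bar>wmax (pw n) q - wmax x q\<bar> \<partial>\<mu> n)"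
        by (rule integral_abs_bound)
      also have "\<dots> \<le> (\<integral>q. (\<Sum>k\<in>UNIV. \<bar>x $ k powr a n - x $ k\<bar>) \<partial>\<mu> n)"
      proof (rule integral_mono_AE)
        show "AE q in \<mu> n. \<bar>wmax (pw n) q - wmax x q\<bar> \<le> (\<Sum>k\<in>UNIV. \<bar>x $ k powr a n - x $ k\<bar>)"
          using \<mu>_cube[of n]
        proof eventually_elim
          case (elim q)
          have "\<bar>wmax (pw n) q - wmax x q\<bar> \<le> (\<Sum>k\<in>UNIV. \<bar>pw n $ k - x $ k\<bar> * \<bar>q $ k\<bar>)"
            by (rule wmax_diff_le)
          also have "\<dots> \<le> (\<Sum>k\<in>UNIV. \<bar>pw n $ k - x $ k\<bar> * 1)"
            using elim by (intro sum_mono mult_left_mono) (auto simp: unit_cube_def)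
          finally show ?case
            by (simp add: pw_def)
        qed
      qed (use int in auto)
      finally show ?thesis
        by (simp add: prob_space)
    qed
    have f_nonneg: "0 \<le> f x"
    proof -
      obtain N where N: "prob_space N" "measure N {x..} = exp (- f x)"
        using stdf_survivalD(4)[OF assms] x by blast
      interpret prob_space N by fact
      show ?thesis
        using prob_le_1[of "{x..}"] N(2) by simp
    qed
    have "(\<lambda>n. \<Sum>k\<in>UNIV. \<bar>x $ k powr a n - x $ k\<bar>) \<longlonglongrightarrow> (\<Sum>k\<in>UNIV. \<bar>x $ k - x $ k\<bar>)"
      using x by (intro tendsto_intros powr_lim) (auto simp: orthant_def)
    then have "(\<lambda>n. \<Sum>k\<in>UNIV. \<bar>x $ k powr a n - x $ k\<bar>) \<longlonglongrightarrow> 0"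
      by simp
    then have "(\<lambda>n. (\<integral>q. wmax (pw n) q \<partial>\<mu> n) - (\<integral>q. wmax x q \<partial>\<mu> n)) \<longlonglongrightarrow> 0"
    proof (rule Lim_null_comparison[rotated])
      show "\<forall>\<^sub>F n in sequentially. norm ((\<integral>q. wmax (pw n) q \<partial>\<mu> n) - (\<integral>q. wmax x q \<partial>\<mu> n))
          \<le> (\<Sum>k\<in>UNIV. \<bar>x $ k powr a n - x $ k\<bar>)"
        using diff by (intro always_eventually allI) simp
    qed
    from LIMSEQ_subseq_LIMSEQ[OF this r]
    have "(\<lambda>n. (\<integral>q. wmax (pw (r n)) q \<partial>\<mu> (r n)) - (\<integral>q. wmax x q \<partial>\<mu> (r n))) \<longlonglongrightarrow> 0"
      by (simp add: o_def)
    moreover have "(\<lambda>n. \<integral>q. wmax x q \<partial>\<mu> (r n)) \<longlonglongrightarrow> (\<integral>q. wmax x q \<partial>\<nu>)"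
      by (intro lim continuous_intros)
    ultimately have "(\<lambda>n. \<integral>q. wmax (pw (r n)) q \<partial>\<mu> (r n)) \<longlonglongrightarrow> 0 + (\<integral>q. wmax x q \<partial>\<nu>)"
      using tendsto_add by fastforce
    then have "(\<lambda>n. CARD('n) * (\<integral>q. wmax (pw (r n)) q \<partial>\<mu> (r n))) \<longlonglongrightarrow> CARD('n) * (\<integral>q. wmax x q \<partial>\<nu>)"
      by (intro tendsto_mult_left) simp
    moreover have "(\<lambda>n. CARD('n) * (\<integral>q. wmax (pw (r n)) q \<partial>\<mu> (r n))) \<longlonglongrightarrow> f x"
      using LIMSEQ_subseq_LIMSEQ[OF powr_lim[OF f_nonneg] r] by (simp add: o_def \<mu>(4)[OF x] pw_def)
    ultimately show "f x = CARD('n) * (\<integral>q. wmax x q \<partial>\<nu>)"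
      by (rule LIMSEQ_unique[symmetric])
  qed
qed


section \<open>Uniqueness of the angular measure\<close>

lemma finite_measure_eqI_atMost:
  fixes M N :: "(real ^ 'n) measure"
  assumes "finite_measure M" "sets M = sets borel" "sets N = sets borel"
    and eq: "\<And>y. emeasure M {..y} = emeasure N {..y}"
  shows "M = N"
proof (rule measure_eqI_generator_eq[where E = "range (\<lambda>y :: real ^ 'n. {..y})" and \<Omega> = UNIV
      and A = "\<lambda>i :: nat. {..\<chi> k. real i}"])
  interpret finite_measure M by fact
  have "{..x} \<inter> {..y} = {..inf x y}" for x y :: "real ^ 'n"
    by auto
  then show "Int_stable (range (\<lambda>y :: real ^ 'n. {..y}))"
    unfolding Int_stable_def by auto
  show "sets M = sigma_sets UNIV (range (\<lambda>y. {..y}))" "sets N = sigma_sets UNIV (range (\<lambda>y. {..y}))"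
    using assms(2,3) by (simp_all add: borel_eq_atMost)
  show "(\<Union>i. {..\<chi> k. real i}) = (UNIV :: (real ^ 'n) set)"
  proof -
    have "\<exists>i. x \<le> (\<chi> k. real i)" for x :: "real ^ 'n"
    proof -
      obtain i where i: "Max (range (($) x)) \<le> real i"
        using real_arch_simple by blast
      have "x $ k \<le> real i" for k
        using i Max_ge[of "range (($) x)" "x $ k"] by simp
      then show ?thesis
        by (auto simp: less_eq_vec_def)
    qed
    then show ?thesis
      by auto
  qed
  show "emeasure M {..\<chi> k. real i} \<noteq> \<infinity>" for i
    by simp
qed (use eq in auto)

text \<open>Raising the j-th weight from 1 to \<open>1 + 1 / real (Suc n)\<close> can alter the
  maximum only through the j-th term. If that term attains the maximum, ties included, the
  difference quotient equals \<open>q $ j\<close>; otherwise it is eventually 0. Ties count because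
  the derivative is taken from the right, which explains the non-strict inequality in the
  indicator.\<close>

lemma wmax_right_derivative:
  fixes \<nu> :: "(real ^ 'n) measure"
  assumes \<nu>: "prob_space \<nu>" "sets \<nu> = sets borel" "AE q in \<nu>. q \<in> unit_simplex"
    and x: "x $ j = 1"
  shows "(\<lambda>n. real (Suc n) * ((\<integral>q. wmax (x + axis j (1 / real (Suc n))) q \<partial>\<nu>) - (\<integral>q. wmax x q \<partial>\<nu>)))
    \<longlonglongrightarrow> (\<integral>q. q $ j * indicator {q. wmax x q \<le> q $ j} q \<partial>\<nu>)"
proof -
  interpret prob_space \<nu> by fact
  have [measurable_cong]: "sets \<nu> = sets borel" by fact
  define y where "y n = x + axis j (1 / real (Suc n))" for n
  have int: "integrable \<nu> (wmax z)" for z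
    by (rule integrable_wmax[OF \<nu>])
  have bound: "\<bar>real (Suc n) * (wmax (y n) q - wmax x q)\<bar> \<le> \<bar>q $ j\<bar>" for n q
  proof -
    have "\<bar>wmax (y n) q - wmax x q\<bar> \<le> (\<Sum>k\<in>UNIV. \<bar>y n $ k - x $ k\<bar> * \<bar>q $ k\<bar>)"
      by (rule wmax_diff_le)
    also have "\<dots> = (\<Sum>k\<in>UNIV. if k = j then \<bar>q $ j\<bar> / real (Suc n) else 0)"
      by (rule sum.cong) (auto simp: y_def axis_def)
    also have "\<dots> = \<bar>q $ j\<bar> / real (Suc n)"
      by simp
    finally have "real (Suc n) * \<bar>wmax (y n) q - wmax x q\<bar> \<le> \<bar>q $ j\<bar>"
      by (simp add: field_simps)
    then show ?thesis
      by (simp only: abs_mult abs_of_nat)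
  qed
  have ptwise: "(\<lambda>n. real (Suc n) * (wmax (y n) q - wmax x q))
      \<longlonglongrightarrow> q $ j * indicator {q. wmax x q \<le> q $ j} q" if q: "q \<in> unit_simplex" for q
  proof -
    have qj: "0 \<le> q $ j"
      using q by (auto simp: unit_simplex_def unit_cube_def)
    have wy: "wmax (y n) q = max (wmax x q) ((1 + 1 / real (Suc n)) * q $ j)" for n
    proof (rule antisym)
      show "wmax (y n) q \<le> max (wmax x q) ((1 + 1 / real (Suc n)) * q $ j)"
        unfolding wmax_le_iff using wmax_upper[of x _ q] x
        by (auto simp: y_def axis_def intro: max.coboundedI1)
      have "x $ k * q $ k \<le> y n $ k * q $ k" for k
        using q by (intro mult_right_mono) (auto simp: y_def axis_def unit_simplex_def unit_cube_def)
      then have "wmax x q \<le> wmax (y n) q"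
        unfolding wmax_le_iff[of x] using wmax_upper[of "y n" _ q] order_trans by blast
      then show "max (wmax x q) ((1 + 1 / real (Suc n)) * q $ j) \<le> wmax (y n) q"
        using wmax_upper[of "y n" j q] x by (simp add: y_def axis_def)
    qed
    show ?thesis
    proof (cases "wmax x q \<le> q $ j")
      case True
      then have "wmax x q = q $ j"
        using wmax_upper[of x j q] x by simp
      then have "real (Suc n) * (wmax (y n) q - wmax x q) = q $ j" for n
        using qj by (simp add: wy max_def field_simps)
      then show ?thesis
        using True by simp
    next
      case False
      have "(\<lambda>n. (1 + 1 / real (Suc n)) * q $ j) \<longlonglongrightarrow> (1 + 0) * q $ j"
        by (intro tendsto_intros LIMSEQ_Suc lim_1_over_n)
      then have "\<forall>\<^sub>F n in sequentially. (1 + 1 / real (Suc n)) * q $ j < wmax x q"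
        using False by (intro order_tendstoD) auto
      then have "\<forall>\<^sub>F n in sequentially. real (Suc n) * (wmax (y n) q - wmax x q) = 0"
        by eventually_elim (simp add: wy)
      then show ?thesis
        using False by (simp add: tendsto_eventually)
    qed
  qed
  have "(\<lambda>n. \<integral>q. real (Suc n) * (wmax (y n) q - wmax x q) \<partial>\<nu>)
      \<longlonglongrightarrow> (\<integral>q. q $ j * indicator {q. wmax x q \<le> q $ j} q \<partial>\<nu>)"
  proof (rule integral_dominated_convergence[where w = "\<lambda>q. \<bar>q $ j\<bar>"])
    show "integrable \<nu> (\<lambda>q. \<bar>q $ j\<bar>)"
      using \<nu> by (intro integrable_continuous_on_unit_cube)
        (auto intro!: continuous_intros AE_unit_simplex_imp_unit_cube)
    show "AE q in \<nu>. (\<lambda>n. real (Suc n) * (wmax (y n) q - wmax x q))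
        \<longlonglongrightarrow> q $ j * indicator {q. wmax x q \<le> q $ j} q"
      using \<nu>(3) by eventually_elim (use ptwise in auto)
    show "AE q in \<nu>. norm (real (Suc n) * (wmax (y n) q - wmax x q)) \<le> \<bar>q $ j\<bar>" for n
      unfolding real_norm_def using bound by (intro AE_I2)
  qed measurable
  then show ?thesis
    by (simp add: y_def int Bochner_Integration.integral_diff)
qed

text \<open>
  The measure \<open>q\<^sub>j \<nu>(dq)\<close> seen in the chart \<open>q / q\<^sub>j\<close>: its distribution function is the right
  derivative of \<open>x \<mapsto> \<integral>q. wmax x q \<partial>\<nu>\<close> in direction \<open>j\<close>.
\<close>

definition tilt :: "(real ^ 'n) measure \<Rightarrow> 'n \<Rightarrow> (real ^ 'n) measure" where
  "tilt \<nu> j = distr (density \<nu> (\<lambda>q. ennreal (q $ j))) borel (\<lambda>q. (1 / q $ j) *\<^sub>R q)"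

lemma emeasure_tilt:
  fixes \<nu> :: "(real ^ 'n) measure"
  assumes sets: "sets \<nu> = sets borel" and A: "A \<in> sets borel"
  shows "emeasure (tilt \<nu> j) A = (\<integral>\<^sup>+q. ennreal (q $ j) * indicator A ((1 / q $ j) *\<^sub>R q) \<partial>\<nu>)"
proof -
  have [measurable_cong]: "sets \<nu> = sets borel" by fact
  have [simp]: "space \<nu> = UNIV"
    using sets sets_eq_imp_space_eq by fastforce
  have T: "(\<lambda>q :: real ^ 'n. (1 / q $ j) *\<^sub>R q) \<in> borel_measurable borel"
    by measurable
  have "emeasure (tilt \<nu> j) A
      = emeasure (density \<nu> (\<lambda>q. ennreal (q $ j))) ((\<lambda>q. (1 / q $ j) *\<^sub>R q) -` A)"
    unfolding tilt_def using A T sets by (subst emeasure_distr) (auto cong: measurable_cong_sets)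
  also have "\<dots> = (\<integral>\<^sup>+q. ennreal (q $ j) * indicator ((\<lambda>q. (1 / q $ j) *\<^sub>R q) -` A) q \<partial>\<nu>)"
    using measurable_sets_borel[OF T A] sets by (intro emeasure_density) auto
  also have "\<dots> = (\<integral>\<^sup>+q. ennreal (q $ j) * indicator A ((1 / q $ j) *\<^sub>R q) \<partial>\<nu>)"
    by (intro nn_integral_cong) (auto simp: indicator_def)
  finally show ?thesis .
qed

lemma finite_measure_tilt:
  assumes \<nu>: "prob_space \<nu>" "sets \<nu> = sets borel" "AE q in \<nu>. q \<in> unit_simplex"
  shows "finite_measure (tilt \<nu> j)"
proof
  interpret prob_space \<nu> by fact
  have "emeasure (tilt \<nu> j) UNIV = (\<integral>\<^sup>+q. ennreal (q $ j) \<partial>\<nu>)"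
    by (simp add: emeasure_tilt[OF \<nu>(2)])
  also have "\<dots> \<le> (\<integral>\<^sup>+q. 1 \<partial>\<nu>)"
    using \<nu>(3) by (intro nn_integral_mono_AE, eventually_elim)
      (auto simp: unit_simplex_def unit_cube_def ennreal_le_1)
  also have "\<dots> < \<infinity>"
    by (simp add: emeasure_space_1)
  finally show "emeasure (tilt \<nu> j) (space (tilt \<nu> j)) \<noteq> \<infinity>"
    by (simp add: tilt_def)
qed

text \<open>Where \<open>q $ j\<close> is positive, \<open>q / q\<^sub>j \<le> y\<close> says that
  every \<open>q $ k / y $ k\<close> is at most \<open>q $ j\<close>. For \<open>k = j\<close> this
  holds by \<open>1 \<le> y $ j\<close>, so the j-th weight may be set to 1, the normalization
  required for the derivative.\<close>

lemma emeasure_tilt_atMost_pos: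
  fixes \<nu> :: "(real ^ 'n) measure"
  assumes \<nu>: "prob_space \<nu>" "sets \<nu> = sets borel" "AE q in \<nu>. q \<in> unit_simplex"
    and y: "\<And>k. 0 < y $ k" "1 \<le> y $ j"
  defines "x \<equiv> (\<chi> k. if k = j then 1 else 1 / y $ k)"
  shows "emeasure (tilt \<nu> j) {..y} = ennreal (\<integral>q. q $ j * indicator {q. wmax x q \<le> q $ j} q \<partial>\<nu>)"
proof -
  interpret prob_space \<nu> by fact
  have [measurable_cong]: "sets \<nu> = sets borel" by fact
  have A: "{..y} \<in> sets borel"
    by simp
  have "emeasure (tilt \<nu> j) {..y} = (\<integral>\<^sup>+q. ennreal (q $ j * indicator {q. wmax x q \<le> q $ j} q) \<partial>\<nu>)"
  proof (subst emeasure_tilt[OF \<nu>(2) A], rule nn_integral_cong_AE)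
    show "AE q in \<nu>. ennreal (q $ j) * indicator {..y} ((1 / q $ j) *\<^sub>R q)
        = ennreal (q $ j * indicator {q. wmax x q \<le> q $ j} q)"
      using \<nu>(3)
    proof eventually_elim
      case (elim q)
      show ?case
      proof (cases "q $ j = 0")
        case False
        then have qj: "0 < q $ j"
          using elim by (auto simp: unit_simplex_def unit_cube_def less_le)
        have "(q $ k / q $ j \<le> y $ k) = (x $ k * q $ k \<le> q $ j)" for k
          using qj y(1)[of k] y(2) by (auto simp: x_def field_simps)
        then have "((1 / q $ j) *\<^sub>R q \<le> y) = (wmax x q \<le> q $ j)"
          by (simp add: wmax_le_iff less_eq_vec_def)
        then show ?thesis
          by (auto simp: indicator_def)
      qed simp
    qed
  qed
  also have "\<dots> = ennreal (\<integral>q. q $ j * indicator {q. wmax x q \<le> q $ j} q \<partial>\<nu>)"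
  proof (rule nn_integral_eq_integral)
    show "AE q in \<nu>. 0 \<le> q $ j * indicator {q. wmax x q \<le> q $ j} q"
      using \<nu>(3) by eventually_elim (auto simp: unit_simplex_def unit_cube_def)
    show "integrable \<nu> (\<lambda>q. q $ j * indicator {q. wmax x q \<le> q $ j} q)"
    proof (rule integrable_const_bound)
      show "AE q in \<nu>. norm (q $ j * indicator {q. wmax x q \<le> q $ j} q) \<le> 1"
        using \<nu>(3) by eventually_elim (auto simp: unit_simplex_def unit_cube_def indicator_def)
    qed measurable
  qed
  finally show ?thesis .
qed

text \<open>The tilted law lives on vectors with nonnegative coordinates and j-th coordinate 1;
  points with \<open>q $ j = 0\<close> carry no weight.\<close>

lemma emeasure_tilt_atMost_zero:
  fixes \<nu> :: "(real ^ 'n) measure"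
  assumes \<nu>: "sets \<nu> = sets borel" "AE q in \<nu>. q \<in> unit_simplex"
    and y: "y $ k < 0 \<or> y $ j < 1"
  shows "emeasure (tilt \<nu> j) {..y} = 0"
proof -
  have "AE q in \<nu>. ennreal (q $ j) * indicator {..y} ((1 / q $ j) *\<^sub>R q) = 0"
    using \<nu>(2)
  proof eventually_elim
    case (elim q)
    show ?case
    proof (cases "q $ j = 0")
      case False
      have "\<not> (1 / q $ j) *\<^sub>R q \<le> y"
      proof
        assume "(1 / q $ j) *\<^sub>R q \<le> y"
        then have "q $ i / q $ j \<le> y $ i" for i
          by (simp add: less_eq_vec_def)
        from this[of j] this[of k] show False
          using elim False y by (auto simp: unit_simplex_def unit_cube_def not_le[symmetric])
            (meson divide_nonneg_nonneg order_trans)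
      qed
      then show ?thesis
        by simp
    qed simp
  qed
  then show ?thesis
    by (subst emeasure_tilt[OF \<nu>(1)], simp, subst nn_integral_cong_AE[where v = "\<lambda>_. 0"]) auto
qed

text \<open>The coordinates of \<open>q\<close> sum to 1, so the weights \<open>q $ j\<close>
  distribute the whole mass among the charts, and dividing a chart point by its coordinate sum
  recovers \<open>q\<close>.\<close>

lemma emeasure_eq_sum_tilt:
  fixes \<nu> :: "(real ^ 'n) measure"
  assumes \<nu>: "sets \<nu> = sets borel" "AE q in \<nu>. q \<in> unit_simplex" and A: "A \<in> sets borel"
  shows "emeasure \<nu> A = (\<Sum>j\<in>UNIV. emeasure (tilt \<nu> j) {z. (1 / (\<Sum>k\<in>UNIV. z $ k)) *\<^sub>R z \<in> A})"
proof -
  have [measurable_cong]: "sets \<nu> = sets borel" by fact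
  note [measurable] = A
  have B: "{z :: real ^ 'n. (1 / (\<Sum>k\<in>UNIV. z $ k)) *\<^sub>R z \<in> A} \<in> sets borel" (is "?B \<in> _")
    by measurable
  have "emeasure \<nu> A = (\<integral>\<^sup>+q. indicator A q \<partial>\<nu>)"
    using A \<nu>(1) by simp
  also have "\<dots> = (\<integral>\<^sup>+q. (\<Sum>j\<in>UNIV. ennreal (q $ j) * indicator ?B ((1 / q $ j) *\<^sub>R q)) \<partial>\<nu>)"
  proof (rule nn_integral_cong_AE)
    show "AE q in \<nu>. indicator A q = (\<Sum>j\<in>UNIV. ennreal (q $ j) * indicator ?B ((1 / q $ j) *\<^sub>R q))"
      using \<nu>(2)
    proof eventually_elim
      case (elim q)
      have *: "ennreal (q $ j) * indicator ?B ((1 / q $ j) *\<^sub>R q) = ennreal (q $ j) * indicator A q" for j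
      proof (cases "q $ j = 0")
        case False
        have "(\<Sum>k\<in>UNIV. q $ k / q $ j) = 1 / q $ j"
          using elim by (simp add: unit_simplex_def flip: sum_divide_distrib)
        then have "(1 / (\<Sum>k\<in>UNIV. ((1 / q $ j) *\<^sub>R q) $ k)) *\<^sub>R (1 / q $ j) *\<^sub>R q = q"
          using False by simp
        then show ?thesis
          by (simp add: indicator_def)
      qed simp
      have "(\<Sum>j\<in>UNIV. ennreal (q $ j)) = 1"
        using elim by (subst sum_ennreal) (auto simp: unit_simplex_def unit_cube_def)
      then show ?case
        unfolding * by (simp flip: sum_distrib_right)
    qed
  qed
  also have "\<dots> = (\<Sum>j\<in>UNIV. emeasure (tilt \<nu> j) ?B)"
    by (subst nn_integral_sum) (auto simp: emeasure_tilt[OF \<nu>(1) B])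
  finally show ?thesis .
qed

theorem pickands_unique:
  fixes \<nu> \<nu>' :: "(real ^ 'n) measure"
  assumes \<nu>: "prob_space \<nu>" "sets \<nu> = sets borel" "AE q in \<nu>. q \<in> unit_simplex"
    and \<nu>': "prob_space \<nu>'" "sets \<nu>' = sets borel" "AE q in \<nu>'. q \<in> unit_simplex"
    and eq: "\<And>x. x \<in> orthant \<Longrightarrow> (\<integral>q. wmax x q \<partial>\<nu>) = (\<integral>q. wmax x q \<partial>\<nu>')"
  shows "\<nu> = \<nu>'"
proof -
  have derivative_eq: "(\<integral>q. q $ j * indicator {q. wmax x q \<le> q $ j} q \<partial>\<nu>)
      = (\<integral>q. q $ j * indicator {q. wmax x q \<le> q $ j} q \<partial>\<nu>')"
    if x: "x \<in> orthant" "x $ j = 1" for x :: "real ^ 'n" and j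
  proof -
    have "x + axis j (1 / real (Suc n)) \<in> orthant" for n
      using x by (auto simp: orthant_def axis_def)
    then show ?thesis
      using wmax_right_derivative[OF \<nu> x(2)] wmax_right_derivative[OF \<nu>' x(2)] eq x
      by (intro LIMSEQ_unique) auto
  qed
  have tilt_pos: "emeasure (tilt \<nu> j) {..y} = emeasure (tilt \<nu>' j) {..y}" if y: "\<And>k. 0 < y $ k" for j y
  proof (cases "1 \<le> y $ j")
    case True
    then show ?thesis
      using y by (simp add: emeasure_tilt_atMost_pos[OF \<nu>] emeasure_tilt_atMost_pos[OF \<nu>'])
        (subst derivative_eq, auto simp: orthant_def intro: less_imp_le)
  next
    case False
    then show ?thesis
      using \<nu> \<nu>' by (simp add: emeasure_tilt_atMost_zero)
  qed
  have "tilt \<nu> j = tilt \<nu>' j" for j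
  proof (rule finite_measure_eqI_atMost)
    show "finite_measure (tilt \<nu> j)"
      by (rule finite_measure_tilt[OF \<nu>])
    show sets: "sets (tilt \<nu> j) = sets borel" "sets (tilt \<nu>' j) = sets borel"
      by (simp_all add: tilt_def)
    fix y :: "real ^ 'n"
    show "emeasure (tilt \<nu> j) {..y} = emeasure (tilt \<nu>' j) {..y}"
    proof (cases "\<exists>k. y $ k < 0")
      case True
      then obtain k where "y $ k < 0" ..
      then show ?thesis
        using \<nu> \<nu>' by (simp add: emeasure_tilt_atMost_zero[where k = k])
    next
      case False
      define Y where "Y n = y + (\<chi> k. 1 / real (Suc n))" for n
      have Y_lim: "(\<lambda>n. emeasure (tilt \<mu> j) {..Y n}) \<longlonglongrightarrow> emeasure (tilt \<mu> j) {..y}"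
        if \<mu>: "prob_space \<mu>" "sets \<mu> = sets borel" "AE q in \<mu>. q \<in> unit_simplex" for \<mu>
      proof -
        interpret T: finite_measure "tilt \<mu> j"
          by (rule finite_measure_tilt[OF \<mu>])
        have "(\<lambda>n. emeasure (tilt \<mu> j) {..Y n}) \<longlonglongrightarrow> emeasure (tilt \<mu> j) (\<Inter>n. {..Y n})"
        proof (rule Lim_emeasure_decseq)
          show "decseq (\<lambda>n. {..Y n})"
          proof (rule decseq_SucI)
            fix n
            have "Y (Suc n) \<le> Y n"
              by (auto simp: Y_def less_eq_vec_def field_simps)
            then show "{..Y (Suc n)} \<subseteq> {..Y n}"
              by auto
          qed
          show "range (\<lambda>n. {..Y n}) \<subseteq> sets (tilt \<mu> j)"
            by (auto simp: tilt_def)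
        qed simp
        also have "(\<Inter>n. {..Y n}) = {..y}"
        proof (intro equalityI subsetI)
          fix z assume z: "z \<in> (\<Inter>n. {..Y n})"
          have "z $ k \<le> y $ k" for k
          proof (rule LIMSEQ_le_const)
            have "(\<lambda>n. y $ k + 1 / real (Suc n)) \<longlonglongrightarrow> y $ k + 0"
              by (intro tendsto_intros LIMSEQ_Suc lim_1_over_n)
            then show "(\<lambda>n. y $ k + 1 / real (Suc n)) \<longlonglongrightarrow> y $ k"
              by simp
            show "\<exists>N. \<forall>n\<ge>N. z $ k \<le> y $ k + 1 / real (Suc n)"
              using z by (auto simp: Y_def less_eq_vec_def)
          qed
          then show "z \<in> {..y}"
            by (simp add: less_eq_vec_def)
        next
          fix z assume "z \<in> {..y}"
          moreover have "y \<le> Y n" for n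
            by (auto simp: Y_def less_eq_vec_def)
          ultimately show "z \<in> (\<Inter>n. {..Y n})"
            using order_trans by auto
        qed
        finally show ?thesis .
      qed
      have "0 < Y n $ k" for n k
        using False by (auto simp: Y_def not_less intro: add_nonneg_pos)
      then show ?thesis
        using Y_lim[OF \<nu>] Y_lim[OF \<nu>'] tilt_pos by (intro LIMSEQ_unique) auto
    qed
  qed
  then show ?thesis
    using \<nu> \<nu>' by (intro measure_eqI) (auto simp: emeasure_eq_sum_tilt)
qed


section \<open>Limits of stable tail dependence functions\<close>

definition survival_function :: "(real ^ 'n \<Rightarrow> real) \<Rightarrow> bool" where
  "survival_function F \<longleftrightarrow>
     (\<exists>N. prob_space N \<and> sets N = sets borel \<and> (\<forall>x\<in>orthant. measure N {x..} = F x))"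

lemma survival_function_cong:
  "(\<And>x. x \<in> orthant \<Longrightarrow> F x = G x) \<Longrightarrow> survival_function F \<longleftrightarrow> survival_function G"
  by (simp add: survival_function_def)

lemma survival_function_scale:
  fixes F :: "real ^ 'n \<Rightarrow> real"
  assumes "survival_function F" and t: "0 < t"
  shows "survival_function (\<lambda>x. F (t *\<^sub>R x))"
proof -
  obtain N where N: "prob_space N" "sets N = sets borel" "\<And>x. x \<in> orthant \<Longrightarrow> measure N {x..} = F x"
    using assms unfolding survival_function_def by blast
  interpret prob_space N by fact
  have [measurable_cong]: "sets N = sets borel" by fact
  have [simp]: "space N = UNIV"
    using sets_eq_imp_space_eq[OF N(2)] by simp
  let ?D = "distr N borel (\<lambda>y. (1 / t) *\<^sub>R y)"
  have "measure ?D {x..} = F (t *\<^sub>R x)" if "x \<in> orthant" for x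
  proof -
    have "(\<lambda>y. (1 / t) *\<^sub>R y) -` {x..} = {t *\<^sub>R x..}"
      using t by (auto simp: less_eq_vec_def field_simps)
    then show ?thesis
      using t N(3)[OF orthant_scaleR[OF that, of t]] by (subst measure_distr) auto
  qed
  then show ?thesis
    unfolding survival_function_def using prob_space_distr[of "\<lambda>y. (1 / t) *\<^sub>R y" borel]
    by (intro exI[of _ ?D]) auto
qed

text \<open>The product is the survival function of the componentwise minimum of two independent
  vectors.\<close>

lemma survival_function_mult:
  fixes F G :: "real ^ 'n \<Rightarrow> real"
  assumes "survival_function F" "survival_function G"
  shows "survival_function (\<lambda>x. F x * G x)"
proof -
  obtain N where N: "prob_space N" "sets N = sets borel" "\<And>x. x \<in> orthant \<Longrightarrow> measure N {x..} = F x"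
    using assms unfolding survival_function_def by blast
  obtain M where M: "prob_space M" "sets M = sets borel" "\<And>x. x \<in> orthant \<Longrightarrow> measure M {x..} = G x"
    using assms unfolding survival_function_def by blast
  interpret N: prob_space N by fact
  interpret M: prob_space M by fact
  interpret NM: pair_prob_space N M ..
  have [measurable_cong]: "sets N = sets borel" "sets M = sets borel" by fact+
  have [simp]: "space N = UNIV" "space M = UNIV"
    using sets_eq_imp_space_eq[OF N(2)] sets_eq_imp_space_eq[OF M(2)] by simp_all
  define h :: "(real ^ 'n) \<times> (real ^ 'n) \<Rightarrow> real ^ 'n" where "h z = (\<chi> k. min (fst z $ k) (snd z $ k))" for z
  have h [measurable]: "h \<in> borel_measurable (N \<Otimes>\<^sub>M M)"
    unfolding h_def by measurable
  let ?D = "distr (N \<Otimes>\<^sub>M M) borel h"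
  have "measure ?D {x..} = F x * G x" if "x \<in> orthant" for x
  proof -
    have "h -` {x..} = {x..} \<times> {x..}"
      by (auto simp: h_def less_eq_vec_def)
    then have "measure ?D {x..} = measure (N \<Otimes>\<^sub>M M) ({x..} \<times> {x..})"
      by (subst measure_distr) (auto simp: space_pair_measure)
    also have "\<dots> = measure N {x..} * measure M {x..}"
      using N(2) M(2) by (simp add: measure_def M.emeasure_pair_measure_Times enn2real_mult)
    finally show ?thesis
      using that by (simp add: N M)
  qed
  then show ?thesis
    unfolding survival_function_def using NM.prob_space_distr[of h borel]
    by (intro exI[of _ ?D]) auto
qed

lemma survival_function_prod:
  assumes "finite I" "I \<noteq> {}" "\<And>i. i \<in> I \<Longrightarrow> survival_function (F i)"
  shows "survival_function (\<lambda>x. \<Prod>i\<in>I. F i x)"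
  using assms
proof (induction rule: finite_ne_induct)
  case (insert i I)
  then have "survival_function (\<lambda>x. F i x * (\<Prod>i\<in>I. F i x))"
    by (intro survival_function_mult) auto
  then show ?case
    using insert by simp
qed simp

text \<open>This is complete dependence: all coordinates are multiples \<open>E / q\<^sub>k\<close>
  of a single standard exponential variable \<open>E = - ln U\<close> with \<open>U\<close>
  uniform.\<close>

lemma survival_function_exp_wmax:
  fixes q :: "real ^ 'n"
  assumes q: "\<And>k. 0 < q $ k"
  shows "survival_function (\<lambda>x. exp (- wmax x q))"
proof -
  define U where "U = uniform_measure lborel {0..1 :: real}"
  interpret U: prob_space U
    unfolding U_def by (rule prob_space_uniform_measure) auto
  have sets_U [measurable_cong]: "sets U = sets borel"
    by (simp add: U_def)
  have [simp]: "space U = UNIV"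
    by (simp add: U_def)
  have "measure U {..0} = 0"
    using measure_uniform_unit_interval_atMost[of 0] by (simp add: U_def)
  then have U_pos: "AE u in U. 0 < u"
    by (intro AE_I[of _ _ "{..0}"]) (auto simp: U.emeasure_eq_measure sets_U)
  define h where "h u = (\<chi> k. - ln u / q $ k)" for u
  have h [measurable]: "h \<in> borel_measurable borel"
    unfolding h_def by measurable
  have "measure (distr U borel h) {x..} = exp (- wmax x q)" if x: "x \<in> orthant" for x
  proof -
    have "measure (distr U borel h) {x..} = measure U (h -` {x..})"
      by (subst measure_distr) auto
    also have "\<dots> = measure U {..exp (- wmax x q)}"
    proof (rule U.finite_measure_eq_AE)
      show "AE u in U. (u \<in> h -` {x..}) = (u \<in> {..exp (- wmax x q)})"
        using U_pos
      proof eventually_elim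
        case (elim u)
        have "(x \<le> h u) = (wmax x q \<le> - ln u)"
          using q by (simp add: h_def less_eq_vec_def wmax_le_iff field_simps)
        also have "\<dots> = (u \<le> exp (- wmax x q))"
          using elim ln_le_cancel_iff[of u "exp (- wmax x q)"] by auto
        finally show ?case
          by simp
      qed
      show "h -` {x..} \<in> U.events"
        using measurable_sets_borel[OF h, of "{x..}"] by (simp add: sets_U)
    qed (simp add: sets_U)
    also have "\<dots> = exp (- wmax x q)"
      unfolding U_def
      by (rule measure_uniform_unit_interval_atMost)
        (use q x in \<open>auto intro!: wmax_nonneg simp: orthant_def less_imp_le\<close>)
    finally show ?thesis .
  qed
  then show ?thesis
    unfolding survival_function_def using U.prob_space_distr[of h borel]
    by (intro exI[of _ "distr U borel h"]) auto
qed

lemma survival_function_nonneg_AE: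
  fixes N :: "(real ^ 'n) measure"
  assumes "prob_space N" "sets N = sets borel" "measure N {0..} = 1"
  shows "AE y in N. y \<in> orthant"
proof -
  interpret prob_space N by fact
  have "AE y in N. y \<in> {0..}"
    using assms prob_eq_1[of "{0..}"] by simp
  then show ?thesis
    by eventually_elim (auto simp: orthant_def less_eq_vec_def)
qed

text \<open>
  In the coordinates \<open>u = exp (- y)\<close> the laws live on the unit cube, so a subsequence converges
  weakly; continuity of the limiting tail dependence function identifies the survival function of
  the weak limit.
\<close>

lemma stdf_limit:
  fixes f :: "real ^ 'n \<Rightarrow> real"
  assumes ext: "f \<in> extensional orthant" and cont: "continuous_on orthant f"
    and g: "\<And>n. stdf (g n)" and lim: "\<And>x. x \<in> orthant \<Longrightarrow> (\<lambda>n. g n x) \<longlonglongrightarrow> f x"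
  shows "stdf f"
proof -
  have hom: "f (t *\<^sub>R x) = t * f x" if "x \<in> orthant" "0 < t" for t x
    using lim[OF orthant_scaleR[OF that(1), of t]] tendsto_mult_left[OF lim[OF that(1)], of t] that
    by (intro LIMSEQ_unique) (auto simp: stdf_survivalD(2)[OF g])
  have axis: "f (axis k t) = t" if "0 \<le> t" for k t
    using lim[OF orthant_axis[OF that, of k]] that
    by (auto simp: stdf_survivalD(3)[OF g] LIMSEQ_const_iff)
  obtain N where N: "\<And>n. prob_space (N n)" "\<And>n. sets (N n) = sets borel"
    and surv: "\<And>n x. x \<in> orthant \<Longrightarrow> measure (N n) {x..} = exp (- g n x)"
    using stdf_survivalD(4)[OF g] by metis
  have axis_0: "axis k (0 :: real) = 0" for k :: 'n
    by (simp add: axis_def vec_eq_iff)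
  have zero: "(0 :: real ^ 'n) \<in> orthant"
    by (simp add: orthant_def)
  have N_orthant: "AE y in N n. y \<in> orthant" for n
    using surv[OF zero, of n] stdf_survivalD(3)[OF g, of 0 n] N
    by (intro survival_function_nonneg_AE) (auto simp: axis_0)
  \<comment> \<open>The truncation at 0 sends every point into the cube; on the orthant, where the
    laws live, it changes nothing.\<close>
  define e where "e y = (\<chi> k. exp (- max 0 (y $ k)))" for y :: "real ^ 'n"
  have e_cube: "e y \<in> unit_cube" for y
    by (simp add: e_def unit_cube_def)
  have e [measurable]: "e \<in> borel_measurable borel"
    unfolding e_def by measurable
  have e_meas [measurable]: "e \<in> borel_measurable (N n)" for n
    using e N(2) by (simp cong: measurable_cong_sets)
  have space_N: "space (N n) = UNIV" for n
    using sets_eq_imp_space_eq[OF N(2)] by simp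
  define M where "M n = distr (N n) borel e" for n
  have M: "prob_space (M n)" "sets (M n) = sets borel" "AE u in M n. u \<in> unit_cube" for n
  proof -
    show "prob_space (M n)"
      unfolding M_def by (rule prob_space.prob_space_distr[OF N(1) e_meas])
    show "sets (M n) = sets borel"
      by (simp add: M_def)
    show "AE u in M n. u \<in> unit_cube"
      unfolding M_def by (subst AE_distr_iff[OF e_meas]) (simp_all add: e_cube)
  qed
  have M_e: "measure (M n) {..e x} = exp (- g n x)" if x: "x \<in> orthant" for n x
  proof -
    interpret N: prob_space "N n" by (rule N)
    have "measure (M n) {..e x} = measure (N n) (e -` {..e x})"
      unfolding M_def by (subst measure_distr) (auto simp: space_N)
    also have "\<dots> = measure (N n) {x..}"
    proof (rule N.finite_measure_eq_AE)
      show "AE y in N n. (y \<in> e -` {..e x}) = (y \<in> {x..})"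
        using N_orthant by eventually_elim (use x in \<open>auto simp: e_def orthant_def less_eq_vec_def\<close>)
      show "e -` {..e x} \<in> N.events"
        using measurable_sets_borel[OF e, of "{..e x}"] by (simp add: N)
    qed (simp add: N)
    finally show ?thesis
      using surv[OF x] by simp
  qed
  obtain r \<mu> where r: "strict_mono (r :: nat \<Rightarrow> nat)" and \<mu>: "prob_space \<mu>" "sets \<mu> = sets borel"
    "AE u in \<mu>. u \<in> unit_cube"
    and weak: "\<And>\<phi> :: real ^ 'n \<Rightarrow> real. continuous_on UNIV \<phi> \<Longrightarrow>
      (\<lambda>n. \<integral>u. \<phi> u \<partial>M (r n)) \<longlonglongrightarrow> (\<integral>u. \<phi> u \<partial>\<mu>)"
    by (rule weakly_convergent_subsequence_unit_cube[of M, OF M]) (rule that; simp)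
  interpret \<mu>: prob_space \<mu> by fact
  have sets_\<mu> [measurable_cong]: "sets \<mu> = sets borel" by fact
  have space_\<mu>: "space \<mu> = UNIV"
    using sets_eq_imp_space_eq[OF \<mu>(2)] by simp
  have lim_r: "(\<lambda>n. exp (- g (r n) x)) \<longlonglongrightarrow> exp (- f x)" if "x \<in> orthant" for x
    using LIMSEQ_subseq_LIMSEQ[OF lim[OF that] r] by (intro tendsto_intros) (simp add: o_def)
  have \<mu>_e: "measure \<mu> {..e x} = exp (- f x)" if x: "x \<in> orthant" for x
  proof -
    \<comment> \<open>\<open>s u\<close> is the total excess of \<open>u\<close> over
      \<open>e x\<close>. The functions \<open>\<phi> n\<close> built from it are continuous and
      lie, on the cube, between the indicators of \<open>{..e x}\<close> and
      \<open>{..e (X n)}\<close>, so weak convergence can be applied to them.\<close>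
    define s where "s u = (\<Sum>k\<in>UNIV. max 0 (u $ k - e x $ k))" for u :: "real ^ 'n"
    define \<phi> where "\<phi> n u = max 0 (1 - real (Suc n) * s u)" for n :: nat and u
    \<comment> \<open>Chosen so that \<open>e (X n)\<close> is \<open>e x\<close> enlarged by
      \<open>1 / real (Suc n)\<close> in each coordinate; the cap at 1 keeps \<open>X n\<close> in
      the orthant.\<close>
    define X where "X n = (\<chi> k. - ln (min 1 (e x $ k + 1 / real (Suc n))))" for n :: nat
    have e_x: "0 < e x $ k" "e x $ k \<le> 1" for k
      using e_cube[of x] by (auto simp: unit_cube_def) (simp add: e_def)
    have min_pos: "0 < min 1 (e x $ k + 1 / real (Suc n))" for n k
      using e_x[of k] by (auto intro: add_pos_pos)
    have X: "X n \<in> orthant" for n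
      using min_pos by (auto simp: X_def orthant_def intro: ln_le_zero_iff[THEN iffD2])
    have e_X: "e (X n) $ k = min 1 (e x $ k + 1 / real (Suc n))" for n k
    proof -
      have "max 0 (X n $ k) = X n $ k"
        using X[of n] by (simp add: orthant_def)
      then show ?thesis
        using min_pos[of k n] by (simp add: e_def[of "X n"]) (simp add: X_def)
    qed
    have X_lim: "X \<longlonglongrightarrow> x"
    proof (rule vec_tendstoI)
      fix k
      have "(\<lambda>n. - ln (min 1 (e x $ k + 1 / real (Suc n)))) \<longlonglongrightarrow> - ln (min 1 (e x $ k + 0))"
        using e_x[of k] by (intro tendsto_intros LIMSEQ_Suc lim_1_over_n) auto
      moreover have "- ln (min 1 (e x $ k + 0)) = x $ k"
        using e_x[of k] x by (simp add: min_def) (simp add: e_def orthant_def)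
      ultimately show "(\<lambda>n. X n $ k) \<longlonglongrightarrow> x $ k"
        by (simp add: X_def)
    qed
    have s_nonneg: "0 \<le> s u" for u
      unfolding s_def by (intro sum_nonneg) auto
    have s_zero: "s u = 0 \<longleftrightarrow> u \<le> e x" for u
    proof -
      have "(max 0 (u $ k - e x $ k) = 0) = (u $ k \<le> e x $ k)" for k
        by (simp add: max_def)
      then show ?thesis
        unfolding s_def by (subst sum_nonneg_eq_0_iff) (simp_all add: less_eq_vec_def)
    qed
    have \<phi>_cont: "continuous_on UNIV (\<phi> n)" for n
      unfolding \<phi>_def s_def by (intro continuous_intros)
    have \<phi>_meas [measurable]: "\<phi> n \<in> borel_measurable borel" for n
      by (rule borel_measurable_continuous_onI[OF \<phi>_cont])
    have \<phi>_bounds: "0 \<le> \<phi> n u" "\<phi> n u \<le> 1" for n u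
      using s_nonneg[of u] by (auto simp: \<phi>_def)
    have \<phi>_lower: "indicator {..e x} u \<le> \<phi> n u" for n u
      using \<phi>_bounds s_zero[of u] by (auto simp: indicator_def \<phi>_def)
    have \<phi>_upper: "\<phi> n u \<le> indicator {..e (X n)} u" if "u \<in> unit_cube" for n u
    proof (cases "\<phi> n u = 0")
      case False
      then have "s u < 1 / real (Suc n)"
        by (simp add: \<phi>_def max_def field_simps split: if_splits)
      have "u $ k \<le> e x $ k + 1 / real (Suc n)" for k
      proof -
        have "u $ k - e x $ k \<le> s u"
          unfolding s_def using member_le_sum[of k UNIV "\<lambda>k. max 0 (u $ k - e x $ k)"] by simp
        then show ?thesis
          using \<open>s u < 1 / real (Suc n)\<close> by linarith
      qed
      then have "u \<in> {..e (X n)}"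
        using that by (auto simp: less_eq_vec_def e_X unit_cube_def)
      then show ?thesis
        using \<phi>_bounds by simp
    qed simp
    have int: "integrable L (\<phi> n)" if "prob_space L" "sets L = sets borel" for L n
    proof -
      interpret L: prob_space L by fact
      show ?thesis
        using \<phi>_bounds \<phi>_meas[of n] that(2)
        by (intro L.integrable_const_bound[of _ 1]) (auto cong: measurable_cong_sets)
    qed
    have sandwich: "exp (- g m x) \<le> (\<integral>u. \<phi> n u \<partial>M m)" "(\<integral>u. \<phi> n u \<partial>M m) \<le> exp (- g m (X n))" for m n
    proof -
      interpret M: prob_space "M m" by (rule M)
      have ind: "integrable (M m) (indicator {..z} :: _ \<Rightarrow> real)" for z
        by (simp add: M(2) less_top[symmetric])
      have "(\<integral>u. indicator {..e x} u \<partial>M m) \<le> (\<integral>u. \<phi> n u \<partial>M m)"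
        using \<phi>_lower by (intro integral_mono ind int M)
      then show "exp (- g m x) \<le> (\<integral>u. \<phi> n u \<partial>M m)"
        using M_e[OF x] M(2)[of m] by simp
      have "(\<integral>u. \<phi> n u \<partial>M m) \<le> (\<integral>u. indicator {..e (X n)} u \<partial>M m)"
      proof (rule integral_mono_AE)
        show "AE u in M m. \<phi> n u \<le> indicator {..e (X n)} u"
          using M(3)[of m] by eventually_elim (rule \<phi>_upper)
      qed (intro ind int M)+
      then show "(\<integral>u. \<phi> n u \<partial>M m) \<le> exp (- g m (X n))"
        using M_e[OF X] M(2)[of m] by simp
    qed
    have lower: "exp (- f x) \<le> (\<integral>u. \<phi> n u \<partial>\<mu>)" for n
      by (rule LIMSEQ_le[OF lim_r[OF x] weak[OF \<phi>_cont]]) (use sandwich in auto)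
    have upper: "(\<integral>u. \<phi> n u \<partial>\<mu>) \<le> exp (- f (X n))" for n
      by (rule LIMSEQ_le[OF weak[OF \<phi>_cont] lim_r[OF X]]) (use sandwich in auto)
    \<comment> \<open>Continuity of \<open>f\<close> closes the gap between the two bounds on the
      integral of \<open>\<phi> n\<close>. In the other direction \<open>\<phi> n\<close> converges
      to the indicator of \<open>{..e x}\<close>, which identifies the measure of that set.\<close>
    have "(\<lambda>n. f (X n)) \<longlonglongrightarrow> f x"
      using continuous_on_tendsto_compose[OF cont X_lim x] X by simp
    then have "(\<lambda>n. exp (- f (X n))) \<longlonglongrightarrow> exp (- f x)"
      by (intro tendsto_intros)
    then have "(\<lambda>n. \<integral>u. \<phi> n u \<partial>\<mu>) \<longlonglongrightarrow> exp (- f x)"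
      by (rule tendsto_sandwich[rotated 2, OF tendsto_const]) (use lower upper in auto)
    moreover have "(\<lambda>n. \<integral>u. \<phi> n u \<partial>\<mu>) \<longlonglongrightarrow> (\<integral>u. indicator {..e x} u \<partial>\<mu>)"
    proof (rule integral_dominated_convergence[where w = "\<lambda>_. 1"])
      show "AE u in \<mu>. (\<lambda>n. \<phi> n u) \<longlonglongrightarrow> indicator {..e x} u"
      proof (rule AE_I2)
        fix u
        show "(\<lambda>n. \<phi> n u) \<longlonglongrightarrow> indicator {..e x} u"
        proof (cases "u \<le> e x")
          case True
          then show ?thesis
            using s_zero[of u] by (simp add: \<phi>_def)
        next
          case False
          then have "0 < s u"
            using s_zero[of u] s_nonneg[of u] by simp
          then obtain m where m: "1 < real m * s u"
            using reals_Archimedean3 by blast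
          have "\<phi> n u = 0" if "m \<le> n" for n
          proof -
            have "real m * s u \<le> real (Suc n) * s u"
              using that \<open>0 < s u\<close> by (intro mult_right_mono) auto
            then show ?thesis
              using m by (simp add: \<phi>_def)
          qed
          then have "\<forall>\<^sub>F n in sequentially. \<phi> n u = 0"
            by (auto simp: eventually_sequentially)
          then show ?thesis
            using False by (simp add: tendsto_eventually)
        qed
      qed
      show "AE u in \<mu>. norm (\<phi> n u) \<le> 1" for n
        using \<phi>_bounds by auto
    qed (auto simp: sets_\<mu>)
    ultimately have "(\<integral>u. indicator {..e x} u \<partial>\<mu>) = exp (- f x)"
      using LIMSEQ_unique by blast
    then show ?thesis
      by (simp add: sets_\<mu>)
  qed
  \<comment> \<open>Mass at \<open>u $ k = 0\<close> would be mass escaped to infinity in the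
    coordinate \<open>y $ k\<close>. The limit \<open>f\<close> still takes the value
    \<open>t\<close> at \<open>axis k t\<close>, which bounds this mass by
    \<open>exp (- real n)\<close> for every \<open>n\<close>.\<close>
  have \<mu>_pos: "AE u in \<mu>. \<forall>k. 0 < u $ k"
  proof (subst AE_all_countable, rule allI)
    fix k
    have "measure \<mu> {u. u $ k \<le> 0} \<le> exp (- real n)" for n
    proof -
      have "measure \<mu> {u. u $ k \<le> 0} \<le> measure \<mu> {..e (axis k (real n))}"
      proof (rule \<mu>.finite_measure_mono_AE)
        show "AE u in \<mu>. u \<in> {u. u $ k \<le> 0} \<longrightarrow> u \<in> {..e (axis k (real n))}"
          using \<mu>(3)
        proof eventually_elim
          case (elim u)
          have "u $ i \<le> e (axis k (real n)) $ i" if "u $ k \<le> 0" for i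
            using elim that by (auto simp: unit_cube_def e_def axis_def intro: order_trans)
          then show ?case
            by (auto simp: less_eq_vec_def)
        qed
      qed simp
      also have "\<dots> = exp (- real n)"
        by (simp add: \<mu>_e orthant_axis axis)
      finally show ?thesis .
    qed
    moreover have "(\<lambda>n. exp (- real n)) \<longlonglongrightarrow> 0"
      by real_asymp
    ultimately have "measure \<mu> {u. u $ k \<le> 0} \<le> 0"
      by (intro LIMSEQ_le_const) auto
    then have "measure \<mu> {u. u $ k \<le> 0} = 0"
      by (simp add: measure_le_0_iff)
    then have "AE u in \<mu>. \<not> u $ k \<le> 0"
      by (intro AE_I[of _ _ "{u. u $ k \<le> 0}"]) (auto simp: \<mu>.emeasure_eq_measure)
    then show "AE u in \<mu>. 0 < u $ k"
      by eventually_elim simp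
  qed
  define L :: "real ^ 'n \<Rightarrow> real ^ 'n" where "L u = (\<chi> k. - ln (u $ k))" for u
  have L [measurable]: "L \<in> borel_measurable borel"
    unfolding L_def by measurable
  have "measure (distr \<mu> borel L) {x..} = exp (- f x)" if x: "x \<in> orthant" for x
  proof -
    have "measure (distr \<mu> borel L) {x..} = measure \<mu> (L -` {x..})"
      by (subst measure_distr) (auto simp: space_\<mu>)
    also have "\<dots> = measure \<mu> {..e x}"
    proof (rule \<mu>.finite_measure_eq_AE)
      show "AE u in \<mu>. (u \<in> L -` {x..}) = (u \<in> {..e x})"
        using \<mu>_pos
      proof eventually_elim
        case (elim u)
        have "(x $ k \<le> - ln (u $ k)) = (u $ k \<le> exp (- max 0 (x $ k)))" for k
          using elim x ln_le_cancel_iff[of "u $ k" "exp (- (x $ k))"]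
          by (simp add: le_minus_iff orthant_def)
        then show ?case
          by (auto simp: L_def e_def less_eq_vec_def)
      qed
      show "L -` {x..} \<in> \<mu>.events"
        using measurable_sets_borel[OF L, of "{x..}"] by (simp add: sets_\<mu>)
    qed (simp add: sets_\<mu>)
    finally show ?thesis
      using \<mu>_e[OF x] by simp
  qed
  then show ?thesis
    using \<mu>.prob_space_distr[of L borel]
    by (intro stdf_survivalI[of f "distr \<mu> borel L"] ext hom axis) auto
qed


section \<open>Mixtures of symmetrized maxima\<close>

lemma permute_vec_nth [simp]: "permute_vec \<sigma> q $ k = q $ \<sigma> k"
  by (simp add: permute_vec_def)

lemma permute_vec_permute_vec: "permute_vec \<tau> (permute_vec \<sigma> q) = permute_vec (\<sigma> \<circ> \<tau>) q"
  by (simp add: vec_eq_iff)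

lemma permute_vec_id [simp]: "permute_vec id q = q"
  by (simp add: vec_eq_iff)

lemma permute_vec_orthant: "x \<in> orthant \<Longrightarrow> permute_vec \<sigma> x \<in> orthant"
  by (simp add: orthant_def)

lemma permute_vec_unit_simplex:
  assumes "\<sigma> permutes UNIV" "q \<in> unit_simplex"
  shows "permute_vec \<sigma> q \<in> unit_simplex"
proof -
  have "(\<Sum>k\<in>UNIV. q $ \<sigma> k) = (\<Sum>k\<in>UNIV. q $ k)"
    using sum.permute[OF assms(1), of "\<lambda>k. q $ k"] by (simp add: o_def)
  then show ?thesis
    using assms(2) by (simp add: unit_simplex_def unit_cube_def)
qed

lemma continuous_on_permute_vec [continuous_intros]:
  "continuous_on A f \<Longrightarrow> continuous_on A (\<lambda>z. permute_vec \<sigma> (f z))"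
  unfolding permute_vec_def by (intro continuous_intros)

lemma wmax_permute_vec:
  assumes "\<sigma> permutes UNIV"
  shows "wmax (permute_vec \<sigma> x) (permute_vec \<sigma> q) = wmax x q"
proof -
  have "range (\<lambda>k. x $ \<sigma> k * q $ \<sigma> k) = (\<lambda>k. x $ k * q $ k) ` range \<sigma>"
    by auto
  then show ?thesis
    using permutes_surj[OF assms] by (simp add: wmax_def)
qed

lemma wmax_permute_vec_inv:
  assumes "\<sigma> permutes UNIV"
  shows "wmax (permute_vec (inv \<sigma>) x) q = wmax x (permute_vec \<sigma> q)"
  using wmax_permute_vec[OF assms, of "permute_vec (inv \<sigma>) x" q] permutes_inv_o(2)[OF assms]
  by (simp add: permute_vec_permute_vec)

lemma ell_eq:
  "x \<in> orthant \<Longrightarrow>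
     ell q x = (\<Sum>\<sigma> | \<sigma> permutes UNIV. wmax x (permute_vec \<sigma> q)) / fact (CARD('n) - 1)"
  for q :: "real ^ 'n"
  by (simp add: ell_def wmax_def)

lemma ell_extensional: "ell q \<in> extensional orthant"
  by (simp add: ell_def)

lemma ell_permute_vec_left:
  assumes "\<tau> permutes UNIV" "x \<in> orthant"
  shows "ell q (permute_vec \<tau> x) = ell q x"
  using assms by (simp add: ell_eq permute_vec_orthant)
    (subst sum_permutations_compose_right[OF assms(1)],
      simp add: wmax_permute_vec flip: permute_vec_permute_vec)

lemma ell_permute_vec_right:
  assumes "\<tau> permutes UNIV"
  shows "ell (permute_vec \<tau> q) = ell q"
proof
  fix x
  show "ell (permute_vec \<tau> q) x = ell q x"
  proof (cases "x \<in> orthant")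
    case True
    then show ?thesis
      using setum_permutations_compose_left[OF assms, of "\<lambda>\<sigma>. wmax x (permute_vec \<sigma> q)"]
      by (simp add: ell_eq permute_vec_permute_vec)
  next
    case False
    then show ?thesis
      by (simp add: ell_def)
  qed
qed

lemma ell_perm_rel: "(q, r) \<in> perm_rel \<Longrightarrow> ell q = ell r"
  by (auto simp: perm_rel_def ell_permute_vec_right)

lemma continuous_on_ell_left: "x \<in> orthant \<Longrightarrow> continuous_on A (\<lambda>q. ell q x)"
  by (simp add: ell_eq) (intro continuous_intros, simp)

lemma continuous_on_ell: "continuous_on orthant (ell q)"
  by (subst continuous_on_cong[OF refl ell_eq]) (auto intro!: continuous_intros)

lemma borel_measurable_ell: "x \<in> orthant \<Longrightarrow> (\<lambda>q. ell q x) \<in> borel_measurable borel"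
  by (intro borel_measurable_continuous_onI continuous_on_ell_left)

text \<open>Composition with a transposition shows that the sum does not depend on \<open>k\<close>;
  adding over \<open>k\<close> then gives d! times the coordinate sum. Thus the factor 1/(d-1)! in
  \<open>ell\<close> normalizes the margins for every \<open>q\<close> in the simplex.\<close>

lemma sum_permutations_component:
  fixes q :: "real ^ 'n"
  shows "(\<Sum>\<sigma> | \<sigma> permutes UNIV. q $ \<sigma> k) = fact (CARD('n) - 1) * (\<Sum>j\<in>UNIV. q $ j)"
proof -
  define P where "P = {\<sigma> :: 'n \<Rightarrow> 'n. \<sigma> permutes UNIV}"
  have P: "card P = fact CARD('n)"
    unfolding P_def by (rule card_permutations) auto
  have const: "(\<Sum>\<sigma>\<in>P. q $ \<sigma> j) = (\<Sum>\<sigma>\<in>P. q $ \<sigma> k)" for j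
    using sum_permutations_compose_right[of "Transposition.transpose k j" UNIV "\<lambda>\<sigma>. q $ \<sigma> j"]
    by (simp add: P_def permutes_swap_id)
  have "CARD('n) * (\<Sum>\<sigma>\<in>P. q $ \<sigma> k) = (\<Sum>j\<in>UNIV. \<Sum>\<sigma>\<in>P. q $ \<sigma> j)"
    by (subst const) simp
  also have "\<dots> = (\<Sum>\<sigma>\<in>P. \<Sum>j\<in>UNIV. q $ \<sigma> j)"
    by (rule sum.swap)
  also have "\<dots> = (\<Sum>\<sigma>\<in>P. \<Sum>j\<in>UNIV. q $ j)"
  proof (rule sum.cong)
    fix \<sigma> assume "\<sigma> \<in> P"
    then show "(\<Sum>j\<in>UNIV. q $ \<sigma> j) = (\<Sum>j\<in>UNIV. q $ j)"
      using sum.permute[of \<sigma> UNIV "\<lambda>k. q $ k"] by (simp add: P_def o_def)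
  qed simp
  also have "\<dots> = CARD('n) * (fact (CARD('n) - 1) * (\<Sum>j\<in>UNIV. q $ j))"
    using P by (simp add: fact_reduce mult.assoc)
  finally show ?thesis
    by (simp add: P_def)
qed

lemma ell_axis:
  assumes "q \<in> unit_simplex" "0 \<le> t"
  shows "ell q (axis k t) = t"
proof -
  have "wmax (axis k t) (permute_vec \<sigma> q) = t * q $ \<sigma> k" for \<sigma>
    using assms unit_simplex_subset_orthant by (subst wmax_axis) (auto intro: permute_vec_orthant)
  then show ?thesis
    using assms sum_permutations_component[of q k]
    by (simp add: ell_eq orthant_axis unit_simplex_def flip: sum_distrib_left)
qed

text \<open>For positive coordinates, \<open>exp (- ell q)\<close> is a product of completely
  dependent survival functions, one for each permutation. A point on the boundary of the simplex is
  approached along the segment from the barycentre \<open>b\<close>.\<close>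

lemma stdf_ell:
  fixes q :: "real ^ 'n"
  assumes q: "q \<in> unit_simplex"
  shows "stdf (ell q)"
proof -
  have pos: "stdf (ell r)" if r: "r \<in> unit_simplex" "\<And>k. 0 < r $ k" for r :: "real ^ 'n"
  proof -
    define c where "c = 1 / (fact (CARD('n) - 1) :: real)"
    have c: "0 < c"
      by (simp add: c_def)
    have "survival_function (\<lambda>x. \<Prod>\<sigma> | \<sigma> permutes UNIV. exp (- wmax x (c *\<^sub>R permute_vec \<sigma> r)))"
      using r c by (intro survival_function_prod survival_function_exp_wmax)
        (auto intro: permutes_id finite_permutations)
    moreover have "(\<Prod>\<sigma> | \<sigma> permutes UNIV. exp (- wmax x (c *\<^sub>R permute_vec \<sigma> r))) = exp (- ell r x)"
      if "x \<in> orthant" for x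
      using that c
      by (simp add: ell_eq wmax_scaleR_right sum_negf c_def finite_permutations sum_divide_distrib flip: exp_sum)
    ultimately have "survival_function (\<lambda>x. exp (- ell r x))"
      by (simp cong: survival_function_cong)
    then obtain N where N: "prob_space N" "sets N = sets borel"
      "\<And>x. x \<in> orthant \<Longrightarrow> measure N {x..} = exp (- ell r x)"
      unfolding survival_function_def by blast
    show ?thesis
    proof (rule stdf_survivalI[OF ell_extensional _ _ N])
      show "ell r (t *\<^sub>R x) = t * ell r x" if "x \<in> orthant" "0 < t" for x t
        using that by (simp add: ell_eq orthant_scaleR wmax_scaleR_left sum_distrib_left)
    qed (use r ell_axis in auto)
  qed
  define b :: "real ^ 'n" where "b = (\<chi> k. 1 / CARD('n))"
  define r where "r n = (1 - 1 / real (Suc n)) *\<^sub>R q + (1 / real (Suc n)) *\<^sub>R b" for n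
  have r: "r n \<in> unit_simplex" "0 < r n $ k" for n k
  proof -
    have q_nonneg: "0 \<le> q $ k" for k
      using q by (simp add: unit_simplex_def unit_cube_def)
    show pos: "0 < r n $ k" for k
      unfolding r_def b_def using q_nonneg[of k] by (auto intro!: add_nonneg_pos)
    have "(\<Sum>k\<in>UNIV. r n $ k) = (1 - 1 / real (Suc n)) * (\<Sum>k\<in>UNIV. q $ k) + 1 / real (Suc n)"
      by (simp add: r_def b_def sum.distrib sum_distrib_left del: of_nat_Suc)
    also have "\<dots> = 1"
      using q by (simp add: unit_simplex_def)
    finally show "r n \<in> unit_simplex"
      using pos by (intro unit_simplexI) (auto simp: orthant_def less_imp_le)
  qed
  have "r \<longlonglongrightarrow> (1 - 0) *\<^sub>R q + 0 *\<^sub>R b"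
    unfolding r_def by (intro tendsto_intros LIMSEQ_Suc lim_1_over_n)
  then have r_lim: "r \<longlonglongrightarrow> q"
    by simp
  show ?thesis
  proof (rule stdf_limit[OF ell_extensional continuous_on_ell])
    show "stdf (ell (r n))" for n
      by (rule pos[OF r])
    show "(\<lambda>n. ell (r n) x) \<longlonglongrightarrow> ell q x" if "x \<in> orthant" for x
      using continuous_on_tendsto_compose[OF continuous_on_ell_left[OF that, of UNIV] r_lim] by simp
  qed
qed

lemma ell_in_symmetric_stdfs: "q \<in> unit_simplex \<Longrightarrow> ell q \<in> symmetric_stdfs"
  by (simp add: symmetric_stdfs_def stdf_ell ell_permute_vec_left)

text \<open>Homogeneity moves the coefficients into the arguments, so the exponential of the
  negative combination is a product of two rescaled survival functions: the minimum of independent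
  vectors divided by \<open>u\<close> and by \<open>1 - u\<close>.\<close>

lemma stdf_convex_combination:
  fixes f g :: "real ^ 'n \<Rightarrow> real"
  assumes f: "stdf f" and g: "stdf g" and u: "0 < u" "u < 1"
  shows "stdf (\<lambda>x. u * f x + (1 - u) * g x)"
proof -
  note fD = stdf_survivalD[OF f] and gD = stdf_survivalD[OF g]
  have "survival_function (\<lambda>x. exp (- f x))" "survival_function (\<lambda>x. exp (- g x))"
    using fD(4) gD(4) by (simp_all add: survival_function_def)
  then have "survival_function (\<lambda>x. exp (- f (u *\<^sub>R x)) * exp (- g ((1 - u) *\<^sub>R x)))"
    using u by (intro survival_function_mult)
      (auto intro: survival_function_scale[of "\<lambda>x. exp (- f x)"] survival_function_scale[of "\<lambda>x. exp (- g x)"])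
  moreover have "exp (- f (u *\<^sub>R x)) * exp (- g ((1 - u) *\<^sub>R x)) = exp (- (u * f x + (1 - u) * g x))"
    if "x \<in> orthant" for x
    using that u by (simp add: fD(2) gD(2) flip: exp_add)
  ultimately have "survival_function (\<lambda>x. exp (- (u * f x + (1 - u) * g x)))"
    by (simp cong: survival_function_cong)
  then obtain N where N: "prob_space N" "sets N = sets borel"
    "\<And>x. x \<in> orthant \<Longrightarrow> measure N {x..} = exp (- (u * f x + (1 - u) * g x))"
    unfolding survival_function_def by blast
  show ?thesis
  proof (rule stdf_survivalI[OF _ _ _ N])
    show "(\<lambda>x. u * f x + (1 - u) * g x) \<in> extensional orthant"
      using fD(1) gD(1) by (auto simp: extensional_def algebra_simps)
  qed (simp_all add: fD(2,3) gD(2,3) algebra_simps)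
qed

lemma convex_symmetric_stdfs: "convex (symmetric_stdfs :: (real ^ 'n \<Rightarrow> real) set)"
proof (rule convexI)
  fix f g :: "real ^ 'n \<Rightarrow> real" and u v :: real
  assume *: "f \<in> symmetric_stdfs" "g \<in> symmetric_stdfs" "0 \<le> u" "0 \<le> v" "u + v = 1"
  have v: "v = 1 - u"
    using * by simp
  consider "u = 0" | "u = 1" | "0 < u" "u < 1"
    using * by linarith
  then show "u *\<^sub>R f + v *\<^sub>R g \<in> symmetric_stdfs"
  proof cases
    case 3
    have "u *\<^sub>R f + v *\<^sub>R g = (\<lambda>x. u * f x + (1 - u) * g x)"
      by (simp add: v scaleR_fun_def plus_fun_def)
    then show ?thesis
      using * stdf_convex_combination[of f g u] 3 by (simp add: symmetric_stdfs_def)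
  qed (use * in simp_all)
qed

lemma integrable_ell:
  assumes "prob_space \<nu>" "sets \<nu> = sets borel" "AE q in \<nu>. q \<in> unit_simplex" "x \<in> orthant"
  shows "integrable \<nu> (\<lambda>q. ell q x)"
  using assms(1,2,4) AE_unit_simplex_imp_unit_cube[OF assms(3)]
  by (intro integrable_continuous_on_unit_cube continuous_on_ell_left) auto

text \<open>The constant is the number d! of summands divided by (d-1)!. As it does not depend on
  \<open>q\<close>, the bound passes to mixtures.\<close>

lemma ell_diff_le:
  fixes q :: "real ^ 'n"
  assumes "q \<in> unit_simplex" "x \<in> orthant" "y \<in> orthant"
  shows "\<bar>ell q x - ell q y\<bar> \<le> CARD('n) * (\<Sum>k\<in>UNIV. \<bar>x $ k - y $ k\<bar>)"
proof -
  define P where "P = {\<sigma> :: 'n \<Rightarrow> 'n. \<sigma> permutes UNIV}"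
  have P: "card P = fact CARD('n)"
    unfolding P_def by (rule card_permutations) auto
  have "\<bar>wmax x (permute_vec \<sigma> q) - wmax y (permute_vec \<sigma> q)\<bar> \<le> (\<Sum>k\<in>UNIV. \<bar>x $ k - y $ k\<bar>)" for \<sigma>
  proof -
    have "\<bar>wmax x (permute_vec \<sigma> q) - wmax y (permute_vec \<sigma> q)\<bar>
        \<le> (\<Sum>k\<in>UNIV. \<bar>x $ k - y $ k\<bar> * \<bar>permute_vec \<sigma> q $ k\<bar>)"
      by (rule wmax_diff_le)
    also have "\<dots> \<le> (\<Sum>k\<in>UNIV. \<bar>x $ k - y $ k\<bar> * 1)"
      using assms(1) by (intro sum_mono mult_left_mono) (auto simp: unit_simplex_def unit_cube_def)
    finally show ?thesis
      by simp
  qed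
  then have "\<bar>\<Sum>\<sigma>\<in>P. wmax x (permute_vec \<sigma> q) - wmax y (permute_vec \<sigma> q)\<bar>
      \<le> (\<Sum>\<sigma>\<in>P. \<Sum>k\<in>UNIV. \<bar>x $ k - y $ k\<bar>)"
    by (intro order_trans[OF sum_abs] sum_mono)
  also have "\<dots> = fact (CARD('n) - 1) * (CARD('n) * (\<Sum>k\<in>UNIV. \<bar>x $ k - y $ k\<bar>))"
    using P by (simp add: fact_reduce)
  finally show ?thesis
    using assms by (simp add: ell_eq sum_subtractf P_def field_simps flip: diff_divide_distrib)
qed

section \<open>Mixtures over probability measures on the simplex\<close>

definition mixture :: "(real ^ 'n) measure \<Rightarrow> real ^ 'n \<Rightarrow> real" where
  "mixture \<nu> = (\<lambda>x\<in>orthant. \<integral>q. ell q x \<partial>\<nu>)"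

lemma continuous_on_mixture:
  fixes \<nu> :: "(real ^ 'n) measure"
  assumes \<nu>: "prob_space \<nu>" "sets \<nu> = sets borel" "AE q in \<nu>. q \<in> unit_simplex"
  shows "continuous_on orthant (mixture \<nu>)"
proof -
  interpret prob_space \<nu> by fact
  have bound: "\<bar>mixture \<nu> x - mixture \<nu> y\<bar> \<le> CARD('n) * (\<Sum>k\<in>UNIV. \<bar>x $ k - y $ k\<bar>)"
    if "x \<in> orthant" "y \<in> orthant" for x y
  proof -
    note int = integrable_ell[OF \<nu>]
    have "\<bar>mixture \<nu> x - mixture \<nu> y\<bar> = \<bar>\<integral>q. ell q x - ell q y \<partial>\<nu>\<bar>"
      using that by (simp add: mixture_def int Bochner_Integration.integral_diff)
    also have "\<dots> \<le> (\<integral>q. \<bar>ell q x - ell q y\<bar> \<partial>\<nu>)"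
      by (rule integral_abs_bound)
    also have "\<dots> \<le> (\<integral>q. CARD('n) * (\<Sum>k\<in>UNIV. \<bar>x $ k - y $ k\<bar>) \<partial>\<nu>)"
    proof (rule integral_mono_AE)
      show "AE q in \<nu>. \<bar>ell q x - ell q y\<bar> \<le> CARD('n) * (\<Sum>k\<in>UNIV. \<bar>x $ k - y $ k\<bar>)"
        using \<nu>(3) by eventually_elim (rule ell_diff_le[OF _ that])
    qed (use int that in auto)
    finally show ?thesis
      by (simp add: prob_space)
  qed
  show ?thesis
    unfolding continuous_on_def
  proof
    fix x :: "real ^ 'n" assume x: "x \<in> orthant"
    have "((\<lambda>y. CARD('n) * (\<Sum>k\<in>UNIV. \<bar>y $ k - x $ k\<bar>)) \<longlongrightarrow> CARD('n) * (\<Sum>k\<in>UNIV. \<bar>x $ k - x $ k\<bar>)) (at x within orthant)"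
      by (intro tendsto_intros)
    then have "((\<lambda>y. CARD('n) * (\<Sum>k\<in>UNIV. \<bar>y $ k - x $ k\<bar>)) \<longlongrightarrow> 0) (at x within orthant)"
      by simp
    then have "((\<lambda>y. mixture \<nu> y - mixture \<nu> x) \<longlongrightarrow> 0) (at x within orthant)"
    proof (rule Lim_null_comparison[rotated])
      show "\<forall>\<^sub>F y in at x within orthant. norm (mixture \<nu> y - mixture \<nu> x)
          \<le> CARD('n) * (\<Sum>k\<in>UNIV. \<bar>y $ k - x $ k\<bar>)"
        using bound x by (auto simp: eventually_at_filter)
    qed
    then show "(mixture \<nu> \<longlongrightarrow> mixture \<nu> x) (at x within orthant)"
      by (simp add: LIM_zero_iff)
  qed
qed

lemma sum_fun_apply: "(\<Sum>i\<in>I. f i) x = (\<Sum>i\<in>I. f i x)" for f :: "'i \<Rightarrow> 'a \<Rightarrow> 'b :: comm_monoid_add"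
  by (induction I rule: infinite_finite_induct) simp_all

lemma convex_unit_simplex: "convex (unit_simplex :: (real ^ 'n) set)"
proof -
  have eq: "unit_simplex = cbox 0 1 \<inter> {x :: real ^ 'n. (\<Sum>k\<in>UNIV. x $ k) = 1}"
    by (auto simp: unit_simplex_def simp flip: unit_cube_eq_cbox)
  have "convex {x :: real ^ 'n. (\<Sum>k\<in>UNIV. x $ k) = 1}"
    by (rule convexI) (simp add: sum.distrib flip: sum_distrib_left)
  then show ?thesis
    unfolding eq by (intro convex_Int convex_box)
qed

lemma unit_simplex_nonempty: "unit_simplex \<noteq> ({} :: (real ^ 'n) set)"
proof -
  have "axis k 1 \<in> (unit_simplex :: (real ^ 'n) set)" for k
    by (intro unit_simplexI orthant_axis) (simp_all add: axis_def)
  then show ?thesis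
    by blast
qed

text \<open>The nearest-point projection. It replaces statements valid only almost everywhere on the
  simplex by maps that take simplex values everywhere, for the simple approximations as well as for
  the class map.\<close>

definition simplex_retraction :: "real ^ 'n \<Rightarrow> real ^ 'n" where
  "simplex_retraction = closest_point unit_simplex"

lemma simplex_retraction_in: "simplex_retraction q \<in> unit_simplex"
  unfolding simplex_retraction_def
  by (rule closest_point_in_set[OF closed_unit_simplex unit_simplex_nonempty])

lemma simplex_retraction_eq: "q \<in> unit_simplex \<Longrightarrow> simplex_retraction q = q"
  by (simp add: simplex_retraction_def closest_point_self)

lemma continuous_on_simplex_retraction: "continuous_on A simplex_retraction"
  unfolding simplex_retraction_def
  by (rule continuous_on_closest_point[OF convex_unit_simplex closed_unit_simplex unit_simplex_nonempty])

text \<open>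
  Mixtures with finite support are convex combinations; the general case follows by approximating
  the identity of the unit simplex by simple functions.
\<close>

lemma mixture_in_symmetric_stdfs:
  fixes \<nu> :: "(real ^ 'n) measure"
  assumes \<nu>: "prob_space \<nu>" "sets \<nu> = sets borel" "AE q in \<nu>. q \<in> unit_simplex"
  shows "mixture \<nu> \<in> symmetric_stdfs"
proof -
  interpret prob_space \<nu> by fact
  have sets_\<nu> [measurable_cong]: "sets \<nu> = sets borel" by fact
  have space_\<nu> [simp]: "space \<nu> = UNIV"
    using sets_eq_imp_space_eq[OF \<nu>(2)] by simp
  obtain F where F: "\<And>i. simple_function \<nu> (F i)" "\<And>q. (\<lambda>i. F i q) \<longlonglongrightarrow> q"
    using borel_measurable_implies_sequence_metric[of "\<lambda>q. q" \<nu> undefined] by auto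
  \<comment> \<open>Simple approximations of the identity may leave the simplex; the continuous
    retraction brings their values back without disturbing the limit at points of the
    simplex.\<close>
  define G where "G i q = simplex_retraction (F i q)" for i q
  have G: "simple_function \<nu> (G i)" for i
    unfolding G_def using simple_function_compose[OF F(1)[of i], of simplex_retraction] by (simp add: o_def)
  have G_mem: "G i q \<in> unit_simplex" for i q
    by (simp add: G_def simplex_retraction_in)
  have G_lim: "(\<lambda>i. G i q) \<longlonglongrightarrow> q" if "q \<in> unit_simplex" for q
  proof -
    have "(\<lambda>i. G i q) \<longlonglongrightarrow> simplex_retraction q"
      unfolding G_def
      by (rule continuous_on_tendsto_compose[OF continuous_on_simplex_retraction[of UNIV] F(2)[of q]]) auto
    then show ?thesis
      using simplex_retraction_eq[OF that] by simp
  qed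
  have G_meas [measurable]: "G i \<in> borel_measurable \<nu>" for i
    by (rule borel_measurable_simple_function[OF G])
  \<comment> \<open>The mixture with respect to the finitely supported law of \<open>G i\<close>,
    hence a convex combination of functions already known to be admissible.\<close>
  define g where "g i = (\<Sum>s\<in>range (G i). measure \<nu> (G i -` {s}) *\<^sub>R ell s)" for i
  have fin: "finite (range (G i))" for i
    using G[of i] by (simp add: simple_function_def)
  have vimage: "G i -` {s} \<in> events" for i s
    using G[of i] simple_functionD(2) by fastforce
  have "g i \<in> symmetric_stdfs" for i
    unfolding g_def
  proof (rule convex_sum[OF fin convex_symmetric_stdfs])
    have "(\<Sum>s\<in>range (G i). measure \<nu> (G i -` {s})) = measure \<nu> (\<Union>s\<in>range (G i). G i -` {s})"
      using vimage by (intro finite_measure_finite_Union[symmetric, OF fin]) (auto simp: disjoint_family_on_def)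
    also have "(\<Union>s\<in>range (G i). G i -` {s}) = UNIV"
      by auto
    finally show "(\<Sum>s\<in>range (G i). measure \<nu> (G i -` {s})) = 1"
      using prob_space by simp
  qed (use G_mem in \<open>auto intro: ell_in_symmetric_stdfs\<close>)
  have g_eq: "g i x = (\<integral>q. ell (G i q) x \<partial>\<nu>)" for i x
  proof -
    have "ell (G i q) x = (\<Sum>s\<in>range (G i). indicator (G i -` {s}) q * ell s x)" for q
    proof -
      have "(\<Sum>s\<in>range (G i). indicator (G i -` {s}) q * ell s x)
          = (\<Sum>s\<in>range (G i). if s = G i q then ell s x else 0)"
        by (rule sum.cong) (auto simp: indicator_def)
      then show ?thesis
        using fin by simp
    qed
    then have "(\<integral>q. ell (G i q) x \<partial>\<nu>)
        = (\<integral>q. (\<Sum>s\<in>range (G i). indicator (G i -` {s}) q * ell s x) \<partial>\<nu>)"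
      by (intro Bochner_Integration.integral_cong refl)
    also have "\<dots> = (\<Sum>s\<in>range (G i). measure \<nu> (G i -` {s}) * ell s x)"
      using vimage by (subst Bochner_Integration.integral_sum) (auto simp: less_top[symmetric])
    finally show ?thesis
      by (simp add: g_def sum_fun_apply scaleR_fun_def)
  qed
  have g_lim: "(\<lambda>i. g i x) \<longlonglongrightarrow> mixture \<nu> x" if x: "x \<in> orthant" for x
  proof -
    obtain B where B: "\<And>q. q \<in> unit_simplex \<Longrightarrow> norm (ell q x) \<le> B"
      by (rule continuous_on_compact_bound[OF compact_unit_simplex continuous_on_ell_left[OF x]]) auto
    have "(\<lambda>i. \<integral>q. ell (G i q) x \<partial>\<nu>) \<longlonglongrightarrow> (\<integral>q. ell q x \<partial>\<nu>)"
    proof (rule integral_dominated_convergence[where w = "\<lambda>_. B"])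
      show "AE q in \<nu>. (\<lambda>i. ell (G i q) x) \<longlonglongrightarrow> ell q x"
        using \<nu>(3)
      proof eventually_elim
        case (elim q)
        then show ?case
          using continuous_on_tendsto_compose[OF continuous_on_ell_left[OF x, of UNIV] G_lim] by simp
      qed
      show "AE q in \<nu>. norm (ell (G i q) x) \<le> B" for i
        using B G_mem by auto
      show "(\<lambda>q. ell (G i q) x) \<in> borel_measurable \<nu>" for i
        by (rule measurable_compose[OF G_meas borel_measurable_ell[OF x]])
      show "(\<lambda>q. ell q x) \<in> borel_measurable \<nu>"
        using borel_measurable_ell[OF x] by (simp cong: measurable_cong_sets)
    qed simp
    then show ?thesis
      using x by (simp add: g_eq mixture_def)
  qed
  have "stdf (mixture \<nu>)"
  proof (rule stdf_limit[OF _ continuous_on_mixture[OF \<nu>] _ g_lim])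
    show "mixture \<nu> \<in> extensional orthant"
      by (simp add: mixture_def)
    show "stdf (g i)" for i
      using \<open>g i \<in> symmetric_stdfs\<close> by (simp add: symmetric_stdfs_def)
  qed
  then show ?thesis
    by (simp add: symmetric_stdfs_def mixture_def permute_vec_orthant ell_permute_vec_left)
qed

text \<open>By symmetry, Pickands' formula holds with \<open>q\<close> permuted by any \<sigma>.
  Adding the d! instances and cancelling the factor d leaves (d-1)!, the normalization of
  \<open>ell\<close>. Only the integrand is symmetrized; the measure is the one from Pickands'
  formula.\<close>

lemma symmetric_stdf_eq_mixture:
  fixes f :: "real ^ 'n \<Rightarrow> real"
  assumes f: "f \<in> symmetric_stdfs"
  obtains \<nu> where "prob_space \<nu>" "sets \<nu> = sets borel" "AE q in \<nu>. q \<in> unit_simplex" "f = mixture \<nu>"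
proof -
  have "stdf f" and sym: "\<And>\<sigma> x. \<sigma> permutes UNIV \<Longrightarrow> x \<in> orthant \<Longrightarrow> f (permute_vec \<sigma> x) = f x"
    using f by (auto simp: symmetric_stdfs_def)
  from \<open>stdf f\<close> obtain \<nu> where \<nu>: "prob_space \<nu>" "sets \<nu> = sets borel" "AE q in \<nu>. q \<in> unit_simplex"
    and rep: "\<And>x. x \<in> orthant \<Longrightarrow> f x = CARD('n) * (\<integral>q. wmax x q \<partial>\<nu>)"
    by (rule pickands_representation) (rule that; simp)
  define P where "P = {\<sigma> :: 'n \<Rightarrow> 'n. \<sigma> permutes UNIV}"
  have P: "card P = fact CARD('n)"
    unfolding P_def by (rule card_permutations) auto
  have "f x = (\<integral>q. ell q x \<partial>\<nu>)" if x: "x \<in> orthant" for x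
  proof -
    have int: "integrable \<nu> (\<lambda>q. wmax x (permute_vec \<sigma> q))" for \<sigma>
      using \<nu> by (intro integrable_continuous_on_unit_cube)
        (auto intro!: continuous_intros AE_unit_simplex_imp_unit_cube)
    have "f x = CARD('n) * (\<integral>q. wmax x (permute_vec \<sigma> q) \<partial>\<nu>)" if "\<sigma> \<in> P" for \<sigma>
    proof -
      have \<sigma>: "\<sigma> permutes UNIV"
        using that by (simp add: P_def)
      have "f x = f (permute_vec (inv \<sigma>) x)"
        using sym[OF permutes_inv[OF \<sigma>] x] by simp
      also have "\<dots> = CARD('n) * (\<integral>q. wmax (permute_vec (inv \<sigma>) x) q \<partial>\<nu>)"
        by (rule rep[OF permute_vec_orthant[OF x]])
      finally show ?thesis
        by (simp add: wmax_permute_vec_inv[OF \<sigma>])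
    qed
    then have "(\<Sum>\<sigma>\<in>P. f x) = (\<Sum>\<sigma>\<in>P. CARD('n) * (\<integral>q. wmax x (permute_vec \<sigma> q) \<partial>\<nu>))"
      by (rule sum.cong[OF refl])
    then have "fact CARD('n) * f x = CARD('n) * (\<integral>q. (\<Sum>\<sigma>\<in>P. wmax x (permute_vec \<sigma> q)) \<partial>\<nu>)"
      using P int by (simp add: Bochner_Integration.integral_sum flip: sum_distrib_left)
    then have "fact (CARD('n) - 1) * f x = (\<integral>q. (\<Sum>\<sigma>\<in>P. wmax x (permute_vec \<sigma> q)) \<partial>\<nu>)"
      by (simp add: fact_reduce mult.assoc)
    then show ?thesis
      using x by (simp add: ell_eq P_def field_simps)
  qed
  moreover have "f \<in> extensional orthant"
    by (rule stdf_survivalD(1)[OF \<open>stdf f\<close>])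
  ultimately have "f = mixture \<nu>"
    by (intro ext) (auto simp: mixture_def extensional_def)
  then show thesis
    by (rule that[OF \<nu>])
qed


section \<open>Representing measures on the quotient\<close>

lemma space_borel_of: "space (borel_of T) = topspace T"
  unfolding borel_of_def by (rule space_measure_of) (auto dest: openin_subset)

lemma sets_borel_of: "sets (borel_of T) = sigma_sets (topspace T) {U. openin T U}"
  unfolding borel_of_def by (rule sets_measure_of) (auto dest: openin_subset)

lemma openin_in_borel_of: "openin T U \<Longrightarrow> U \<in> sets (borel_of T)"
  by (auto simp: sets_borel_of)

lemma closedin_in_borel_of: "closedin T U \<Longrightarrow> U \<in> sets (borel_of T)"
  using sets.compl_sets[OF openin_in_borel_of[of T "topspace T - U"]]
  by (auto simp: closedin_def space_borel_of double_diff)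

lemma measurable_borel_of:
  assumes "f \<in> space M \<rightarrow> topspace T" "\<And>U. openin T U \<Longrightarrow> f -` U \<inter> space M \<in> sets M"
  shows "f \<in> M \<rightarrow>\<^sub>M borel_of T"
  unfolding borel_of_def using assms
  by (intro measurable_measure_of) (auto dest: openin_subset)

lemma topspace_perm_quotient: "topspace perm_quotient = unit_simplex // perm_rel"
  by (simp add: perm_quotient_def topspace_quotient_topology)

lemma perm_class_in_topspace: "q \<in> unit_simplex \<Longrightarrow> perm_rel `` {q} \<in> topspace perm_quotient"
  by (simp add: topspace_perm_quotient quotientI)

lemma topspace_perm_quotientE:
  assumes "c \<in> topspace perm_quotient"
  obtains q where "q \<in> unit_simplex" "c = perm_rel `` {q}"
  using assms by (auto simp: topspace_perm_quotient elim: quotientE)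

lemma openin_perm_quotient:
  "openin perm_quotient U \<longleftrightarrow>
     U \<subseteq> topspace perm_quotient \<and> openin (top_of_set unit_simplex) {q \<in> unit_simplex. perm_rel `` {q} \<in> U}"
  by (simp add: perm_quotient_def openin_quotient_topology topspace_quotient_topology)

lemma closedin_perm_quotient:
  assumes "C \<subseteq> topspace perm_quotient"
  shows "closedin perm_quotient C \<longleftrightarrow>
    closedin (top_of_set unit_simplex) {q \<in> unit_simplex. perm_rel `` {q} \<in> C}"
  using assms quotient_map_quotient_topology[of "top_of_set unit_simplex" perm_rel]
  unfolding quotient_map_closedin perm_quotient_def by auto

lemma ell_class_perm_class:
  assumes "q \<in> unit_simplex"
  shows "ell_class (perm_rel `` {q}) = ell q"
proof -
  have "q \<in> perm_rel `` {q}"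
    using equiv_class_self[OF equiv_perm_rel assms] .
  moreover have "ell r = ell q" if "r \<in> perm_rel `` {q}" for r
    using that ell_perm_rel by fastforce
  ultimately show ?thesis
    unfolding ell_class_def by (intro the_elem_image_unique) blast+
qed

lemma borel_measurable_perm_quotient:
  fixes h :: "(real ^ 'n) set \<Rightarrow> 'b :: topological_space"
  assumes "continuous_on unit_simplex (\<lambda>q. h (perm_rel `` {q}))"
  shows "h \<in> borel_measurable (borel_of perm_quotient)"
proof (rule borel_measurableI)
  fix V :: "'b set" assume V: "open V"
  have "{q \<in> unit_simplex. perm_rel `` {q} \<in> {c \<in> topspace perm_quotient. h c \<in> V}}
      = unit_simplex \<inter> (\<lambda>q. h (perm_rel `` {q})) -` V"
    using perm_class_in_topspace by auto
  moreover have "openin (top_of_set unit_simplex) (unit_simplex \<inter> (\<lambda>q. h (perm_rel `` {q})) -` V)"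
    by (rule continuous_openin_preimage_gen[OF assms V])
  ultimately have "openin perm_quotient {c \<in> topspace perm_quotient. h c \<in> V}"
    by (simp add: openin_perm_quotient)
  moreover have "h -` V \<inter> space (borel_of perm_quotient) = {c \<in> topspace perm_quotient. h c \<in> V}"
    by (auto simp: space_borel_of)
  ultimately show "h -` V \<inter> space (borel_of perm_quotient) \<in> sets (borel_of perm_quotient)"
    using openin_in_borel_of by metis
qed

lemma borel_measurable_ell_class:
  assumes "x \<in> orthant"
  shows "(\<lambda>c. ell_class c x) \<in> borel_measurable (borel_of perm_quotient)"
  using continuous_on_ell_left[OF assms, of unit_simplex]
  by (intro borel_measurable_perm_quotient) (simp add: ell_class_perm_class cong: continuous_on_cong)

lemma ell_nonneg:
  assumes "q \<in> unit_simplex" "x \<in> orthant"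
  shows "0 \<le> ell q x"
  using assms unit_simplex_subset_orthant
  by (auto simp: ell_eq intro!: divide_nonneg_nonneg sum_nonneg wmax_nonneg permute_vec_orthant)

lemma ell_class_nonneg:
  assumes "c \<in> topspace perm_quotient" "x \<in> orthant"
  shows "0 \<le> ell_class c x"
  using assms by (auto elim!: topspace_perm_quotientE simp: ell_class_perm_class ell_nonneg)

lemma integrable_ell_class:
  assumes m: "prob_space m" "sets m = sets (borel_of perm_quotient)" and x: "x \<in> orthant"
  shows "integrable m (\<lambda>c. ell_class c x)"
proof -
  interpret prob_space m by fact
  obtain B where B: "\<And>q. q \<in> unit_simplex \<Longrightarrow> norm (ell q x) \<le> B"
    by (rule continuous_on_compact_bound[OF compact_unit_simplex continuous_on_ell_left[OF x]]) auto
  show ?thesis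
  proof (rule integrable_const_bound)
    show "AE c in m. norm (ell_class c x) \<le> B"
      using sets_eq_imp_space_eq[OF m(2)] B
      by (intro AE_I2) (auto simp: space_borel_of ell_class_perm_class elim!: topspace_perm_quotientE)
    show "(\<lambda>c. ell_class c x) \<in> borel_measurable m"
      using borel_measurable_ell_class[OF x] m(2) by (simp cong: measurable_cong_sets)
  qed
qed

text \<open>The retraction extends the class map to all of space with values in the quotient, so
  that it is a measurable map on \<open>borel\<close>.\<close>

definition perm_class :: "real ^ 'n \<Rightarrow> (real ^ 'n) set" where
  "perm_class q = perm_rel `` {simplex_retraction q}"

lemma perm_class_eq: "q \<in> unit_simplex \<Longrightarrow> perm_class q = perm_rel `` {q}"
  by (simp add: perm_class_def simplex_retraction_eq)

lemma measurable_perm_class: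
  "(perm_class :: real ^ 'n \<Rightarrow> _) \<in> borel \<rightarrow>\<^sub>M borel_of perm_quotient"
proof (rule measurable_borel_of)
  show "(perm_class :: real ^ 'n \<Rightarrow> _) \<in> space borel \<rightarrow> topspace perm_quotient"
    by (simp add: perm_class_def perm_class_in_topspace simplex_retraction_in)
  fix U :: "(real ^ 'n) set set" assume "openin perm_quotient U"
  then obtain V where V: "open V" "{q \<in> unit_simplex. perm_rel `` {q} \<in> U} = unit_simplex \<inter> V"
    by (auto simp: openin_perm_quotient openin_open)
  have "perm_rel `` {r} \<in> U \<longleftrightarrow> r \<in> V" if "r \<in> unit_simplex" for r
    using V(2) that by blast
  from this[OF simplex_retraction_in] have "perm_class -` U = simplex_retraction -` V"
    unfolding perm_class_def by blast
  moreover have "open (simplex_retraction -` V)"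
    using continuous_on_simplex_retraction[of "UNIV :: (real ^ 'n) set"] V(1) by (simp add: continuous_on_open_vimage)
  ultimately show "perm_class -` U \<inter> space borel \<in> sets borel"
    by simp
qed

section \<open>Existence and uniqueness of representing measures\<close>

definition represents :: "(real ^ 'n) set measure \<Rightarrow> (real ^ 'n \<Rightarrow> real) \<Rightarrow> bool" where
  "represents m f \<longleftrightarrow> prob_space m \<and> sets m = sets (borel_of perm_quotient) \<and>
     (\<forall>x\<in>orthant. integrable m (\<lambda>c. ell_class c x) \<and> f x = (\<integral>c. ell_class c x \<partial>m))"

lemma representing_measure_exists:
  fixes f :: "real ^ 'n \<Rightarrow> real"
  assumes "f \<in> symmetric_stdfs"
  shows "\<exists>m. represents m f"
proof -
  obtain \<nu> where \<nu>: "prob_space \<nu>" "sets \<nu> = sets borel" "AE q in \<nu>. q \<in> unit_simplex" and f: "f = mixture \<nu>"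
    using assms by (rule symmetric_stdf_eq_mixture)
  interpret prob_space \<nu> by fact
  have pc: "perm_class \<in> \<nu> \<rightarrow>\<^sub>M borel_of perm_quotient"
    using measurable_perm_class \<nu>(2) by (simp cong: measurable_cong_sets)
  define m where "m = distr \<nu> (borel_of perm_quotient) perm_class"
  have m: "prob_space m" "sets m = sets (borel_of perm_quotient)"
    unfolding m_def by (auto intro: prob_space_distr pc)
  have "f x = (\<integral>c. ell_class c x \<partial>m)" if x: "x \<in> orthant" for x
  proof -
    have meas: "(\<lambda>q. ell_class (perm_class q) x) \<in> borel_measurable \<nu>"
      by (rule measurable_compose[OF pc borel_measurable_ell_class[OF x]])
    have "(\<integral>c. ell_class c x \<partial>m) = (\<integral>q. ell_class (perm_class q) x \<partial>\<nu>)"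
      unfolding m_def by (rule integral_distr[OF pc borel_measurable_ell_class[OF x]])
    also have "\<dots> = (\<integral>q. ell q x \<partial>\<nu>)"
    proof (rule integral_cong_AE[OF meas])
      show "AE q in \<nu>. ell_class (perm_class q) x = ell q x"
        using \<nu>(3) by eventually_elim (simp add: perm_class_eq ell_class_perm_class)
    qed (use borel_measurable_integrable[OF integrable_ell[OF \<nu> x]] in simp)
    finally show ?thesis
      using x by (simp add: f mixture_def)
  qed
  then show ?thesis
    using m integrable_ell_class[OF m] unfolding represents_def by blast
qed

text \<open>
  A measure on the quotient lifts to a permutation invariant measure on the simplex by spreading
  each class uniformly over its orbit; Pickands' uniqueness applies to the lift.
\<close>

definition orbit_law :: "real ^ 'n \<Rightarrow> (real ^ 'n) measure" where
  "orbit_law q = distr (measure_pmf (pmf_of_set {\<sigma>. \<sigma> permutes UNIV})) borel (\<lambda>\<sigma>. permute_vec \<sigma> q)"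

lemma sets_orbit_law [simp]: "sets (orbit_law q) = sets borel"
  by (simp add: orbit_law_def)

lemma prob_space_orbit_law: "prob_space (orbit_law q)"
  unfolding orbit_law_def by (rule measure_pmf.prob_space_distr) simp

lemma permutations_finite_nonempty:
  "finite {\<sigma> :: 'n :: finite \<Rightarrow> 'n. \<sigma> permutes UNIV}" "{\<sigma> :: 'n \<Rightarrow> 'n. \<sigma> permutes UNIV} \<noteq> {}"
  using permutes_id[of UNIV] by (auto intro: finite_permutations simp del: permutes_id)

lemma emeasure_orbit_law:
  fixes q :: "real ^ 'n"
  assumes "A \<in> sets borel"
  shows "emeasure (orbit_law q) A
    = emeasure (measure_pmf (pmf_of_set {\<sigma> :: 'n \<Rightarrow> 'n. \<sigma> permutes UNIV})) {\<sigma>. permute_vec \<sigma> q \<in> A}"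
  unfolding orbit_law_def using assms by (subst emeasure_distr) (auto simp: vimage_def)

lemma AE_orbit_law:
  assumes "q \<in> unit_simplex"
  shows "AE r in orbit_law q. r \<in> unit_simplex \<and> perm_rel `` {r} = perm_rel `` {q}"
proof -
  have *: "permute_vec \<sigma> q \<in> unit_simplex \<and> perm_rel `` {permute_vec \<sigma> q} = perm_rel `` {q}"
    if "\<sigma> permutes UNIV" for \<sigma>
  proof
    show "permute_vec \<sigma> q \<in> unit_simplex"
      by (rule permute_vec_unit_simplex[OF that assms])
    then have "(permute_vec \<sigma> q, q) \<in> perm_rel"
      using that assms by (auto simp: perm_rel_def)
    then show "perm_rel `` {permute_vec \<sigma> q} = perm_rel `` {q}"
      by (rule equiv_class_eq[OF equiv_perm_rel])
  qed
  let ?O = "(\<lambda>\<sigma>. permute_vec \<sigma> q) ` {\<sigma>. \<sigma> permutes UNIV}"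
  have "finite ?O"
    using permutations_finite_nonempty(1) by simp
  then have "?O \<in> sets borel"
    by (intro borel_closed finite_imp_closed)
  then have "AE r in orbit_law q. r \<in> ?O"
    unfolding orbit_law_def
    by (subst AE_distr_iff) (auto simp: AE_measure_pmf_iff set_pmf_of_set[OF permutations_finite_nonempty(2,1)])
  then show ?thesis
    by eventually_elim (use * in auto)
qed

text \<open>A uniform average over d! permutations, compared with the prefactor 1/(d-1)! of
  \<open>ell\<close>, leaves the factor 1/d of Pickands' formula.\<close>

lemma nn_integral_orbit_law_wmax:
  fixes q :: "real ^ 'n"
  assumes "q \<in> unit_simplex" "x \<in> orthant"
  shows "(\<integral>\<^sup>+r. ennreal (wmax x r) \<partial>orbit_law q) = ennreal (ell q x / CARD('n))"
proof -
  let ?P = "{\<sigma> :: 'n \<Rightarrow> 'n. \<sigma> permutes UNIV}"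
  have card: "card ?P = fact CARD('n)"
    by (rule card_permutations) auto
  have nonneg: "0 \<le> wmax x (permute_vec \<sigma> q)" for \<sigma>
    using assms unit_simplex_subset_orthant by (auto intro!: wmax_nonneg permute_vec_orthant)
  have "(\<integral>\<^sup>+r. ennreal (wmax x r) \<partial>orbit_law q)
      = (\<integral>\<^sup>+\<sigma>. ennreal (wmax x (permute_vec \<sigma> q)) \<partial>measure_pmf (pmf_of_set ?P))"
    unfolding orbit_law_def by (rule nn_integral_distr) auto
  also have "\<dots> = (\<Sum>\<sigma>\<in>?P. ennreal (wmax x (permute_vec \<sigma> q))) / ennreal (real (card ?P))"
    by (subst nn_integral_pmf_of_set[OF permutations_finite_nonempty(2,1)])
      (simp add: ennreal_of_nat_eq_real_of_nat)
  also have "\<dots> = ennreal ((\<Sum>\<sigma>\<in>?P. wmax x (permute_vec \<sigma> q)) / fact CARD('n))"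
    using nonneg card by (simp add: sum_ennreal divide_ennreal sum_nonneg)
  also have "(\<Sum>\<sigma>\<in>?P. wmax x (permute_vec \<sigma> q)) / fact CARD('n) = ell q x / CARD('n)"
    using assms(2) by (simp add: ell_eq fact_reduce field_simps)
  finally show ?thesis .
qed

text \<open>Composing with \<tau> on the left permutes the symmetric group and therefore preserves
  its uniform distribution.\<close>

lemma orbit_law_permute_vec:
  assumes \<tau>: "\<tau> permutes UNIV"
  shows "orbit_law (permute_vec \<tau> q) = orbit_law q"
proof -
  let ?P = "{\<sigma> :: 'a \<Rightarrow> 'a. \<sigma> permutes UNIV}"
  have "bij_betw ((\<circ>) \<tau>) ?P ?P"
    by (rule bij_betw_byWitness[where f' = "(\<circ>) (inv \<tau>)"])
      (auto simp: fun_eq_iff permutes_inverses[OF \<tau>] intro: permutes_compose[OF _ \<tau>]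
        permutes_compose[OF _ permutes_inv[OF \<tau>]])
  then have "map_pmf ((\<circ>) \<tau>) (pmf_of_set ?P) = pmf_of_set ?P"
    by (rule map_pmf_of_set_bij_betw[OF _ permutations_finite_nonempty(2,1)])
  then have "orbit_law q = distr (measure_pmf (map_pmf ((\<circ>) \<tau>) (pmf_of_set ?P))) borel (\<lambda>\<sigma>. permute_vec \<sigma> q)"
    by (simp add: orbit_law_def)
  also have "\<dots> = distr (measure_pmf (pmf_of_set ?P)) borel ((\<lambda>\<sigma>. permute_vec \<sigma> q) \<circ> (\<circ>) \<tau>)"
    by (subst map_pmf_rep_eq, subst distr_distr) auto
  also have "\<dots> = orbit_law (permute_vec \<tau> q)"
    by (simp add: orbit_law_def o_def permute_vec_permute_vec)
  finally show ?thesis ..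
qed

text \<open>The chosen representative is immaterial, since the orbit law is constant on
  classes.\<close>

definition class_law :: "(real ^ 'n) set \<Rightarrow> (real ^ 'n) measure" where
  "class_law c = orbit_law (SOME q. q \<in> c)"

lemma class_law_eq:
  assumes "q \<in> unit_simplex"
  shows "class_law (perm_rel `` {q}) = orbit_law q"
proof -
  have "q \<in> perm_rel `` {q}"
    using equiv_class_self[OF equiv_perm_rel assms] .
  then have "(SOME r. r \<in> perm_rel `` {q}) \<in> perm_rel `` {q}" (is "?r \<in> _")
    by (rule someI)
  then obtain \<sigma> where "\<sigma> permutes UNIV" "q = permute_vec \<sigma> ?r"
    by (auto simp: perm_rel_def)
  then have "orbit_law q = orbit_law ?r"
    using orbit_law_permute_vec by metis
  then show ?thesis
    by (simp add: class_law_def)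
qed

text \<open>It suffices to test closed sets \<open>A\<close>. The orbit law gives \<open>A\<close>
  mass at least \<open>y\<close> exactly when some set \<open>T\<close> of permutations of
  sufficient uniform mass sends \<open>q\<close> into \<open>A\<close>. For fixed \<open>T\<close>
  this is a closed condition, and there are only finitely many \<open>T\<close>, so the superlevel
  sets are closed in the quotient.\<close>

lemma measurable_class_law:
  "(class_law :: (real ^ 'n) set \<Rightarrow> _) \<in> borel_of perm_quotient \<rightarrow>\<^sub>M prob_algebra borel"
proof (rule measurable_prob_algebra_generated[where \<Omega> = UNIV and G = "Collect closed"])
  show "sets borel = sigma_sets UNIV (Collect closed :: (real ^ 'n) set set)"
    by (simp add: borel_eq_closed)
  show "Int_stable (Collect closed :: (real ^ 'n) set set)"
    by (auto simp: Int_stable_def)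
  show "prob_space (class_law c)" "sets (class_law c) = sets borel" for c :: "(real ^ 'n) set"
    by (simp_all add: class_law_def prob_space_orbit_law)
  fix A :: "(real ^ 'n) set" assume "A \<in> Collect closed"
  then have A: "closed A"
    by simp
  let ?P = "{\<sigma> :: 'n \<Rightarrow> 'n. \<sigma> permutes UNIV}"
  let ?U = "emeasure (measure_pmf (pmf_of_set ?P))"
  show "(\<lambda>c. emeasure (class_law c) A) \<in> borel_measurable (borel_of perm_quotient)"
  proof (rule borel_measurableI_ge)
    fix y
    let ?C = "{c \<in> topspace perm_quotient. y \<le> emeasure (class_law c) A}"
    have "{q \<in> unit_simplex. perm_rel `` {q} \<in> ?C}
        = unit_simplex \<inter> (\<Union>T\<in>{T. T \<subseteq> ?P \<and> y \<le> ?U T}. \<Inter>\<sigma>\<in>T. permute_vec \<sigma> -` A)" (is "?L = ?R")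
    proof (intro equalityI subsetI)
      fix q assume "q \<in> ?L"
      then have q: "q \<in> unit_simplex" "y \<le> emeasure (orbit_law q) A"
        by (auto simp: class_law_eq)
      have "emeasure (orbit_law q) A = ?U {\<sigma>. permute_vec \<sigma> q \<in> A}"
        using A by (simp add: emeasure_orbit_law)
      also have "\<dots> = ?U {\<sigma> \<in> ?P. permute_vec \<sigma> q \<in> A}"
        by (rule emeasure_eq_AE)
          (auto simp: AE_measure_pmf_iff set_pmf_of_set[OF permutations_finite_nonempty(2,1)])
      finally show "q \<in> ?R"
        using q by (auto intro!: exI[of _ "{\<sigma> \<in> ?P. permute_vec \<sigma> q \<in> A}"])
    next
      fix q assume "q \<in> ?R"
      then obtain T where T: "q \<in> unit_simplex" "y \<le> ?U T" "T \<subseteq> {\<sigma>. permute_vec \<sigma> q \<in> A}"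
        by auto
      have "?U T \<le> ?U {\<sigma>. permute_vec \<sigma> q \<in> A}"
        using T(3) by (rule emeasure_mono) simp
      then show "q \<in> ?L"
        using T(1,2) A by (auto simp: class_law_eq emeasure_orbit_law perm_class_in_topspace)
    qed
    moreover have "closed (\<Union>T\<in>{T. T \<subseteq> ?P \<and> y \<le> ?U T}. \<Inter>\<sigma>\<in>T. permute_vec \<sigma> -` A)"
    proof (intro closed_UN closed_INT ballI)
      show "finite {T. T \<subseteq> ?P \<and> y \<le> ?U T}"
        using permutations_finite_nonempty(1) by (rule finite_subset[rotated, OF finite_Pow_iff[THEN iffD2]]) auto
      show "closed (permute_vec \<sigma> -` A)" for \<sigma> :: "'n \<Rightarrow> 'n"
        using A continuous_on_permute_vec[OF continuous_on_id, of UNIV \<sigma>]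
        by (simp add: continuous_on_closed_vimage)
    qed
    ultimately have "closedin (top_of_set unit_simplex) {q \<in> unit_simplex. perm_rel `` {q} \<in> ?C}"
      by (simp add: closedin_closed_Int)
    then have "closedin perm_quotient ?C"
      by (subst closedin_perm_quotient) auto
    then show "{c \<in> space (borel_of perm_quotient). y \<le> emeasure (class_law c) A} \<in> sets (borel_of perm_quotient)"
      by (simp add: space_borel_of closedin_in_borel_of)
  qed
qed simp

lemma representing_measure_unique:
  fixes f :: "real ^ 'n \<Rightarrow> real"
  assumes "represents m f" "represents m' f"
  shows "m = m'"
proof -
  define lift where "lift n = n \<bind> class_law" for n :: "(real ^ 'n) set measure"
  have sub: "class_law \<in> n \<rightarrow>\<^sub>M subprob_algebra borel"
    if "sets n = sets (borel_of perm_quotient)" for n :: "(real ^ 'n) set measure"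
    using measurable_prob_algebraD[OF measurable_class_law] that by (simp cong: measurable_cong_sets)
  have lift: "prob_space (lift n)" "sets (lift n) = sets borel" "AE q in lift n. q \<in> unit_simplex"
    "\<And>x. x \<in> orthant \<Longrightarrow> (\<integral>q. wmax x q \<partial>lift n) = f x / CARD('n)"
    "\<And>A. A \<in> sets (borel_of perm_quotient) \<Longrightarrow>
      emeasure n A = emeasure (lift n) {q \<in> unit_simplex. perm_class q \<in> A}"
    if n: "represents n f" for n
  proof -
    have n': "prob_space n" "sets n = sets (borel_of perm_quotient)"
      and f: "\<And>x. x \<in> orthant \<Longrightarrow> f x = (\<integral>c. ell_class c x \<partial>n)"
      using n by (auto simp: represents_def)
    interpret prob_space n by fact
    have space_n: "space n = topspace perm_quotient"
      using sets_eq_imp_space_eq[OF n'(2)] by (simp add: space_borel_of)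
    have in_space: "n \<in> space (prob_algebra (borel_of perm_quotient))"
      using n' by (simp add: space_prob_algebra)
    show prob_lift: "prob_space (lift n)"
      unfolding lift_def by (rule prob_space_bind'[OF in_space measurable_class_law])
    show sets_lift: "sets (lift n) = sets borel"
      unfolding lift_def by (rule sets_bind'[OF in_space measurable_class_law])
    show AE_lift: "AE q in lift n. q \<in> unit_simplex"
      unfolding lift_def
    proof (subst AE_bind[OF sub[OF n'(2)]])
      show "AE c in n. AE q in class_law c. q \<in> unit_simplex"
      proof (rule AE_I2)
        fix c assume "c \<in> space n"
        then obtain q where q: "q \<in> unit_simplex" "c = perm_rel `` {q}"
          by (auto simp: space_n elim: topspace_perm_quotientE)
        show "AE q in class_law c. q \<in> unit_simplex"
          using AE_orbit_law[OF q(1)] unfolding q(2) class_law_eq[OF q(1)] by eventually_elim simp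
      qed
    qed simp
    show "(\<integral>q. wmax x q \<partial>lift n) = f x / CARD('n)" if x: "x \<in> orthant" for x
    proof -
      have f_nonneg: "0 \<le> f x"
        unfolding f[OF x] by (intro integral_nonneg_AE AE_I2) (simp add: space_n x ell_class_nonneg)
      have "(\<integral>\<^sup>+q. ennreal (wmax x q) \<partial>lift n) = (\<integral>\<^sup>+c. \<integral>\<^sup>+q. ennreal (wmax x q) \<partial>class_law c \<partial>n)"
        unfolding lift_def
        by (rule nn_integral_bind[OF measurable_compose[OF _ measurable_ennreal] sub[OF n'(2)]])
          (intro borel_measurable_continuous_onI continuous_intros)
      also have "\<dots> = (\<integral>\<^sup>+c. ennreal (ell_class c x / CARD('n)) \<partial>n)"
      proof (rule nn_integral_cong)
        fix c assume "c \<in> space n"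
        then obtain q where "q \<in> unit_simplex" "c = perm_rel `` {q}"
          by (auto simp: space_n elim: topspace_perm_quotientE)
        then show "(\<integral>\<^sup>+q. ennreal (wmax x q) \<partial>class_law c) = ennreal (ell_class c x / CARD('n))"
          using nn_integral_orbit_law_wmax[OF _ x] by (simp add: class_law_eq ell_class_perm_class)
      qed
      also have "\<dots> = ennreal (\<integral>c. ell_class c x / CARD('n) \<partial>n)"
        using integrable_ell_class[OF n' x]
        by (intro nn_integral_eq_integral) (auto simp: space_n ell_class_nonneg x)
      also have "\<dots> = ennreal (f x / CARD('n))"
        by (simp add: f[OF x])
      finally have "(\<integral>\<^sup>+q. ennreal (wmax x q) \<partial>lift n) = ennreal (f x / CARD('n))" .
      moreover have "AE q in lift n. 0 \<le> wmax x q"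
        using AE_lift by eventually_elim (use x unit_simplex_subset_orthant in \<open>auto intro: wmax_nonneg\<close>)
      moreover have "wmax x \<in> borel_measurable (lift n)"
        using borel_measurable_integrable[OF integrable_wmax[OF prob_lift sets_lift AE_lift]] .
      ultimately show ?thesis
        using f_nonneg by (subst integral_eq_nn_integral) auto
    qed
    \<comment> \<open>Each orbit law is concentrated on a single class, so pushing the lift forward
      to classes returns the original measure; this makes the lift injective.\<close>
    show "emeasure n A = emeasure (lift n) {q \<in> unit_simplex. perm_class q \<in> A}"
      if A: "A \<in> sets (borel_of perm_quotient)" for A
    proof -
      have preimage: "{q \<in> unit_simplex. perm_class q \<in> A} \<in> sets borel" (is "?B \<in> _")
      proof -
        have "?B = unit_simplex \<inter> perm_class -` A"
          by auto
        then show ?thesis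
          using measurable_sets_borel[OF measurable_perm_class A] by simp
      qed
      have "emeasure (lift n) ?B = (\<integral>\<^sup>+c. emeasure (class_law c) ?B \<partial>n)"
        unfolding lift_def by (rule emeasure_bind_prob_algebra[OF in_space measurable_class_law preimage])
      also have "\<dots> = (\<integral>\<^sup>+c. indicator A c \<partial>n)"
      proof (rule nn_integral_cong)
        fix c assume "c \<in> space n"
        then obtain q where q: "q \<in> unit_simplex" "c = perm_rel `` {q}"
          by (auto simp: space_n elim: topspace_perm_quotientE)
        interpret O: prob_space "orbit_law q"
          by (rule prob_space_orbit_law)
        have "AE r in orbit_law q. r \<in> ?B \<longleftrightarrow> c \<in> A"
          using AE_orbit_law[OF q(1)] by eventually_elim (auto simp: q perm_class_eq)
        then have "emeasure (orbit_law q) ?B = emeasure (orbit_law q) (if c \<in> A then UNIV else {})"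
          using preimage by (intro emeasure_eq_AE) auto
        also have "\<dots> = indicator A c"
          using O.emeasure_space_1 sets_eq_imp_space_eq[OF sets_orbit_law[of q]] by auto
        finally show "emeasure (class_law c) ?B = indicator A c"
          using q by (simp add: class_law_eq)
      qed
      also have "\<dots> = emeasure n A"
        using A n'(2) by simp
      finally show ?thesis ..
    qed
  qed
  have "lift m = lift m'"
    by (rule pickands_unique) (use lift assms in auto)
  then show ?thesis
    using assms lift(5)[of m] lift(5)[of m'] by (intro measure_eqI) (auto simp: represents_def)
qed


section \<open>Extreme points\<close>

lemma represents_return:
  assumes "q \<in> unit_simplex"
  shows "represents (return (borel_of perm_quotient) (perm_rel `` {q})) (ell q)"
proof -
  have c: "perm_rel `` {q} \<in> space (borel_of perm_quotient)"
    by (simp add: space_borel_of perm_class_in_topspace assms)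
  let ?m = "return (borel_of perm_quotient) (perm_rel `` {q})"
  have m: "prob_space ?m" "sets ?m = sets (borel_of perm_quotient)"
    by (simp_all add: prob_space_return[OF c])
  have "(\<integral>c. ell_class c x \<partial>?m) = ell q x" if "x \<in> orthant" for x
    using integral_return[OF c borel_measurable_ell_class[OF that]] assms
    by (simp add: ell_class_perm_class)
  then show ?thesis
    unfolding represents_def using m integrable_ell_class[OF m] by simp
qed

text \<open>The measure is realized as a two-stage experiment: a coin with success probability
  \<open>u\<close> selects \<open>mh\<close> or \<open>mg\<close>, and the class is drawn from the
  selected measure.\<close>

lemma represents_convex_combination:
  assumes mg: "represents mg g" and mh: "represents mh h" and u: "0 < u" "u < (1 :: real)"
  obtains m where "represents m (\<lambda>x. (1 - u) * g x + u * h x)"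
    "\<And>A. A \<in> sets (borel_of perm_quotient) \<Longrightarrow> measure m A = (1 - u) * measure mg A + u * measure mh A"
proof -
  define k where "k b = (if b then mh else mg)" for b
  define m where "m = measure_pmf (bernoulli_pmf u) \<bind> k"
  have g: "prob_space mg" "sets mg = sets (borel_of perm_quotient)"
    and h: "prob_space mh" "sets mh = sets (borel_of perm_quotient)"
    using mg mh by (auto simp: represents_def)
  interpret g: prob_space mg by fact
  interpret h: prob_space mh by fact
  have k: "k \<in> measure_pmf (bernoulli_pmf u) \<rightarrow>\<^sub>M prob_algebra (borel_of perm_quotient)"
    using g h by (auto simp: k_def space_prob_algebra)
  have k': "k \<in> measure_pmf (bernoulli_pmf u) \<rightarrow>\<^sub>M subprob_algebra (borel_of perm_quotient)"
    by (rule measurable_prob_algebraD[OF k])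
  have B: "measure_pmf (bernoulli_pmf u) \<in> space (prob_algebra (measure_pmf (bernoulli_pmf u)))"
    by (simp add: space_prob_algebra measure_pmf.prob_space_axioms)
  have m: "prob_space m" "sets m = sets (borel_of perm_quotient)"
    unfolding m_def by (rule prob_space_bind'[OF B k], rule sets_bind'[OF B k])
  interpret m: prob_space m by fact
  have space_eq: "space mg = topspace perm_quotient" "space mh = topspace perm_quotient"
    "space m = topspace perm_quotient"
    using sets_eq_imp_space_eq[OF g(2)] sets_eq_imp_space_eq[OF h(2)] sets_eq_imp_space_eq[OF m(2)]
    by (simp_all add: space_borel_of)
  have nn: "(\<integral>\<^sup>+c. F c \<partial>m) = ennreal u * (\<integral>\<^sup>+c. F c \<partial>mh) + ennreal (1 - u) * (\<integral>\<^sup>+c. F c \<partial>mg)"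
    if "F \<in> borel_measurable (borel_of perm_quotient)" for F
    unfolding m_def using u
    by (subst nn_integral_bind[OF that k']) (simp add: nn_integral_bernoulli_pmf k_def mult.commute)
  have "measure m A = (1 - u) * measure mg A + u * measure mh A"
    if A: "A \<in> sets (borel_of perm_quotient)" for A
  proof -
    have "ennreal (measure m A) = ennreal u * ennreal (measure mh A) + ennreal (1 - u) * ennreal (measure mg A)"
      using nn[of "indicator A"] A m(2) g(2) h(2)
      by (simp add: m.emeasure_eq_measure g.emeasure_eq_measure h.emeasure_eq_measure)
    then show ?thesis
      using u by (simp add: ennreal_mult[symmetric] ennreal_plus[symmetric] del: ennreal_plus)
  qed
  moreover have "represents m (\<lambda>x. (1 - u) * g x + u * h x)"
    unfolding represents_def
  proof (intro conjI ballI m integrable_ell_class[OF m])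
    fix x :: "real ^ 'a" assume x: "x \<in> orthant"
    have eq: "(\<integral>\<^sup>+c. ennreal (ell_class c x) \<partial>n) = ennreal (\<integral>c. ell_class c x \<partial>n)"
      "0 \<le> (\<integral>c. ell_class c x \<partial>n)"
      if n: "prob_space n" "sets n = sets (borel_of perm_quotient)" for n
    proof -
      have "AE c in n. 0 \<le> ell_class c x"
        using sets_eq_imp_space_eq[OF n(2)] x by (intro AE_I2) (simp add: space_borel_of ell_class_nonneg)
      then show "(\<integral>\<^sup>+c. ennreal (ell_class c x) \<partial>n) = ennreal (\<integral>c. ell_class c x \<partial>n)"
        "0 \<le> (\<integral>c. ell_class c x \<partial>n)"
        using integrable_ell_class[OF n x] by (auto intro: nn_integral_eq_integral integral_nonneg_AE)
    qed
    have "ennreal (\<integral>c. ell_class c x \<partial>m)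
        = ennreal u * ennreal (\<integral>c. ell_class c x \<partial>mh) + ennreal (1 - u) * ennreal (\<integral>c. ell_class c x \<partial>mg)"
      using nn[of "\<lambda>c. ennreal (ell_class c x)"] borel_measurable_ell_class[OF x]
      by (simp add: eq[OF m] eq[OF g] eq[OF h])
    then have "(\<integral>c. ell_class c x \<partial>m) = u * (\<integral>c. ell_class c x \<partial>mh) + (1 - u) * (\<integral>c. ell_class c x \<partial>mg)"
      using u eq(2)[OF m] eq(2)[OF g] eq(2)[OF h]
      by (simp add: ennreal_mult[symmetric] ennreal_plus[symmetric] del: ennreal_plus)
    then show "(1 - u) * g x + u * h x = (\<integral>c. ell_class c x \<partial>m)"
      using mg mh x by (simp add: represents_def)
  qed
  ultimately show thesis
    using that by blast
qed

lemma symmetric_stdfs_extensional: "symmetric_stdfs \<subseteq> extensional orthant"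
  using stdf_survivalD(1) by (auto simp: symmetric_stdfs_def)

lemma represents_inj:
  assumes "f \<in> extensional orthant" "g \<in> extensional orthant" "represents m f" "represents m g"
  shows "f = g"
proof
  fix x
  show "f x = g x"
    using assms by (cases "x \<in> orthant") (simp_all add: represents_def extensional_def)
qed

text \<open>If \<open>ell q\<close> lay strictly between \<open>g\<close> and \<open>h\<close>,
  uniqueness would force the mixture of their representing measures to be the point mass at the
  class of \<open>q\<close>. Point masses are extreme among probability measures, so both
  representing measures coincide, and with them \<open>g\<close> and \<open>h\<close>.\<close>

lemma ell_extreme_point:
  fixes q :: "real ^ 'n"
  assumes q: "q \<in> unit_simplex"
  shows "ell q extreme_point_of symmetric_stdfs"
  unfolding extreme_point_of_def
proof (intro conjI ballI notI)
  show "ell q \<in> symmetric_stdfs"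
    by (rule ell_in_symmetric_stdfs[OF q])
  fix g h assume gh: "g \<in> symmetric_stdfs" "h \<in> symmetric_stdfs" and "ell q \<in> open_segment g h"
  then obtain u where u: "0 < u" "u < 1" "ell q = (1 - u) *\<^sub>R g + u *\<^sub>R h" and "g \<noteq> h"
    by (auto simp: in_segment)
  obtain mg mh where mg: "represents mg g" and mh: "represents mh h"
    using representing_measure_exists gh by metis
  interpret g: prob_space mg using mg by (simp add: represents_def)
  interpret h: prob_space mh using mh by (simp add: represents_def)
  obtain m where m: "represents m (\<lambda>x. (1 - u) * g x + u * h x)"
    and m_eq: "\<And>A. A \<in> sets (borel_of perm_quotient) \<Longrightarrow> measure m A = (1 - u) * measure mg A + u * measure mh A"
    using represents_convex_combination[OF mg mh u(1,2)] by metis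
  have "(\<lambda>x. (1 - u) * g x + u * h x) = ell q"
    by (simp add: u(3) scaleR_fun_def plus_fun_def)
  then have m_return: "m = return (borel_of perm_quotient) (perm_rel `` {q})"
    using m represents_return[OF q] by (intro representing_measure_unique) auto
  have "mg = mh"
  proof (rule measure_eqI)
    show "sets mg = sets mh"
      using mg mh by (simp add: represents_def)
    fix A assume "A \<in> sets mg"
    then have A: "A \<in> sets (borel_of perm_quotient)"
      using mg by (simp add: represents_def)
    have "(1 - u) * measure mg A + u * measure mh A = indicator A (perm_rel `` {q})"
      using m_eq[OF A] A by (simp add: m_return measure_return)
    moreover have "0 \<le> (1 - u) * measure mg A" "0 \<le> u * measure mh A"
      "(1 - u) * measure mg A \<le> (1 - u) * 1" "u * measure mh A \<le> u * 1"
      using u g.prob_le_1 h.prob_le_1 by (simp_all add: mult_left_mono)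
    moreover define I where "I = (indicator A (perm_rel `` {q}) :: real)"
    ultimately have *: "(1 - u) * measure mg A + u * measure mh A = I"
      "0 \<le> (1 - u) * measure mg A" "0 \<le> u * measure mh A"
      "(1 - u) * measure mg A \<le> 1 - u" "u * measure mh A \<le> u"
      by simp_all
    \<comment> \<open>The two terms lie between 0 and their weights. A total of 0 makes both vanish,
      and a total of 1 pushes both to their upper bounds.\<close>
    have "(1 - u) * measure mg A = (1 - u) * I \<and> u * measure mh A = u * I"
    proof (cases "perm_rel `` {q} \<in> A")
      case True
      then have "(1 - u) * I = 1 - u" "u * I = u" "I = 1"
        by (simp_all add: I_def)
      then show ?thesis
        using * by linarith
    next
      case False
      then have "(1 - u) * I = 0" "u * I = 0" "I = 0"
        by (simp_all add: I_def)
      then show ?thesis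
        using * by linarith
    qed
    then have "measure mg A = measure mh A"
      using u by simp
    then show "emeasure mg A = emeasure mh A"
      by (simp add: g.emeasure_eq_measure h.emeasure_eq_measure)
  qed
  then show False
    using represents_inj mg mh gh symmetric_stdfs_extensional \<open>g \<noteq> h\<close> by blast
qed

text \<open>
  Conditioning a mixing measure of an extreme point on an event does not change the mixture. Applied
  to the event that \<open>ell q x\<close> exceeds \<open>f x\<close>, this shows that the integrand is almost surely constant.
\<close>

lemma extreme_mixture_AE_eq:
  fixes \<nu> :: "(real ^ 'n) measure"
  assumes \<nu>: "prob_space \<nu>" "sets \<nu> = sets borel" "AE q in \<nu>. q \<in> unit_simplex"
    and extreme: "mixture \<nu> extreme_point_of symmetric_stdfs" and x: "x \<in> orthant"
  shows "AE q in \<nu>. ell q x = mixture \<nu> x"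
proof -
  interpret prob_space \<nu> by fact
  have sets_\<nu> [measurable_cong]: "sets \<nu> = sets borel" by fact
  have space_\<nu> [simp]: "space \<nu> = UNIV"
    using sets_eq_imp_space_eq[OF \<nu>(2)] by simp
  note [measurable] = borel_measurable_ell[OF x]
  note int = integrable_ell[OF \<nu>]
  define cond where "cond A = density \<nu> (\<lambda>q. ennreal (indicator A q / prob A))" for A
  have cond: "mixture (cond A) \<in> symmetric_stdfs"
    "\<And>y. y \<in> orthant \<Longrightarrow> prob A * mixture (cond A) y = (\<integral>q. indicator A q * ell q y \<partial>\<nu>)"
    if A: "A \<in> sets borel" "0 < prob A" for A
  proof -
    have "emeasure (cond A) (space (cond A)) = (\<integral>\<^sup>+q. ennreal (1 / prob A) * indicator A q \<partial>\<nu>)"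
      unfolding cond_def using A
      by (subst emeasure_density) (auto simp: \<nu>(2) indicator_def intro!: nn_integral_cong)
    also have "\<dots> = ennreal (1 / prob A) * ennreal (prob A)"
      using A by (simp add: nn_integral_cmult emeasure_eq_measure \<nu>(2))
    also have "\<dots> = 1"
      using A by (simp add: ennreal_mult[symmetric])
    finally have "prob_space (cond A)"
      by (rule prob_spaceI)
    moreover have "AE q in cond A. q \<in> unit_simplex"
      unfolding cond_def using A \<nu>(3) by (subst AE_density) (auto simp: \<nu>(2) elim: eventually_mono)
    ultimately show "mixture (cond A) \<in> symmetric_stdfs"
      by (intro mixture_in_symmetric_stdfs) (simp_all add: cond_def \<nu>(2))
    fix y :: "real ^ 'n" assume y: "y \<in> orthant"
    have "(\<integral>q. ell q y \<partial>cond A) = (\<integral>q. (indicator A q / prob A) *\<^sub>R ell q y \<partial>\<nu>)"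
      unfolding cond_def using A borel_measurable_ell[OF y]
      by (intro integral_density) (auto simp: \<nu>(2) cong: measurable_cong_sets)
    then show "prob A * mixture (cond A) y = (\<integral>q. indicator A q * ell q y \<partial>\<nu>)"
      using A y by (simp add: mixture_def)
  qed
  \<comment> \<open>If both \<open>A\<close> and its complement have positive mass, the mixture is a
    proper convex combination of the two conditional mixtures, and extremality makes them equal. An
    event of full mass is treated separately, because its complement cannot be conditioned
    on.\<close>
  have cond_eq: "mixture (cond A) = mixture \<nu>" if A: "A \<in> sets borel" "0 < prob A" for A
  proof (cases "prob A = 1")
    case True
    then have AE_A: "AE q in \<nu>. q \<in> A"
      using A(1) by (subst (asm) prob_eq_1) (auto simp: \<nu>(2))
    have "mixture (cond A) y = mixture \<nu> y" if y: "y \<in> orthant" for y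
    proof -
      have "(\<integral>q. indicator A q * ell q y \<partial>\<nu>) = (\<integral>q. ell q y \<partial>\<nu>)"
        using AE_A A(1) borel_measurable_ell[OF y]
        by (intro integral_cong_AE) (auto simp: \<nu>(2) elim: eventually_mono cong: measurable_cong_sets)
      then show ?thesis
        using cond(2)[OF A y] True y by (simp add: mixture_def)
    qed
    then show ?thesis
      by (auto simp: mixture_def)
  next
    case False
    let ?u = "1 - prob A"
    have compl: "prob (- A) = ?u"
      using A(1) prob_compl[of A] by (simp add: \<nu>(2) Compl_eq_Diff_UNIV)
    have u: "0 < ?u" "?u < 1"
      using False A(2) prob_le_1[of A] by linarith+
    have A': "- A \<in> sets borel" "0 < prob (- A)"
      using A(1) u compl by auto
    have split: "mixture \<nu> y = (1 - ?u) * mixture (cond A) y + ?u * mixture (cond (- A)) y" for y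
    proof (cases "y \<in> orthant")
      case True
      have "(\<integral>q. ell q y \<partial>\<nu>) = (\<integral>q. indicator A q * ell q y + indicator (- A) q * ell q y \<partial>\<nu>)"
        by (intro Bochner_Integration.integral_cong) (auto simp: indicator_def)
      also have "\<dots> = (\<integral>q. indicator A q * ell q y \<partial>\<nu>) + (\<integral>q. indicator (- A) q * ell q y \<partial>\<nu>)"
        using A(1) int[OF True]
        integrable_mult_indicator[of _ \<nu> "\<lambda>q. ell q y"]
        by (intro Bochner_Integration.integral_add) (auto simp: \<nu>(2))
      finally show ?thesis
        using cond(2)[OF A True] cond(2)[OF A' True] True compl by (simp add: mixture_def)
    next
      case False
      then show ?thesis
        by (simp add: mixture_def algebra_simps)
    qed
    have "mixture \<nu> \<notin> open_segment (mixture (cond A)) (mixture (cond (- A)))"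
      using extreme cond(1)[OF A] cond(1)[OF A'] by (auto simp: extreme_point_of_def)
    moreover have "mixture \<nu> = (1 - ?u) *\<^sub>R mixture (cond A) + ?u *\<^sub>R mixture (cond (- A))"
      using split by (auto simp: scaleR_fun_def plus_fun_def)
    ultimately have "mixture (cond A) = mixture (cond (- A))"
      using u unfolding in_segment by blast
    then show ?thesis
      using split by (auto simp: algebra_simps)
  qed
  \<comment> \<open>Conditioning on this event leaves the mean of \<open>ell q x\<close> unchanged,
    although the integrand exceeds that mean everywhere on the event; hence the event is
    null.\<close>
  define A where "A = {q. mixture \<nu> x < ell q x}"
  have A: "A \<in> sets borel"
    unfolding A_def by measurable
  have "prob A = 0"
  proof (rule ccontr)
    assume "prob A \<noteq> 0"
    then have pos: "0 < prob A"
      by (simp add: zero_less_measure_iff)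
    have int_A: "integrable \<nu> (\<lambda>q. indicator A q * ell q x)" "integrable \<nu> (\<lambda>q. indicator A q * mixture \<nu> x)"
      using A int[OF x] integrable_mult_indicator[of A \<nu> "\<lambda>q. ell q x"]
      by (auto simp: \<nu>(2) less_top[symmetric])
    have "(\<integral>q. indicator A q * (ell q x - mixture \<nu> x) \<partial>\<nu>) = 0"
      using cond(2)[OF A pos x] cond_eq[OF A pos] int_A A
      by (simp add: right_diff_distrib Bochner_Integration.integral_diff \<nu>(2))
    moreover have "integrable \<nu> (\<lambda>q. indicator A q * (ell q x - mixture \<nu> x))"
      using int_A by (simp add: right_diff_distrib)
    ultimately have "AE q in \<nu>. indicator A q * (ell q x - mixture \<nu> x) = 0"
      by (subst (asm) integral_nonneg_eq_0_iff_AE) (auto simp: A_def indicator_def)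
    then have "AE q in \<nu>. q \<notin> A"
      by eventually_elim (auto simp: A_def)
    then have "prob A = 0"
      using A by (subst prob_eq_0) (auto simp: \<nu>(2))
    then show False
      using pos by simp
  qed
  then have le: "AE q in \<nu>. ell q x \<le> mixture \<nu> x"
    using A by (subst (asm) prob_eq_0) (auto simp: \<nu>(2) A_def not_less)
  \<comment> \<open>The integrand is now almost surely nonnegative, and its integral
    vanishes.\<close>
  have "(\<integral>q. mixture \<nu> x - ell q x \<partial>\<nu>) = 0"
    using int[OF x] x prob_space
    by (simp add: Bochner_Integration.integral_diff del: space_\<nu>) (simp add: mixture_def)
  then have "AE q in \<nu>. mixture \<nu> x - ell q x = 0"
    using int[OF x] le by (subst (asm) integral_nonneg_eq_0_iff_AE) (auto elim: eventually_mono)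
  then show ?thesis
    by eventually_elim simp
qed

text \<open>The exceptional null set in the almost sure equality depends on \<open>x\<close>. A
  countable dense subset of the orthant makes one \<open>q\<close> serve all its points at once, and
  continuity in \<open>x\<close> of both sides extends the equality to the whole orthant.\<close>

lemma extreme_point_imp_ell:
  fixes f :: "real ^ 'n \<Rightarrow> real"
  assumes extreme: "f extreme_point_of symmetric_stdfs"
  shows "\<exists>q\<in>unit_simplex. f = ell q"
proof -
  have "f \<in> symmetric_stdfs"
    using extreme by (simp add: extreme_point_of_def)
  then obtain \<nu> where \<nu>: "prob_space \<nu>" "sets \<nu> = sets borel" "AE q in \<nu>. q \<in> unit_simplex" and f: "f = mixture \<nu>"
    by (rule symmetric_stdf_eq_mixture)
  interpret prob_space \<nu> by fact
  obtain D :: "(real ^ 'n) set" where D: "countable D" "D \<subseteq> orthant" "orthant \<subseteq> closure D"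
    by (rule separable)
  have "AE q in \<nu>. \<forall>x\<in>D. ell q x = f x"
    using D(1,2) extreme_mixture_AE_eq[OF \<nu>] extreme f by (subst AE_ball_countable) auto
  with \<nu>(3) have "AE q in \<nu>. q \<in> unit_simplex \<and> (\<forall>x\<in>D. ell q x = f x)"
    by eventually_elim auto
  have "\<exists>q. q \<in> unit_simplex \<and> (\<forall>x\<in>D. ell q x = f x)" (is "\<exists>q. ?good q")
  proof (rule ccontr)
    assume "\<nexists>q. ?good q"
    then have "\<not> ?good q" for q
      by blast
    with \<open>AE q in \<nu>. ?good q\<close> have "AE q in \<nu>. False"
      by (simp only:)
    then show False
      by simp
  qed
  then obtain q where q: "q \<in> unit_simplex" "\<And>x. x \<in> D \<Longrightarrow> ell q x = f x"
    by blast
  have "f x = ell q x" if x: "x \<in> orthant" for x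
  proof -
    obtain y where y: "\<And>n. y n \<in> D" "y \<longlonglongrightarrow> x"
      using x D(3) closure_sequential[of x D] by auto
    have y_orthant: "\<forall>\<^sub>F n in sequentially. y n \<in> orthant"
      using y(1) D(2) by (intro always_eventually) blast
    have "(\<lambda>n. f (y n)) \<longlonglongrightarrow> f x"
      using continuous_on_tendsto_compose[OF continuous_on_mixture[OF \<nu>] y(2) x y_orthant] by (simp add: f)
    moreover have "(\<lambda>n. f (y n)) \<longlonglongrightarrow> ell q x"
      using continuous_on_tendsto_compose[OF continuous_on_ell y(2) x y_orthant, of q] q(2) y(1) by simp
    ultimately show ?thesis
      by (rule LIMSEQ_unique)
  qed
  then have "f = ell q"
    by (intro ext) (auto simp: f mixture_def ell_def)
  then show ?thesis
    using q(1) by blast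
qed

lemma extreme_points_eq:
  "{f :: real ^ 'n \<Rightarrow> real. f extreme_point_of symmetric_stdfs} = ell_class ` (unit_simplex // perm_rel)"
proof -
  have "unit_simplex // perm_rel = (\<lambda>q :: real ^ 'n. perm_rel `` {q}) ` unit_simplex"
    by (auto simp: quotient_def)
  then have "ell_class ` (unit_simplex // perm_rel) = (ell :: real ^ 'n \<Rightarrow> _) ` unit_simplex"
    by (simp add: image_image ell_class_perm_class cong: image_cong_simp)
  moreover have "{f :: real ^ 'n \<Rightarrow> real. f extreme_point_of symmetric_stdfs} = ell ` unit_simplex"
    using ell_extreme_point extreme_point_imp_ell by (intro equalityI subsetI) (auto simp: image_iff)
  ultimately show ?thesis
    by simp
qed

text \<open>Uniqueness of representing measures, applied to point masses. Two point masses can be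
  told apart because a singleton class is closed in the quotient: its orbit is finite.\<close>

lemma inj_on_ell_class: "inj_on ell_class (topspace perm_quotient)"
proof (rule inj_onI)
  fix b c :: "(real ^ 'n) set"
  assume b: "b \<in> topspace perm_quotient" and c: "c \<in> topspace perm_quotient" and eq: "ell_class b = ell_class c"
  obtain p where p: "p \<in> unit_simplex" "b = perm_rel `` {p}"
    using b by (rule topspace_perm_quotientE)
  obtain q where q: "q \<in> unit_simplex" "c = perm_rel `` {q}"
    using c by (rule topspace_perm_quotientE)
  have "ell p = ell q"
    using eq p q by (simp add: ell_class_perm_class)
  then have returns: "return (borel_of perm_quotient) b = return (borel_of perm_quotient) c"
    using represents_return[OF p(1)] represents_return[OF q(1)] p(2) q(2)
    by (metis representing_measure_unique)
  have "{r \<in> unit_simplex. perm_rel `` {r} \<in> {b}} \<subseteq> (\<lambda>\<sigma>. permute_vec \<sigma> p) ` {\<sigma>. \<sigma> permutes UNIV}"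
  proof
    fix r assume "r \<in> {r \<in> unit_simplex. perm_rel `` {r} \<in> {b}}"
    then have "(r, p) \<in> perm_rel"
      using p eq_equiv_class_iff[OF equiv_perm_rel] by auto
    then show "r \<in> (\<lambda>\<sigma>. permute_vec \<sigma> p) ` {\<sigma>. \<sigma> permutes UNIV}"
      by (auto simp: perm_rel_def)
  qed
  then have "finite {r \<in> unit_simplex. perm_rel `` {r} \<in> {b}}"
    using permutations_finite_nonempty(1) finite_subset by blast
  then have "closedin perm_quotient {b}"
    using b by (subst closedin_perm_quotient) (auto intro!: closed_subset finite_imp_closed)
  then have "{b} \<in> sets (borel_of perm_quotient)"
    by (rule closedin_in_borel_of)
  then have "indicator {b} b = (indicator {b} c :: ennreal)"
    using returns emeasure_return by metis
  then show "b = c"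
    by (simp split: split_indicator_asm)
qed

section \<open>Borel isomorphism between the quotient and the extreme points\<close>

lemma continuous_on_ell_family: "continuous_on unit_simplex ell"
proof (rule continuous_on_coordinatewise_then_product)
  fix x :: "real ^ 'n"
  show "continuous_on unit_simplex (\<lambda>q. ell q x)"
  proof (cases "x \<in> orthant")
    case False
    then have "ell q x = undefined" for q
      by (simp add: ell_def)
    then show ?thesis
      by simp
  qed (rule continuous_on_ell_left)
qed

lemma compact_imp_closed_fun:
  fixes A :: "('a \<Rightarrow> 'b :: metric_space) set"
  assumes "compact A"
  shows "closed A"
proof -
  have "Hausdorff_space (euclidean :: ('a \<Rightarrow> 'b) topology)"
    unfolding euclidean_product_topology[symmetric] Hausdorff_space_product_topology by simp
  then have "closedin euclidean A"
    using assms by (intro compactin_imp_closedin) simp_all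
  then show ?thesis
    by simp
qed

lemma measurable_ell_class:
  "(ell_class :: (real ^ 'n) set \<Rightarrow> _)
     \<in> borel_of perm_quotient \<rightarrow>\<^sub>M restrict_space borel (ell_class ` topspace perm_quotient)"
proof (rule measurable_restrict_space2)
  show "ell_class \<in> space (borel_of perm_quotient) \<rightarrow> ell_class ` topspace perm_quotient"
    by (simp add: space_borel_of)
  show "(ell_class :: (real ^ 'n) set \<Rightarrow> _) \<in> borel_measurable (borel_of perm_quotient)"
    using continuous_on_ell_family
    by (intro borel_measurable_perm_quotient) (simp add: ell_class_perm_class cong: continuous_on_cong)
qed

text \<open>The complement of an open set of classes comes from a compact subset of the simplex. Its
  image under \<open>ell\<close> is compact, hence closed for pointwise convergence, so preimages of
  open sets under the inverse are relatively open.\<close>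

lemma measurable_inv_ell_class:
  "inv_into (topspace perm_quotient) (ell_class :: (real ^ 'n) set \<Rightarrow> _)
     \<in> restrict_space borel (ell_class ` topspace perm_quotient) \<rightarrow>\<^sub>M borel_of perm_quotient"
  (is "?inv \<in> restrict_space borel ?E \<rightarrow>\<^sub>M _")
proof (rule measurable_borel_of)
  show "?inv \<in> space (restrict_space borel ?E) \<rightarrow> topspace perm_quotient"
    by (auto simp: space_restrict_space inv_into_into)
  fix U :: "(real ^ 'n) set set" assume U: "openin perm_quotient U"
  let ?C = "{q \<in> unit_simplex. perm_rel `` {q} \<notin> U}"
  have "openin (top_of_set unit_simplex) {q \<in> unit_simplex. perm_rel `` {q} \<in> U}"
    using U by (simp add: openin_perm_quotient)
  then have "closedin (top_of_set unit_simplex) (unit_simplex - {q \<in> unit_simplex. perm_rel `` {q} \<in> U})"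
    by (intro closedin_diff) auto
  moreover have "unit_simplex - {q \<in> unit_simplex. perm_rel `` {q} \<in> U} = ?C"
    by auto
  ultimately have "closedin (top_of_set unit_simplex) ?C"
    by simp
  then have "compact ?C"
    by (rule closedin_compact[OF compact_unit_simplex])
  then have "compact (ell ` ?C)"
    by (rule compact_continuous_image[rotated]) (rule continuous_on_subset[OF continuous_on_ell_family], auto)
  then have "closed (ell ` ?C)"
    by (rule compact_imp_closed_fun)
  moreover have "?inv -` U \<inter> space (restrict_space borel ?E) = ?E \<inter> - (ell ` ?C)"
  proof -
    have "?inv g \<in> U \<longleftrightarrow> g \<notin> ell ` ?C" if "g \<in> ?E" for g
    proof -
      obtain c where c: "c \<in> topspace perm_quotient" "g = ell_class c"
        using \<open>g \<in> ?E\<close> by auto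
      have "?inv g = c"
        using c inv_into_f_f[OF inj_on_ell_class] by simp
      moreover have "c \<notin> U \<longleftrightarrow> g \<in> ell ` ?C"
      proof
        assume "c \<notin> U"
        then show "g \<in> ell ` ?C"
          using c by (auto elim!: topspace_perm_quotientE simp: ell_class_perm_class)
      next
        assume "g \<in> ell ` ?C"
        then obtain q where q: "q \<in> unit_simplex" "perm_rel `` {q} \<notin> U" "ell_class c = ell_class (perm_rel `` {q})"
          using c by (auto simp: ell_class_perm_class)
        then have "c = perm_rel `` {q}"
          using inj_onD[OF inj_on_ell_class q(3) c(1)] perm_class_in_topspace by blast
        then show "c \<notin> U"
          using q by simp
      qed
      ultimately show ?thesis
        by blast
    qed
    then show ?thesis
      by (auto simp: space_restrict_space)
  qed
  ultimately show "?inv -` U \<inter> space (restrict_space borel ?E) \<in> sets (restrict_space borel ?E)"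
    by (auto simp: sets_restrict_space)
qed

lemma borel_measurable_evaluation: "(\<lambda>g. g x) \<in> borel_measurable (restrict_space borel E)"
  for E :: "('a \<Rightarrow> real) set"
  by (intro measurable_restrict_space1 borel_measurable_continuous_onI continuous_on_product_coordinates)

text \<open>Existence comes from pushing a representing measure on classes forward under
  \<open>ell_class\<close>. For uniqueness, two measures on the extreme points are pulled back along
  \<open>iv\<close>, coincide there, and are recovered by pushing forward again.\<close>

lemma simplex_on_symmetric_stdfs: "simplex_on orthant (symmetric_stdfs :: (real ^ 'n \<Rightarrow> real) set)"
  unfolding simplex_on_def
proof (intro conjI ballI symmetric_stdfs_extensional convex_symmetric_stdfs)
  fix f :: "real ^ 'n \<Rightarrow> real" assume f: "f \<in> symmetric_stdfs"
  define E where "E = (ell_class :: (real ^ 'n) set \<Rightarrow> _) ` topspace perm_quotient"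
  have E: "{g :: real ^ 'n \<Rightarrow> real. g extreme_point_of symmetric_stdfs} = E"
    by (simp add: E_def topspace_perm_quotient extreme_points_eq)
  define iv where "iv = inv_into (topspace perm_quotient) (ell_class :: (real ^ 'n) set \<Rightarrow> _)"
  have to_E: "ell_class \<in> borel_of perm_quotient \<rightarrow>\<^sub>M restrict_space borel E"
    unfolding E_def by (rule measurable_ell_class)
  have from_E: "iv \<in> restrict_space borel E \<rightarrow>\<^sub>M borel_of perm_quotient"
    unfolding E_def iv_def by (rule measurable_inv_ell_class)
  have inverse: "ell_class (iv g) = g" if "g \<in> E" for g
    using that by (simp add: E_def iv_def f_inv_into_f)
  let ?rep = "\<lambda>\<mu>. prob_space \<mu> \<and> sets \<mu> = sets (restrict_space borel E) \<and>
    (\<forall>x\<in>orthant. integrable \<mu> (\<lambda>g. g x) \<and> f x = (\<integral>g. g x \<partial>\<mu>))"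
  have "\<exists>!\<mu>. ?rep \<mu>"
  proof (rule ex_ex1I)
    obtain m where m: "represents m f"
      using representing_measure_exists[OF f] ..
    then have m': "prob_space m" "sets m = sets (borel_of perm_quotient)"
      by (auto simp: represents_def)
    have to_E': "ell_class \<in> m \<rightarrow>\<^sub>M restrict_space borel E"
      using to_E m'(2) by (simp cong: measurable_cong_sets)
    have "?rep (distr m (restrict_space borel E) ell_class)"
      using m prob_space.prob_space_distr[OF m'(1) to_E']
      by (auto simp: represents_def integrable_distr_eq[OF to_E' borel_measurable_evaluation]
          integral_distr[OF to_E' borel_measurable_evaluation])
    then show "\<exists>\<mu>. ?rep \<mu>" ..
  next
    fix \<mu> \<mu>' assume rep: "?rep \<mu>" "?rep \<mu>'"
    have *: "represents (distr \<mu> (borel_of perm_quotient) iv) f"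
      "distr (distr \<mu> (borel_of perm_quotient) iv) (restrict_space borel E) ell_class = \<mu>"
      if \<mu>: "?rep \<mu>" for \<mu>
    proof -
      have from_E': "iv \<in> \<mu> \<rightarrow>\<^sub>M borel_of perm_quotient"
        using from_E \<mu> by (simp cong: measurable_cong_sets)
      have space_\<mu>: "space \<mu> = E"
        using sets_eq_imp_space_eq[of \<mu> "restrict_space borel E"] \<mu> by (simp add: space_restrict_space)
      let ?m = "distr \<mu> (borel_of perm_quotient) iv"
      have m: "prob_space ?m" "sets ?m = sets (borel_of perm_quotient)"
        using \<mu> prob_space.prob_space_distr[OF _ from_E'] by auto
      show "represents ?m f"
        unfolding represents_def
      proof (intro conjI ballI m integrable_ell_class[OF m])
        fix x :: "real ^ 'n" assume x: "x \<in> orthant"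
        have "(\<integral>c. ell_class c x \<partial>?m) = (\<integral>g. ell_class (iv g) x \<partial>\<mu>)"
          by (rule integral_distr[OF from_E' borel_measurable_ell_class[OF x]])
        also have "\<dots> = (\<integral>g. g x \<partial>\<mu>)"
          by (intro Bochner_Integration.integral_cong) (simp_all add: space_\<mu> inverse)
        finally show "f x = (\<integral>c. ell_class c x \<partial>?m)"
          using \<mu> x by simp
      qed
      have "distr ?m (restrict_space borel E) ell_class = distr \<mu> (restrict_space borel E) (ell_class \<circ> iv)"
        by (rule distr_distr[OF to_E from_E'])
      also have "\<dots> = distr \<mu> \<mu> (\<lambda>g. g)"
        using \<mu> by (intro distr_cong) (simp_all add: space_\<mu> inverse)
      finally show "distr ?m (restrict_space borel E) ell_class = \<mu>"
        by (simp add: distr_id)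
    qed
    have "\<mu> = distr (distr \<mu> (borel_of perm_quotient) iv) (restrict_space borel E) ell_class"
      by (rule *(2)[OF rep(1), symmetric])
    also have "\<dots> = distr (distr \<mu>' (borel_of perm_quotient) iv) (restrict_space borel E) ell_class"
      by (simp only: representing_measure_unique[OF *(1)[OF rep(1)] *(1)[OF rep(2)]])
    also have "\<dots> = \<mu>'"
      by (rule *(2)[OF rep(2)])
    finally show "\<mu> = \<mu>'" .
  qed
  then show "\<exists>!\<mu>. prob_space \<mu> \<and>
      sets \<mu> = sets (restrict_space borel {g. g extreme_point_of symmetric_stdfs}) \<and>
      (\<forall>x\<in>orthant. integrable \<mu> (\<lambda>g. g x) \<and> f x = (\<integral>g. g x \<partial>\<mu>))"
    by (simp only: E)
qed

theorem lemma2p4: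
  assumes "CARD('n::finite) \<ge> 2"
  shows "convex (symmetric_stdfs :: (real ^ 'n \<Rightarrow> real) set) \<and>
    (\<forall>q \<in> unit_simplex :: (real ^ 'n) set. ell q \<in> symmetric_stdfs) \<and>
    (\<forall>(q :: real ^ 'n, r) \<in> perm_rel. ell q = ell r) \<and>
    (\<forall>q \<in> unit_simplex :: (real ^ 'n) set. ell_class (perm_rel `` {q}) = ell q) \<and>
    simplex_on orthant (symmetric_stdfs :: (real ^ 'n \<Rightarrow> real) set) \<and>
    {f :: real ^ 'n \<Rightarrow> real. f extreme_point_of symmetric_stdfs} =
      ell_class ` (unit_simplex // perm_rel) \<and>
    (\<forall>f \<in> symmetric_stdfs :: (real ^ 'n \<Rightarrow> real) set. \<exists>!m.
      prob_space m \<and> sets m = sets (borel_of perm_quotient) \<and>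
      (\<forall>x\<in>orthant. integrable m (\<lambda>c. ell_class c x) \<and>
        f x = (\<integral>c. ell_class c x \<partial>m)))"
proof -
  have "\<exists>!m. represents m f" if "f \<in> symmetric_stdfs" for f :: "real ^ 'n \<Rightarrow> real"
    using representing_measure_exists[OF that] representing_measure_unique by blast
  then show ?thesis
    unfolding represents_def
    by (intro conjI ballI convex_symmetric_stdfs simplex_on_symmetric_stdfs extreme_points_eq)
      (auto simp: ell_in_symmetric_stdfs ell_perm_rel ell_class_perm_class)
qed

end
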